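(* Let $n\ge 2$, $1<p<\infty$, and let $\Omega\subset\mathbb{R}^n$ be open and bounded. Suppose $\sigma\in L^\infty_+(\Omega)$ and either $\sigma\ge 1$ almost everywhere or $\sigma\le 1$ almost everywhere. Let $D=\mathrm{supp}(\sigma-1)$. Then $$\mathrm{conv}\,D=\bigcap_{\rho\in\mathbb{R}^n,\ |\rho|=1}\overline{H}_\rho,$$ where $$H_\rho=\left\{x\in\mathbb{R}^n : |I_\rho(x\cdot\rho,\tau)|\to\infty\ \text{as}\ \tau\to\infty\right\},$$ $\overline{H}_\rho$ is the closure of $H_\rho$, and $I_\rho(t,\tau)$ is the indicator function built from $\Lambda_\sigma$ and the Wolff solutions, as defined in the context.
   Context: $m$ denotes $n$-dimensional Lebesgue measure. $L^\infty_+(\Omega)=\{f\in L^\infty(\Omega;\mathbb{R}) : \operatorname{ess\,inf} f>0\}$. Dirichlet-Neumann map: let $X=W^{1,p}(\Omega)/W^{1,p}_0(\Omega)$ with dual $X'$. For $\sigma\in L^\infty_+(\Omega)$ and $f\in X$ let $u_\sigma^f$ be the unique minimizer of $E_\sigma(u)=\int_\Omega \sigma|\nabla u|^p\,dx$ over $f+W^{1,p}_0(\Omega)$. Then $\Lambda_\sigma:X\to X'$ is the (nonlinear) map $$\langle\Lambda_\sigma(f),g\rangle=\int_\Omega \sigma|\nabla u_\sigma^f|^{p-2}\nabla u_\sigma^f\cdot\nabla v^g\,dx,\qquad f,g\in X,$$ where $v^g\in W^{1,p}(\Omega)$ is any representative of $g$. $\Lambda_1$ denotes the Dirichlet-Neumann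 map for the conductivity identically $1$. Wolff solutions: fix initial data $(a_0,b_0)\in\mathbb{R}^2\setminus\{(0,0)\}$ and let $w\in C^\infty(\mathbb{R})$ be the solution with $(w(0),w'(0))=(a_0,b_0)$ of $$w''+V(w,w')w=0,\qquad V(w,w')=\frac{(2p-3)(w')^2+(p-1)w^2}{(p-1)(w')^2+w^2}.$$ It is known that $w$ exists, is periodic with some period $\lambda_p>0$, satisfies $\int_0^{\lambda_p}w(s)\,ds=0$, and that there are constants $C>c>0$ with $c<w(s)^2+w'(s)^2<C$ for all $s\in\mathbb{R}$. For each unit vector $\rho\in\mathbb{R}^n$ fix a unit vector $\rho^\perp\in\mathbb{R}^n$ with $\rho\cdot\rho^\perp=0$. For $t\in\mathbb{R}$ and $\tau>0$ put $$u_\tau(x)=e^{\tau(x\cdot\rho-t)}\,w(\tau x\cdot\rho^\perp),\qquad x\in\mathbb{R}^n,$$ which is known to solve $\mathrm{div}(|\nabla u|^{p-2}\nabla u)=0$ in $\mathbb{R}^n$, and let $f_\tau\in X$ be the class of $u_\tau|_\Omega$ (its boundary value). Indicator function: $I_\rho(t,\tau)=\tau^{-p}\langle(\Lambda_\sigma-\Lambda_1)(f_\tau),f_\tau\rangle$. Essential support: for measurable $f:\Omega\to\mathbb{R}$, $\mathrm{supp} f$ is the complement in $\Omega$ of the union of all open sets $O\subseteq\Omega$ with $f|_O=0$ almost everywhere. (Closed) essential convex hull: for measurable $A\subset\mathbb{R}^n$, $\mathrm{conv}\,A$ is the intersection of all closed half-spaces $\{x\in\mathbb{R}^n : x\cdot\rho\le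 t\}$ ($\rho\in\mathbb{R}^n$, $t\in\mathbb{R}$) such that $m(A\setminus\{x : x\cdot\rho\le t\})=0$. *)

theory Defs
  imports "HOL-Analysis.Analysis" "HOL-Probability.Essential_Supremum"
begin

section \<open>Smooth functions\<close>

text \<open>Functions on the whole space that are k times continuously differentiable, by recursion on
  directional derivatives: totally differentiable, with every directional derivative of class one
  less.\<close>

primrec C_diff :: "nat \<Rightarrow> ('a::real_normed_vector \<Rightarrow> real) \<Rightarrow> bool" where
  "C_diff 0 f \<longleftrightarrow> continuous_on UNIV f"
| "C_diff (Suc k) f \<longleftrightarrow>
     (\<forall>x. f differentiable (at x)) \<and> (\<forall>v. C_diff k (\<lambda>x. frechet_derivative f (at x) v))"

definition smooth :: "('a::real_normed_vector \<Rightarrow> real) \<Rightarrow> bool" where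
  "smooth f \<longleftrightarrow> (\<forall>k. C_diff k f)"

definition test_functions :: "'a::euclidean_space set \<Rightarrow> ('a \<Rightarrow> real) set" where
  "test_functions \<Omega> =
     {\<phi>. smooth \<phi> \<and> compact (closure {x. \<phi> x \<noteq> 0}) \<and> closure {x. \<phi> x \<noteq> 0} \<subseteq> \<Omega>}"

section \<open>Sobolev spaces\<close>

text \<open>Function spaces over \<open>\<Omega>\<close> are represented by sets of total functions whose values
  outside \<open>\<Omega>\<close> play no role. Functions that agree almost everywhere on \<open>\<Omega>\<close> are not identified
  here; in the quotient \<open>bdry_space\<close> they become equal, as \<open>W0p\<close> contains every function that
  vanishes almost everywhere on \<open>\<Omega>\<close>.\<close>

definition Lp :: "'a::euclidean_space set \<Rightarrow> real \<Rightarrow> ('a \<Rightarrow> 'b::euclidean_space) set" where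
  "Lp \<Omega> p = {u \<in> borel_measurable (lebesgue_on \<Omega>).
               integrable (lebesgue_on \<Omega>) (\<lambda>x. norm (u x) powr p)}"

definition L1_loc :: "'a::euclidean_space set \<Rightarrow> ('a \<Rightarrow> 'b::euclidean_space) set" where
  "L1_loc \<Omega> = {u. \<forall>K. compact K \<and> K \<subseteq> \<Omega> \<longrightarrow> integrable (lebesgue_on K) u}"

definition has_weak_grad ::
    "'a::euclidean_space set \<Rightarrow> ('a \<Rightarrow> real) \<Rightarrow> ('a \<Rightarrow> 'a) \<Rightarrow> bool" where
  "has_weak_grad \<Omega> u g \<longleftrightarrow> u \<in> L1_loc \<Omega> \<and> g \<in> L1_loc \<Omega> \<and>
     (\<forall>\<phi>\<in>test_functions \<Omega>. \<forall>i\<in>Basis.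
        (\<integral>x. u x * frechet_derivative \<phi> (at x) i \<partial>lebesgue_on \<Omega>)
          = - (\<integral>x. (g x \<bullet> i) * \<phi> x \<partial>lebesgue_on \<Omega>))"

text \<open>The weak gradient is unique up to null sets, so the choice is immaterial under integrals.\<close>

definition weak_grad :: "'a::euclidean_space set \<Rightarrow> ('a \<Rightarrow> real) \<Rightarrow> 'a \<Rightarrow> 'a" where
  "weak_grad \<Omega> u = (SOME g. has_weak_grad \<Omega> u g)"

definition W1p :: "'a::euclidean_space set \<Rightarrow> real \<Rightarrow> ('a \<Rightarrow> real) set" where
  "W1p \<Omega> p = {u \<in> Lp \<Omega> p. \<exists>g\<in>Lp \<Omega> p. has_weak_grad \<Omega> u g}"

definition W1p_norm :: "'a::euclidean_space set \<Rightarrow> real \<Rightarrow> ('a \<Rightarrow> real) \<Rightarrow> real" where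
  "W1p_norm \<Omega> p u = ((\<integral>x. \<bar>u x\<bar> powr p \<partial>lebesgue_on \<Omega>)
     + (\<integral>x. norm (weak_grad \<Omega> u x) powr p \<partial>lebesgue_on \<Omega>)) powr (1 / p)"

text \<open>The closure of the test functions in the Sobolev norm.\<close>

definition W0p :: "'a::euclidean_space set \<Rightarrow> real \<Rightarrow> ('a \<Rightarrow> real) set" where
  "W0p \<Omega> p = {u \<in> W1p \<Omega> p.
     \<forall>\<epsilon>>0. \<exists>\<phi>\<in>test_functions \<Omega>. W1p_norm \<Omega> p (\<lambda>x. u x - \<phi> x) < \<epsilon>}"

definition bdry_rel :: "'a::euclidean_space set \<Rightarrow> real \<Rightarrow> (('a \<Rightarrow> real) \<times> ('a \<Rightarrow> real)) set" where
  "bdry_rel \<Omega> p =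
     {(u, v). u \<in> W1p \<Omega> p \<and> v \<in> W1p \<Omega> p \<and> (\<lambda>x. v x - u x) \<in> W0p \<Omega> p}"

definition bdry_space :: "'a::euclidean_space set \<Rightarrow> real \<Rightarrow> ('a \<Rightarrow> real) set set" where
  "bdry_space \<Omega> p = W1p \<Omega> p // bdry_rel \<Omega> p"

definition bdry_class :: "'a::euclidean_space set \<Rightarrow> real \<Rightarrow> ('a \<Rightarrow> real) \<Rightarrow> ('a \<Rightarrow> real) set" where
  "bdry_class \<Omega> p u = bdry_rel \<Omega> p `` {u}"

section \<open>Conductivities and the Dirichlet-Neumann map\<close>

definition essinf :: "'a measure \<Rightarrow> ('a \<Rightarrow> real) \<Rightarrow> ereal" where
  "essinf M f = - esssup M (\<lambda>x. ereal (- f x))"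

definition Linfty_pos :: "'a::euclidean_space set \<Rightarrow> ('a \<Rightarrow> real) set" where
  "Linfty_pos \<Omega> = {\<sigma> \<in> borel_measurable (lebesgue_on \<Omega>).
     esssup (lebesgue_on \<Omega>) (\<lambda>x. ereal \<bar>\<sigma> x\<bar>) < \<infinity> \<and> essinf (lebesgue_on \<Omega>) \<sigma> > 0}"

definition energy ::
    "'a::euclidean_space set \<Rightarrow> real \<Rightarrow> ('a \<Rightarrow> real) \<Rightarrow> ('a \<Rightarrow> real) \<Rightarrow> real" where
  "energy \<Omega> p \<sigma> u = (\<integral>x. \<sigma> x * norm (weak_grad \<Omega> u x) powr p \<partial>lebesgue_on \<Omega>)"

text \<open>An element \<open>f\<close> of the quotient space is itself the affine space \<open>f + W0p \<Omega> p\<close> over which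
  the energy is minimised. The minimiser is unique up to null sets.\<close>

definition minimizer ::
    "'a::euclidean_space set \<Rightarrow> real \<Rightarrow> ('a \<Rightarrow> real) \<Rightarrow> ('a \<Rightarrow> real) set \<Rightarrow> 'a \<Rightarrow> real" where
  "minimizer \<Omega> p \<sigma> f =
     (SOME u. u \<in> f \<and> (\<forall>v\<in>f. energy \<Omega> p \<sigma> u \<le> energy \<Omega> p \<sigma> v))"

text \<open>\<open>DN_map \<Omega> p \<sigma> f g\<close> is the pairing of the functional assigned to \<open>f\<close> with \<open>g\<close>; the
  integral does not depend on the representative \<open>v\<close> of \<open>g\<close>.\<close>

definition DN_map :: "'a::euclidean_space set \<Rightarrow> real \<Rightarrow> ('a \<Rightarrow> real) \<Rightarrow>
    ('a \<Rightarrow> real) set \<Rightarrow> ('a \<Rightarrow> real) set \<Rightarrow> real" where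
  "DN_map \<Omega> p \<sigma> = (\<lambda>f\<in>bdry_space \<Omega> p. \<lambda>g\<in>bdry_space \<Omega> p.
     let u = minimizer \<Omega> p \<sigma> f; v = (SOME v. v \<in> g) in
     (\<integral>x. \<sigma> x * norm (weak_grad \<Omega> u x) powr (p - 2) * (weak_grad \<Omega> u x \<bullet> weak_grad \<Omega> v x)
        \<partial>lebesgue_on \<Omega>))"

section \<open>Wolff solutions and the indicator function\<close>

definition wolff_V :: "real \<Rightarrow> real \<Rightarrow> real \<Rightarrow> real" where
  "wolff_V p w w' = ((2 * p - 3) * w'\<^sup>2 + (p - 1) * w\<^sup>2) / ((p - 1) * w'\<^sup>2 + w\<^sup>2)"

definition wolff_profile :: "real \<Rightarrow> real \<Rightarrow> real \<Rightarrow> (real \<Rightarrow> real) \<Rightarrow> bool" where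
  "wolff_profile p a\<^sub>0 b\<^sub>0 w \<longleftrightarrow> smooth w \<and> w 0 = a\<^sub>0 \<and> deriv w 0 = b\<^sub>0 \<and>
     (\<forall>s. deriv (deriv w) s + wolff_V p (w s) (deriv w s) * w s = 0)"

definition wolff_solution ::
    "(real \<Rightarrow> real) \<Rightarrow> 'a::euclidean_space \<Rightarrow> 'a \<Rightarrow> real \<Rightarrow> real \<Rightarrow> 'a \<Rightarrow> real" where
  "wolff_solution w \<rho> \<rho>' t \<tau> x = exp (\<tau> * (x \<bullet> \<rho> - t)) * w (\<tau> * (x \<bullet> \<rho>'))"

definition indicator_fn :: "'a::euclidean_space set \<Rightarrow> real \<Rightarrow> ('a \<Rightarrow> real) \<Rightarrow> (real \<Rightarrow> real) \<Rightarrow>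
    ('a \<Rightarrow> 'a) \<Rightarrow> 'a \<Rightarrow> real \<Rightarrow> real \<Rightarrow> real" where
  "indicator_fn \<Omega> p \<sigma> w perp \<rho> t \<tau> =
     (let f = bdry_class \<Omega> p (wolff_solution w \<rho> (perp \<rho>) t \<tau>) in
      \<tau> powr (- p) * (DN_map \<Omega> p \<sigma> f f - DN_map \<Omega> p (\<lambda>_. 1) f f))"

section \<open>Essential support and essential convex hull\<close>

definition ess_supp :: "'a::euclidean_space set \<Rightarrow> ('a \<Rightarrow> real) \<Rightarrow> 'a set" where
  "ess_supp \<Omega> f =
     \<Omega> - \<Union>{G. open G \<and> G \<subseteq> \<Omega> \<and> (AE x in lebesgue_on G. f x = 0)}"

text \<open>The vector \<open>\<rho>\<close> is not normalised, and \<open>\<rho> = 0\<close> is allowed. In particular the hull of a null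
  set is empty.\<close>

definition ess_conv :: "'a::euclidean_space set \<Rightarrow> 'a set" where
  "ess_conv A =
     \<Inter>{H. \<exists>\<rho> t. H = {x. x \<bullet> \<rho> \<le> t} \<and> A - H \<in> null_sets lebesgue}"

end

theory Submission
  imports Defs
begin

text \<open>
  The divergence of the indicator function is governed by the conductivity alone: for a unit vector
  \<^term>\<open>\<rho>\<close>, the indicator function at level \<^term>\<open>t\<close> tends to infinity in absolute value if and
  only if \<^term>\<open>\<sigma>\<close> differs from one on a subset of positive measure of the half-space
  \<^term>\<open>{x. x \<bullet> \<rho> > t}\<close> (lemma \<open>indicator_fn_filterlim_iff\<close>). The points \<^term>\<open>x\<close> with this
  property for \<^term>\<open>t = x \<bullet> \<rho>\<close> form an open half-space whose closure is the smallest closed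
  half-space with normal \<^term>\<open>\<rho>\<close> that contains almost all of the essential support, or else the
  empty set; intersecting over all directions gives the essential convex hull
  (lemma \<open>ess_conv_ess_supp\<close>).

  The behaviour of the indicator function rests on monotonicity. The Dirichlet-Neumann map paired
  with its own argument is the minimal energy of the class (lemma \<open>DN_map_minimal_energy\<close>). If a
  class contains a \<^term>\<open>p\<close>-harmonic function \<^term>\<open>u\<close>, then \<^term>\<open>u\<close> minimises the
  energy with conductivity one and is a competitor for the conductivity \<^term>\<open>\<sigma>\<close>, which bounds
  the difference of the minimal energies from above by the integral of
  \<^term>\<open>(\<sigma> x - 1) * norm (grad u x) powr p\<close>. Young's inequality with weight \<^term>\<open>\<sigma> x\<close>
  gives a bound from below with \<^term>\<open>\<sigma> x - 1\<close> replaced by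
  \<^term>\<open>(p - 1) * (1 - \<sigma> x powr (- 1 / (p - 1)))\<close>. As \<open>\<sigma> - 1\<close> has one sign and
  \<^term>\<open>\<sigma>\<close> stays between positive constants, the absolute value of the difference is comparable
  to the integral of \<^term>\<open>\<bar>\<sigma> x - 1\<bar> * norm (grad u x) powr p\<close>
  (lemma \<open>DN_difference_comparable\<close>).

  For a Wolff solution the density \<^term>\<open>norm (grad u x) powr p\<close> is
  \<^term>\<open>\<tau> powr p * exp (p * \<tau> * (x \<bullet> \<rho> - t))\<close> times a factor that lies between two positive
  constants, thanks to a first integral of the ordinary differential equation (lemma \<open>R_bounds\<close>).
  The indicator function is thus comparable to the integral of \<^term>\<open>\<bar>\<sigma> x - 1\<bar>\<close> against
  an exponential that explodes beyond the level \<^term>\<open>t\<close> and is at most one below it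
  (lemma \<open>exp_weight_filterlim_iff\<close>).

  All of this requires that minimizers exist. They are obtained by the direct method: the
  gradients of a minimising sequence form a Cauchy sequence by uniform convexity of the energy
  density (lemma \<open>uniform_convexity_powr\<close>), the functions themselves do so by the inequality of
  Poincare (lemma \<open>poincare\<close>), and the limit is again a Sobolev function in the same class. Weak
  gradients are unique because smooth bumps approximate the indicators of boxes.
\<close>

section \<open>Smooth functions and bump functions\<close>

lemma C_diff_SucD: "C_diff (Suc k) f \<Longrightarrow> C_diff k f"
proof (induction k arbitrary: f)
  case 0
  then show ?case
    by (auto simp: differentiable_imp_continuous_within continuous_on_eq_continuous_within)
next
  case (Suc k)
  then show ?case by auto
qed

lemma C_diff_const: "C_diff k (\<lambda>x. c)"
  by (induction k arbitrary: c) auto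

lemma frechet_derivative_at':
  "(f has_derivative f') (at x) \<Longrightarrow> frechet_derivative f (at x) = f'"
  by (rule frechet_derivative_at[symmetric])

lemma C_diff_add: "C_diff k f \<Longrightarrow> C_diff k g \<Longrightarrow> C_diff k (\<lambda>x. f x + g x)"
proof (induction k arbitrary: f g)
  case (Suc k)
  have "frechet_derivative (\<lambda>x. f x + g x) (at x) v
      = frechet_derivative f (at x) v + frechet_derivative g (at x) v" for x v
    using Suc.prems by (intro fun_cong[OF frechet_derivative_at'] has_derivative_add)
      (auto simp: frechet_derivative_works)
  with Suc show ?case by (auto intro: differentiable_add)
qed (auto intro: continuous_on_add)

lemma frechet_derivative_mult_real:
  fixes f g :: "'a::real_normed_vector \<Rightarrow> real"
  assumes "f differentiable (at x)" "g differentiable (at x)"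
  shows "frechet_derivative (\<lambda>x. f x * g x) (at x) v
      = f x * frechet_derivative g (at x) v + frechet_derivative f (at x) v * g x"
  using fun_cong[OF frechet_derivative_at'[OF has_derivative_mult[OF
        assms(1)[unfolded frechet_derivative_works] assms(2)[unfolded frechet_derivative_works]]]] .

lemma C_diff_mult: "C_diff k f \<Longrightarrow> C_diff k g \<Longrightarrow> C_diff k (\<lambda>x. f x * g x)"
proof (induction k arbitrary: f g)
  case (Suc k)
  have "frechet_derivative (\<lambda>x. f x * g x) (at x) v
      = f x * frechet_derivative g (at x) v + frechet_derivative f (at x) v * g x" for x v
    using Suc.prems by (intro frechet_derivative_mult_real) auto
  moreover have "C_diff k f" "C_diff k g"
    using Suc.prems C_diff_SucD by blast+
  ultimately show ?case
    using Suc by (auto intro!: C_diff_add Suc.IH differentiable_mult)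
qed (auto intro: continuous_on_mult)

lemma C_diff_comp_inner:
  fixes v :: "'a::real_inner"
  shows "C_diff k h \<Longrightarrow> C_diff k (\<lambda>x. h (c * (x \<bullet> v) + d))"
proof (induction k arbitrary: h)
  case 0
  then show ?case
    by (auto intro!: continuous_on_compose2[of UNIV h] continuous_intros)
next
  case (Suc k)
  have D: "((\<lambda>x. h (c * (x \<bullet> v) + d)) has_derivative
      (\<lambda>u. frechet_derivative h (at (c * (x \<bullet> v) + d)) (c * (u \<bullet> v)))) (at x)" for x
  proof -
    have "((\<lambda>x. c * (x \<bullet> v) + d) has_derivative (\<lambda>u. c * (u \<bullet> v))) (at x)"
      by (auto intro!: derivative_eq_intros)
    from diff_chain_at[OF this, of h] Suc.prems show ?thesis
      by (simp add: o_def frechet_derivative_works)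
  qed
  moreover have "frechet_derivative (\<lambda>x. h (c * (x \<bullet> v) + d)) (at x) u
      = frechet_derivative h (at (c * (x \<bullet> v) + d)) (c * (u \<bullet> v))" for x u
    by (metis D frechet_derivative_at')
  moreover have "C_diff k (\<lambda>x. frechet_derivative h (at (c * (x \<bullet> v) + d)) (c * (u \<bullet> v)))" for u
    using Suc.prems by (intro Suc.IH[where h="\<lambda>s. frechet_derivative h (at s) (c * (u \<bullet> v))"]) simp
  ultimately show ?case
    by (auto simp: differentiable_def)
qed

lemma C_diff_prod:
  "finite A \<Longrightarrow> (\<And>i. i \<in> A \<Longrightarrow> C_diff k (f i)) \<Longrightarrow> C_diff k (\<lambda>x. \<Prod>i\<in>A. f i x)"
proof (induction A rule: finite_induct)
  case empty
  show ?case by (simp add: C_diff_const)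
next
  case (insert i A)
  then have "C_diff k (\<lambda>x. f i x * (\<Prod>i\<in>A. f i x))"
    by (intro C_diff_mult) auto
  with insert.hyps show ?case by simp
qed

text \<open>The polynomial factor is there for the induction: with it the class of these functions is
  closed under differentiation, which is how \<^term>\<open>exp_flat 1\<close> is seen to be smooth.\<close>

definition exp_flat :: "real poly \<Rightarrow> real \<Rightarrow> real" where
  "exp_flat P x = (if x > 0 then poly P (1 / x) * exp (- (1 / x)) else 0)"

lemma poly_mult_exp_minus_tendsto_0: "((\<lambda>y. poly P y * exp (- y)) \<longlongrightarrow> 0) at_top" for P :: "real poly"
proof -
  have "((\<lambda>y. \<Sum>i\<le>degree P. coeff P i * (y ^ i / exp y)) \<longlongrightarrow> (\<Sum>i\<le>degree P. coeff P i * 0)) at_top"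
    by (intro tendsto_intros tendsto_power_div_exp_0)
  moreover have "(\<Sum>i\<le>degree P. coeff P i * (y ^ i / exp y)) = poly P y * exp (- y)" for y
    by (simp add: poly_altdef sum_distrib_right exp_minus divide_inverse mult.assoc)
  ultimately show ?thesis by simp
qed

lemma exp_flat_has_derivative:
  "(exp_flat P has_real_derivative exp_flat ([:0, 0, 1:] * (P - pderiv P)) x) (at x)"
proof -
  consider "x > 0" | "x < 0" | "x = 0" by linarith
  then show ?thesis
  proof cases
    case 1
    have "((\<lambda>x. poly P (1 / x) * exp (- (1 / x))) has_real_derivative
        exp_flat ([:0, 0, 1:] * (P - pderiv P)) x) (at x)"
      using 1 unfolding exp_flat_def
      by (auto intro!: derivative_eq_intros DERIV_chain2[of "poly P"] poly_DERIV
          simp: field_simps power2_eq_square)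
    then show ?thesis
      by (rule has_field_derivative_transform_within_open[where S="{0<..}"])
        (use 1 in \<open>auto simp: exp_flat_def\<close>)
  next
    case 2
    have "((\<lambda>x. 0) has_real_derivative exp_flat ([:0, 0, 1:] * (P - pderiv P)) x) (at x)"
      using 2 by (simp add: exp_flat_def)
    then show ?thesis
      by (rule has_field_derivative_transform_within_open[where S="{..<0}"])
        (use 2 in \<open>auto simp: exp_flat_def\<close>)
  next
    case 3
    \<comment> \<open>The difference quotient at zero is again of the same shape in the variable \<^term>\<open>1 / x\<close>,
      with the polynomial multiplied by its variable.\<close>
    have "((\<lambda>y. poly (pCons 0 P) y * exp (- y)) \<longlongrightarrow> 0) at_top"
      by (rule poly_mult_exp_minus_tendsto_0)
    then have "((\<lambda>x. poly (pCons 0 P) (1 / x) * exp (- (1 / x))) \<longlongrightarrow> 0) (at_right 0)"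
      by (rule filterlim_compose) (simp add: filterlim_inverse_at_top_right flip: inverse_eq_divide)
    moreover have "\<forall>\<^sub>F x in at_right 0.
        poly (pCons 0 P) (1 / x) * exp (- (1 / x)) = exp_flat P x / x"
      unfolding eventually_at_right_field by (intro exI[of _ 1]) (auto simp: exp_flat_def)
    ultimately have R: "((\<lambda>x. exp_flat P x / x) \<longlongrightarrow> 0) (at_right 0)"
      by (rule Lim_transform_eventually)
    have "\<forall>\<^sub>F x in at_left 0. 0 = exp_flat P x / x"
      unfolding eventually_at_left_field by (intro exI[of _ "-1"]) (auto simp: exp_flat_def)
    then have L: "((\<lambda>x. exp_flat P x / x) \<longlongrightarrow> 0) (at_left 0)"
      by (rule Lim_transform_eventually[OF tendsto_const])
    from R L have "((\<lambda>x. exp_flat P x / x) \<longlongrightarrow> 0) (at 0)"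
      by (simp add: filterlim_split_at)
    moreover have "exp_flat Q 0 = 0" for Q
      by (simp add: exp_flat_def)
    ultimately show ?thesis
      using 3 by (simp add: has_field_derivative_iff del: mult_pCons_left)
  qed
qed

lemma C_diff_exp_flat: "C_diff k (exp_flat P)"
proof -
  \<comment> \<open>The scalar factor absorbs the direction in which the derivative is taken.\<close>
  have "C_diff k (\<lambda>x. c * exp_flat P x)" for c
  proof (induction k arbitrary: P c)
    case 0
    show ?case
      by (intro continuous_intros continuous_at_imp_continuous_on ballI C_diff.simps(1)[THEN iffD2])
        (rule DERIV_isCont[OF exp_flat_has_derivative])
  next
    case (Suc k)
    have D: "((\<lambda>x. c * exp_flat P x) has_derivative
        (\<lambda>v. (c * v) * exp_flat ([:0, 0, 1:] * (P - pderiv P)) x)) (at x)" for x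
      using exp_flat_has_derivative[of P x]
      by (auto simp: has_field_derivative_def intro!: derivative_eq_intros)
    then have "frechet_derivative (\<lambda>x. c * exp_flat P x) (at x) v
        = (c * v) * exp_flat ([:0, 0, 1:] * (P - pderiv P)) x" for x v
      by (metis frechet_derivative_at')
    moreover have "(\<lambda>x. c * exp_flat P x) differentiable at x" for x
      using D by (rule differentiableI)
    ultimately show ?case
      using Suc.IH by (simp del: mult_pCons_left)
  qed
  from this[of 1] show ?thesis by simp
qed

text \<open>The factors are flat exponentials of the distances to the faces of the box. Stretching them
  by \<^term>\<open>k\<close> makes the bumps converge to the indicator of the open box, so that test functions
  detect integrals over boxes.\<close>

definition box_bump :: "'a::euclidean_space \<Rightarrow> 'a \<Rightarrow> nat \<Rightarrow> 'a \<Rightarrow> real" where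
  "box_bump a b k x = (\<Prod>i\<in>Basis. exp_flat 1 (real k * (x \<bullet> i - a \<bullet> i)) * exp_flat 1 (real k * (b \<bullet> i
      - x \<bullet> i)))"

lemma smooth_box_bump: "smooth (box_bump a b k)"
proof -
  have "C_diff j (\<lambda>x. exp_flat 1 (real k * (x \<bullet> i) + - real k * (a \<bullet> i))
      * exp_flat 1 (- real k * (x \<bullet> i) + real k * (b \<bullet> i)))" for j and i :: 'a
    by (intro C_diff_mult C_diff_comp_inner C_diff_exp_flat)
  then have "C_diff j (\<lambda>x. \<Prod>i\<in>Basis. exp_flat 1 (real k * (x \<bullet> i) + - real k * (a \<bullet> i))
      * exp_flat 1 (- real k * (x \<bullet> i) + real k * (b \<bullet> i)))" for j
    by (intro C_diff_prod) auto
  then show ?thesis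
    by (simp add: smooth_def box_bump_def[abs_def] algebra_simps)
qed

lemma box_bump_bounds: "0 \<le> box_bump a b k x" "box_bump a b k x \<le> 1"
proof -
  have "0 \<le> exp_flat 1 s \<and> exp_flat 1 s \<le> 1" for s by (auto simp: exp_flat_def)
  then show "0 \<le> box_bump a b k x" "box_bump a b k x \<le> 1"
    unfolding box_bump_def by (auto intro!: prod_nonneg prod_le_1 mult_le_one)
qed

lemma box_bump_eq_0: "x \<notin> box a b \<Longrightarrow> box_bump a b k x = 0"
proof -
  assume "x \<notin> box a b"
  then obtain i where i: "i \<in> Basis" "x \<bullet> i \<le> a \<bullet> i \<or> b \<bullet> i \<le> x \<bullet> i"
    by (auto simp: mem_box not_less)
  then have "real k * (x \<bullet> i - a \<bullet> i) \<le> 0 \<or> real k * (b \<bullet> i - x \<bullet> i) \<le> 0"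
    by (auto simp: mult_le_0_iff)
  with i show ?thesis
    unfolding box_bump_def by (intro prod_zero bexI[of _ i]) (auto simp: exp_flat_def)
qed

lemma box_bump_tendsto: "(\<lambda>k. box_bump a b k x) \<longlonglongrightarrow> indicator (box a b) x"
proof (cases "x \<in> box a b")
  case False
  then show ?thesis by (simp add: box_bump_eq_0)
next
  case True
  have *: "(\<lambda>k. exp_flat 1 (real k * s)) \<longlonglongrightarrow> 1" if "s > 0" for s
  proof -
    have "(\<lambda>k. exp (- (1 / s) * (1 / real k))) \<longlonglongrightarrow> exp (- (1 / s) * 0)"
      by (intro tendsto_intros lim_1_over_n)
    moreover have "eventually (\<lambda>k. exp (- (1 / s) * (1 / real k))
        = exp_flat 1 (real k * s)) sequentially"
      using that by (intro eventually_mono[OF eventually_gt_at_top[of 0]]) (auto simp: exp_flat_def)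
    ultimately show ?thesis by (auto intro: Lim_transform_eventually)
  qed
  have "(\<lambda>k. box_bump a b k x) \<longlonglongrightarrow> (\<Prod>i\<in>(Basis::'a set). 1 * 1)"
    unfolding box_bump_def using True by (intro tendsto_prod tendsto_mult *) (auto simp: mem_box)
  with True show ?thesis by simp
qed

lemma box_bump_test_function:
  assumes "cbox a b \<subseteq> \<Omega>"
  shows "box_bump a b k \<in> test_functions \<Omega>"
proof -
  have "{x. box_bump a b k x \<noteq> 0} \<subseteq> cbox a b"
    using box_bump_eq_0 box_subset_cbox by blast
  then have *: "closure {x. box_bump a b k x \<noteq> 0} \<subseteq> cbox a b"
    by (intro closure_minimal closed_cbox)
  then have "compact (closure {x. box_bump a b k x \<noteq> 0})"
    using compact_cbox compact_Int_closed[of "cbox a b" "closure {x. box_bump a b k x \<noteq> 0}"]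
    by (simp add: inf.absorb2)
  with * assms show ?thesis
    by (auto simp: test_functions_def smooth_box_bump)
qed

section \<open>Integration by parts\<close>

lemma has_derivative_along_line:
  assumes "F differentiable (at (x + t *\<^sub>R v))"
  shows "((\<lambda>t. F (x + t *\<^sub>R v)) has_real_derivative frechet_derivative F (at (x + t *\<^sub>R v)) v) (at t)"
proof -
  have D: "(F has_derivative frechet_derivative F (at (x + t *\<^sub>R v))) (at (x + t *\<^sub>R v))"
    using assms by (simp add: frechet_derivative_works)
  interpret bounded_linear "frechet_derivative F (at (x + t *\<^sub>R v))"
    using D by (rule has_derivative_bounded_linear)
  have "((\<lambda>t. x + t *\<^sub>R v) has_derivative (\<lambda>s. s *\<^sub>R v)) (at t)"
    by (auto intro!: derivative_eq_intros)
  from diff_chain_at[OF this D] show ?thesis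
    by (simp add: o_def has_field_derivative_def scaleR mult_commute_abs)
qed

lemma frechet_derivative_eq_0_outside:
  assumes "closed K" "\<And>x. x \<notin> K \<Longrightarrow> F x = 0" "x \<notin> K"
  shows "frechet_derivative F (at x) v = 0"
proof -
  have "((\<lambda>x. 0) has_derivative (\<lambda>v. 0)) (at x)" by simp
  then have "(F has_derivative (\<lambda>v. 0)) (at x)"
    by (rule has_derivative_transform_within_open[where s="- K"]) (use assms in auto)
  then show ?thesis by (metis frechet_derivative_at')
qed

lemma integrable_lborel_continuous_compact_support:
  fixes f :: "'a::euclidean_space \<Rightarrow> real"
  assumes "continuous_on UNIV f" "compact K" "\<And>x. x \<notin> K \<Longrightarrow> f x = 0"
  shows "integrable lborel f"
proof -
  have "integrable lborel (\<lambda>x. indicator K x *\<^sub>R f x)"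
    using assms(1) by (intro borel_integrable_compact assms(2) continuous_on_subset[OF assms(1)]) auto
  moreover have "(\<lambda>x. indicator K x *\<^sub>R f x) = f"
    using assms(3) by (auto simp: fun_eq_iff indicator_def)
  ultimately show ?thesis by simp
qed

text \<open>The integral of a difference quotient vanishes because Lebesgue measure is translation
  invariant, and the difference quotients converge boundedly on a fixed compact set.\<close>

lemma integral_directional_derivative_eq_0:
  fixes F :: "'a::euclidean_space \<Rightarrow> real"
  assumes diff: "\<And>x. F differentiable (at x)"
    and cont: "continuous_on UNIV (\<lambda>x. frechet_derivative F (at x) v)"
    and K: "compact K" "\<And>x. x \<notin> K \<Longrightarrow> F x = 0"
  shows "(\<integral>x. frechet_derivative F (at x) v \<partial>lborel) = 0"
proof -
  define D where "D x = frechet_derivative F (at x) v" for x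
  have D0: "D x = 0" if "x \<notin> K" for x
    using that K by (auto simp: D_def intro!: frechet_derivative_eq_0_outside compact_imp_closed)
  have contF: "continuous_on UNIV F"
    using diff by (auto simp: continuous_on_eq_continuous_within differentiable_imp_continuous_within)
  have contD: "continuous_on UNIV D"
    using cont by (simp add: D_def[abs_def])
  have "compact (D ` K)"
    by (intro compact_continuous_image K continuous_on_subset[OF contD]) auto
  then obtain M0 where "\<And>y. y \<in> D ` K \<Longrightarrow> norm y \<le> M0"
    by (meson bounded_iff compact_imp_bounded)
  then have M: "\<bar>D x\<bar> \<le> max M0 0" for x
    using D0[of x] by (cases "x \<in> K") force+
  obtain B where B: "\<And>x. x \<in> K \<Longrightarrow> norm x \<le> B"
    using compact_imp_bounded[OF K(1)] by (meson bounded_iff)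
  define h :: "nat \<Rightarrow> real" where "h k = 1 / real (Suc k)" for k
  have h: "0 < h k" "h k \<le> 1" for k by (auto simp: h_def)
  define q where "q k x = (F (x + h k *\<^sub>R v) - F x) / h k" for k x
  have line: "((\<lambda>t. F (x + t *\<^sub>R v)) has_real_derivative D (x + t *\<^sub>R v)) (at t)" for x t
    unfolding D_def by (rule has_derivative_along_line) (rule diff)
  have lim: "(\<lambda>k. q k x) \<longlonglongrightarrow> D x" for x
  proof -
    have "((\<lambda>t. (F (x + t *\<^sub>R v) - F x) / t) \<longlongrightarrow> D x) (at 0)"
      using line[of x 0] by (simp add: has_field_derivative_iff)
    moreover have "filterlim h (at 0) sequentially"
    proof -
      have "h \<longlonglongrightarrow> 0"
        unfolding h_def by (rule LIMSEQ_Suc[OF lim_1_over_n])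
      moreover have "h k \<noteq> 0" for k
        using h(1)[of k] by simp
      ultimately show ?thesis
        by (simp add: filterlim_at)
    qed
    ultimately show ?thesis
      unfolding q_def by (rule filterlim_compose)
  qed
  have q_bound: "\<bar>q k x\<bar> \<le> max M0 0" for k x
  proof -
    obtain z where "F (x + h k *\<^sub>R v) - F (x + 0 *\<^sub>R v) = (h k - 0) * D (x + z *\<^sub>R v)"
      using MVT2[of 0 "h k" "\<lambda>t. F (x + t *\<^sub>R v)" "\<lambda>t. D (x + t *\<^sub>R v)"] line h by blast
    then have "q k x = D (x + z *\<^sub>R v)"
      using h[of k] by (simp add: q_def)
    with M show ?thesis by metis
  qed
  have q_out: "q k x = 0" if "x \<notin> cball 0 (B + norm v)" for k x
  proof -
    have "norm (h k *\<^sub>R v) \<le> norm v"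
      using h[of k] by (simp add: mult_left_le_one_le)
    moreover have "norm x \<le> norm (x + h k *\<^sub>R v) + norm (h k *\<^sub>R v)"
      by (metis add_diff_cancel_right' norm_triangle_ineq4)
    moreover have "norm x > B + norm v" using that by simp
    ultimately have "norm (x + h k *\<^sub>R v) > B" "norm x > B"
      using norm_ge_zero[of v] by linarith+
    then have "x \<notin> K" "x + h k *\<^sub>R v \<notin> K"
      using B[of x] B[of "x + h k *\<^sub>R v"] by auto
    then show ?thesis
      by (simp add: q_def K(2))
  qed
  have Fint: "integrable lborel F"
    using contF K by (rule integrable_lborel_continuous_compact_support)
  have shift: "integrable lborel (\<lambda>x. F (x + c))" "(\<integral>x. F (x + c) \<partial>lborel) = (\<integral>x. F x \<partial>lborel)" for c
  proof -
    have [measurable]: "F \<in> borel_measurable borel"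
      using contF by (simp add: borel_measurable_continuous_onI)
    have m: "(+) c \<in> measurable lborel borel" by simp
    have "(\<integral>x. F x \<partial>distr lborel borel ((+) c)) = (\<integral>x. F (c + x) \<partial>lborel)"
      by (rule integral_distr[OF m]) simp
    then show "(\<integral>x. F (x + c) \<partial>lborel) = (\<integral>x. F x \<partial>lborel)"
      by (simp only: lborel_distr_plus add.commute)
    have "integrable (distr lborel borel ((+) c)) F \<longleftrightarrow> integrable lborel (\<lambda>x. F (c + x))"
      by (rule integrable_distr_eq[OF m]) simp
    then show "integrable lborel (\<lambda>x. F (x + c))"
      using Fint by (simp only: lborel_distr_plus add.commute)
  qed
  have q0: "(\<integral>x. q k x \<partial>lborel) = 0" for k
    using Fint shift[of "h k *\<^sub>R v"] by (simp add: q_def)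
  have "(\<lambda>k. \<integral>x. q k x \<partial>lborel) \<longlonglongrightarrow> (\<integral>x. D x \<partial>lborel)"
  proof (rule integral_dominated_convergence[where w="\<lambda>x. max M0 0 * indicator (cball 0 (B
      + norm v)) x"])
    have [measurable]: "F \<in> borel_measurable borel" "D \<in> borel_measurable borel"
      using contF contD by (simp_all add: borel_measurable_continuous_onI)
    show "D \<in> borel_measurable lborel" "q k \<in> borel_measurable lborel" for k
      unfolding q_def by simp_all
    show "integrable lborel (\<lambda>x. max M0 0 * indicator (cball (0::'a) (B + norm v)) x)"
      using emeasure_lborel_cball_finite[of "0::'a" "B + norm v"]
      by (intro integrable_mult_right integrable_real_indicator) auto
    show "AE x in lborel. norm (q k x) \<le> max M0 0 * indicator (cball 0 (B + norm v)) x" for k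
    proof (rule AE_I2)
      show "norm (q k x) \<le> max M0 0 * indicator (cball 0 (B + norm v)) x" for x
        using q_bound[of k x] q_out[of x k] by (cases "x \<in> cball 0 (B + norm v)") auto
    qed
  qed (use lim in auto)
  then have "(\<integral>x. D x \<partial>lborel) = 0"
    unfolding q0 by (simp only: LIMSEQ_const_iff)
  then show ?thesis
    by (simp only: D_def)
qed

lemma C1_D:
  assumes "C_diff (Suc 0) f"
  shows "f differentiable (at x)" "continuous_on UNIV f"
    "continuous_on UNIV (\<lambda>x. frechet_derivative f (at x) v)"
  using assms C_diff_SucD[OF assms] by simp_all

lemma C1_realI:
  assumes "\<And>s. (h has_real_derivative h' s) (at s)" "continuous_on UNIV h'"
  shows "C_diff (Suc 0) h"
proof -
  have D: "(h has_derivative (\<lambda>v. h' s * v)) (at s)" for s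
    using assms(1)[of s] by (simp add: has_field_derivative_def)
  then have "frechet_derivative h (at s) v = h' s * v" for s v
    by (metis frechet_derivative_at')
  with D assms(2) show ?thesis
    by (auto simp: differentiable_def intro!: continuous_intros)
qed

lemma frechet_derivative_comp_real:
  fixes f :: "'a::real_normed_vector \<Rightarrow> real"
  assumes "(h has_real_derivative d) (at (f x))" "f differentiable (at x)"
  shows "(\<lambda>x. h (f x)) differentiable (at x)"
    "frechet_derivative (\<lambda>x. h (f x)) (at x) v = d * frechet_derivative f (at x) v"
proof -
  have "((\<lambda>x. h (f x)) has_derivative (\<lambda>v. d * frechet_derivative f (at x) v)) (at x)"
    using diff_chain_at[OF assms(2)[unfolded frechet_derivative_works]
        assms(1)[unfolded has_field_derivative_def]] by (simp add: o_def)
  then show "(\<lambda>x. h (f x)) differentiable (at x)"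
    "frechet_derivative (\<lambda>x. h (f x)) (at x) v = d * frechet_derivative f (at x) v"
    by (auto simp: differentiable_def dest: frechet_derivative_at')
qed

lemma C1_comp_real:
  fixes f :: "'a::real_normed_vector \<Rightarrow> real"
  assumes h: "\<And>s. (h has_real_derivative h' s) (at s)" "continuous_on UNIV h'"
    and f: "C_diff (Suc 0) f"
  shows "C_diff (Suc 0) (\<lambda>x. h (f x))"
proof -
  have "continuous_on UNIV (\<lambda>x. h' (f x))"
    by (rule continuous_on_compose2[OF h(2) C1_D(2)[OF f]]) auto
  with frechet_derivative_comp_real[OF h(1) C1_D(1)[OF f]] C1_D(3)[OF f] show ?thesis
    by (auto intro!: continuous_on_mult)
qed

lemma test_function_C1: "\<phi> \<in> test_functions \<Omega> \<Longrightarrow> C_diff (Suc 0) \<phi>"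
  unfolding test_functions_def smooth_def by blast

lemma test_function_support:
  assumes "\<phi> \<in> test_functions \<Omega>"
  obtains K where "compact K" "K \<subseteq> \<Omega>" "\<And>x. x \<notin> K \<Longrightarrow> \<phi> x = 0"
    "\<And>x v. x \<notin> K \<Longrightarrow> frechet_derivative \<phi> (at x) v = 0"
proof
  let ?K = "closure {x. \<phi> x \<noteq> 0}"
  show "compact ?K" "?K \<subseteq> \<Omega>"
    using assms by (auto simp: test_functions_def)
  show z: "\<phi> x = 0" if "x \<notin> ?K" for x
    using that closure_subset[of "{x. \<phi> x \<noteq> 0}"] by blast
  show "frechet_derivative \<phi> (at x) v = 0" if "x \<notin> ?K" for x v
    using frechet_derivative_eq_0_outside[OF closed_closure z that] by simp
qed

lemma integral_lebesgue_on_support: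
  fixes f :: "'a::euclidean_space \<Rightarrow> real"
  assumes "f \<in> borel_measurable borel" "S \<in> sets lebesgue" "\<And>x. x \<notin> S \<Longrightarrow> f x = 0"
  shows "(\<integral>x. f x \<partial>lebesgue_on S) = (\<integral>x. f x \<partial>lborel)"
    "integrable (lebesgue_on S) f \<longleftrightarrow> integrable lborel f"
proof -
  have *: "(\<lambda>x. if x \<in> S then f x else 0) = f" using assms(3) by auto
  show "(\<integral>x. f x \<partial>lebesgue_on S) = (\<integral>x. f x \<partial>lborel)"
    using Lebesgue_Measure.integral_restrict_UNIV[OF assms(2), of f] assms(1)
        by (simp add: * integral_completion)
  show "integrable (lebesgue_on S) f \<longleftrightarrow> integrable lborel f"
    using Lebesgue_Measure.integrable_restrict_UNIV[OF assms(2), of f] assms(1)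
        by (simp add: * integrable_completion)
qed

lemma integral_by_parts_test_function:
  fixes \<Omega> :: "'a::euclidean_space set"
  assumes "open \<Omega>" and a: "C_diff (Suc 0) a" and \<phi>: "\<phi> \<in> test_functions \<Omega>"
  shows "(\<integral>x. a x * frechet_derivative \<phi> (at x) v \<partial>lebesgue_on \<Omega>)
      = - (\<integral>x. frechet_derivative a (at x) v * \<phi> x \<partial>lebesgue_on \<Omega>)"
proof -
  obtain K where K: "compact K" "K \<subseteq> \<Omega>" "\<And>x. x \<notin> K \<Longrightarrow> \<phi> x = 0"
    "\<And>x v. x \<notin> K \<Longrightarrow> frechet_derivative \<phi> (at x) v = 0"
    using test_function_support[OF \<phi>] by metis
  note C = C1_D[OF a] C1_D[OF test_function_C1[OF \<phi>]]
  let ?f = "\<lambda>x. a x * frechet_derivative \<phi> (at x) v" and ?g = "\<lambda>x. frechet_derivative a (at x) v * \<phi> x"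
  have cont: "continuous_on UNIV ?f" "continuous_on UNIV ?g"
    by (intro continuous_on_mult C)+
  have z: "?f x = 0" "?g x = 0" if "x \<notin> K" for x
    using K that by auto
  note int = integrable_lborel_continuous_compact_support[OF cont(1) K(1) z(1)]
    integrable_lborel_continuous_compact_support[OF cont(2) K(1) z(2)]
  have fd: "frechet_derivative (\<lambda>x. a x * \<phi> x) (at x) v = ?f x + ?g x" for x
    by (rule frechet_derivative_mult_real) (rule C)+
  have "(\<integral>x. frechet_derivative (\<lambda>x. a x * \<phi> x) (at x) v \<partial>lborel) = 0"
  proof (rule integral_directional_derivative_eq_0[OF _ _ K(1)])
    show "(\<lambda>x. a x * \<phi> x) differentiable at x" for x
      by (intro differentiable_mult C)
    show "continuous_on UNIV (\<lambda>x. frechet_derivative (\<lambda>x. a x * \<phi> x) (at x) v)"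
      unfolding fd by (intro continuous_on_add cont)
  qed (use K in auto)
  then have "(\<integral>x. ?f x \<partial>lborel) + (\<integral>x. ?g x \<partial>lborel) = 0"
    unfolding fd using int by simp
  moreover have "(\<integral>x. ?f x \<partial>lebesgue_on \<Omega>) = (\<integral>x. ?f x \<partial>lborel)"
    "(\<integral>x. ?g x \<partial>lebesgue_on \<Omega>) = (\<integral>x. ?g x \<partial>lborel)"
    using cont K(2) z \<open>open \<Omega>\<close>
    by (intro integral_lebesgue_on_support borel_measurable_continuous_onI; force)+
  ultimately show ?thesis by linarith
qed

text \<open>Sums the directional derivatives along the basis into a vector, so that it can be compared
  with \<^const>\<open>weak_grad\<close>.\<close>

definition classical_grad :: "('a::euclidean_space \<Rightarrow> real) \<Rightarrow> 'a \<Rightarrow> 'a" where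
  "classical_grad f x = (\<Sum>i\<in>Basis. frechet_derivative f (at x) i *\<^sub>R i)"

lemma classical_grad_inner:
  assumes "f differentiable (at x)"
  shows "classical_grad f x \<bullet> v = frechet_derivative f (at x) v"
proof -
  interpret bounded_linear "frechet_derivative f (at x)"
    using assms by (auto simp: frechet_derivative_works intro: has_derivative_bounded_linear)
  have "frechet_derivative f (at x) v = frechet_derivative f (at x) (\<Sum>i\<in>Basis. (v \<bullet> i) *\<^sub>R i)"
    by (simp add: euclidean_representation)
  also have "\<dots> = (\<Sum>i\<in>Basis. (v \<bullet> i) * frechet_derivative f (at x) i)"
    by (simp add: sum scaleR)
  finally show ?thesis
    by (simp add: classical_grad_def inner_sum_left inner_commute[of v] mult.commute)
qed

lemma continuous_classical_grad:
  "C_diff (Suc 0) f \<Longrightarrow> continuous_on UNIV (classical_grad f)"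
  unfolding classical_grad_def[abs_def] by (intro continuous_intros C1_D)

lemma integrable_lebesgue_on_compact:
  fixes f :: "'a::euclidean_space \<Rightarrow> 'b::euclidean_space"
  assumes "continuous_on UNIV f" "compact K"
  shows "integrable (lebesgue_on K) f"
proof -
  have "integrable lborel (\<lambda>x. indicator K x *\<^sub>R f x)"
    by (intro borel_integrable_compact assms(2) continuous_on_subset[OF assms(1)]) auto
  then have "integrable lebesgue (\<lambda>x. indicator K x *\<^sub>R f x)"
    by (subst integrable_completion) auto
  then show ?thesis
    using assms(2) by (subst integrable_restrict_space) (auto simp: borel_compact)
qed

lemma continuous_imp_L1_loc: "continuous_on UNIV f \<Longrightarrow> f \<in> L1_loc \<Omega>"
  unfolding L1_loc_def using integrable_lebesgue_on_compact by blast

lemma C1_has_weak_grad: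
  assumes "open \<Omega>" "C_diff (Suc 0) u"
  shows "has_weak_grad \<Omega> u (classical_grad u)"
  unfolding has_weak_grad_def
proof (intro conjI ballI)
  show "u \<in> L1_loc \<Omega>" "classical_grad u \<in> L1_loc \<Omega>"
    by (intro continuous_imp_L1_loc C1_D continuous_classical_grad assms(2))+
  fix \<phi> i assume "\<phi> \<in> test_functions \<Omega>"
  from integral_by_parts_test_function[OF assms this, of i]
  show "(\<integral>x. u x * frechet_derivative \<phi> (at x) i \<partial>lebesgue_on \<Omega>)
      = - (\<integral>x. (classical_grad u x \<bullet> i) * \<phi> x \<partial>lebesgue_on \<Omega>)"
    unfolding classical_grad_inner[OF C1_D(1)[OF assms(2)]] .
qed

section \<open>Uniqueness and linearity of weak gradients\<close>

text \<open>The sets over which the integral vanishes form a Dynkin system, and the boxes are a generator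
  of the Borel sets that is stable under intersection.\<close>

lemma AE_zero_if_box_integrals_zero_lborel:
  fixes g :: "'a::euclidean_space \<Rightarrow> real"
  assumes g: "integrable lborel g" and z: "\<And>a b. (\<integral>x. indicator (box a b) x * g x \<partial>lborel) = 0"
  shows "AE x in lborel. g x = 0"
proof (rule density_unique_real[OF g, where f'="\<lambda>x. 0", simplified])
  have ig: "integrable lborel (\<lambda>x. indicator A x * g x)" if "A \<in> sets borel" for A
    using integrable_mult_indicator[of A lborel g] that g by simp
  fix A :: "'a set" assume "A \<in> sets borel"
  then have A: "A \<in> sigma_sets UNIV (range (\<lambda>(a, b). box a b))"
    by (metis (no_types, lifting) borel_eq_box sets_measure_of subset_UNIV Pow_UNIV)
  have stable: "Int_stable (range (\<lambda>(a, b). box a b :: 'a set))"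
    unfolding Int_stable_def by (auto simp: box_Int_box)
  have "A \<in> sets borel \<and> (\<integral>x. indicator A x * g x \<partial>lborel) = 0"
    using stable subset_UNIV[of "range (\<lambda>(a, b). box a b :: 'a set)", folded Pow_UNIV] A
  proof (induction rule: sigma_sets_induct_disjoint)
    case (basic A)
    then show ?case using z by auto
  next
    case empty
    then show ?case by simp
  next
    case (compl A)
    have "(\<lambda>k. \<integral>x. indicator (box (- (real k *\<^sub>R One)) (real k *\<^sub>R One)) x * g x \<partial>lborel)
        \<longlonglongrightarrow> (\<integral>x. g x \<partial>lborel)"
    proof (rule integral_dominated_convergence[where w="\<lambda>x. \<bar>g x\<bar>"])
      show "AE x in lborel. (\<lambda>k. indicator (box (- (real k *\<^sub>R One)) (real k *\<^sub>R One)) x * g x) \<longlonglongrightarrow> g x"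
      proof (rule AE_I2)
        fix x :: 'a
        have "x \<in> (\<Union>k::nat. box (- (real k *\<^sub>R One)) (real k *\<^sub>R One))"
          using UN_box_eq_UNIV by blast
        then obtain k0 :: nat where k0: "x \<in> box (- (real k0 *\<^sub>R One)) (real k0 *\<^sub>R One)"
          by blast
        have "x \<in> box (- (real k *\<^sub>R One)) (real k *\<^sub>R One)" if "k \<ge> k0" for k
          unfolding mem_box
        proof
          fix i :: 'a assume i: "i \<in> Basis"
          with k0 have "- real k0 < x \<bullet> i \<and> x \<bullet> i < real k0"
            by (auto simp: mem_box)
          moreover have "real k0 \<le> real k" using that by simp
          ultimately show "- (real k *\<^sub>R One) \<bullet> i < x \<bullet> i \<and> x \<bullet> i < (real k *\<^sub>R One) \<bullet> i"
            using i by simp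
        qed
        then have "\<forall>\<^sub>F k in sequentially. g x = indicator (box (- (real k *\<^sub>R One)) (real k
            *\<^sub>R One)) x * g x"
          by (intro eventually_mono[OF eventually_ge_at_top[of k0]]) simp
        then show "(\<lambda>k. indicator (box (- (real k *\<^sub>R One)) (real k *\<^sub>R One)) x * g x) \<longlonglongrightarrow> g x"
          by (rule Lim_transform_eventually[OF tendsto_const])
      qed
      show "integrable lborel (\<lambda>x. \<bar>g x\<bar>)" using g by simp
    qed (use g ig in \<open>auto simp: indicator_def\<close>)
    then have "(\<integral>x. g x \<partial>lborel) = 0"
      unfolding z by (simp only: LIMSEQ_const_iff)
    moreover have "indicator (UNIV - A) x * g x = g x - indicator A x * g x" for x
      by (simp add: indicator_def)
    ultimately show ?case
      using compl g ig[of A] by auto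
  next
    case (union A)
    have A: "A i \<in> sets borel" for i
      using union by blast
    then have UA: "(\<Union>i. A i) \<in> sets borel"
      by blast
    have "(\<integral>x. indicator (\<Union>i. A i) x * g x \<partial>lborel) = (\<Sum>i. \<integral>x. indicator (A i) x * g x \<partial>lborel)"
      using lebesgue_integral_countable_add[of A lborel g] union(1) ig[OF UA] A
      by (auto simp: set_lebesgue_integral_def set_integrable_def disjoint_family_on_def)
    with union UA show ?case by auto
  qed
  then show "set_lebesgue_integral lborel A g = 0"
    by (simp add: set_lebesgue_integral_def)
qed

lemma AE_zero_if_box_integrals_zero:
  fixes g :: "'a::euclidean_space \<Rightarrow> real"
  assumes g: "integrable lebesgue g" and z: "\<And>a b. (\<integral>x. indicator (box a b) x * g x \<partial>lebesgue) = 0"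
  shows "AE x in lebesgue. g x = 0"
proof -
  obtain g' where g': "g' \<in> borel_measurable lborel" "AE x in lborel. g x = g' x"
    using completion_ex_borel_measurable_real[OF borel_measurable_integrable[OF g]] by auto
  have ae: "AE x in lebesgue. g x = g' x"
    using g'(2) by (rule AE_completion)
  have m: "g' \<in> borel_measurable lebesgue"
    using g'(1) by (rule measurable_completion)
  have "integrable lebesgue g'"
    using g ae m by (simp add: integrable_cong_AE[OF borel_measurable_integrable[OF g] m ae])
  then have "integrable lborel g'"
    using g'(1) by (simp add: integrable_completion)
  moreover have "(\<integral>x. indicator (box a b) x * g' x \<partial>lborel) = 0" for a b
  proof -
    have "(\<integral>x. indicator (box a b) x * g' x \<partial>lborel) = (\<integral>x. indicator (box a b) x * g' x \<partial>lebesgue)"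
      using g'(1) by (intro integral_completion[symmetric]) simp
    also have "\<dots> = (\<integral>x. indicator (box a b) x * g x \<partial>lebesgue)"
    proof (rule integral_cong_AE)
      have b: "box a b \<in> sets lebesgue" by simp
      show "(\<lambda>x. indicator (box a b) x * g' x) \<in> borel_measurable lebesgue"
        "(\<lambda>x. indicator (box a b) x * g x) \<in> borel_measurable lebesgue"
        using m borel_measurable_integrable[OF g] b
        by (auto intro!: borel_measurable_times borel_measurable_indicator)
    qed (use ae in auto)
    finally show ?thesis using z by simp
  qed
  ultimately have "AE x in lborel. g' x = 0"
    by (rule AE_zero_if_box_integrals_zero_lborel)
  then have "AE x in lebesgue. g' x = 0"
    by (rule AE_completion)
  with ae show ?thesis by eventually_elim simp
qed

lemma L1_loc_bounded_mult_integrable: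
  fixes g :: "'a::euclidean_space \<Rightarrow> real"
  assumes g: "g \<in> L1_loc \<Omega>" and \<Omega>: "open \<Omega>" and f: "continuous_on UNIV f"
    and K: "compact K" "K \<subseteq> \<Omega>" "\<And>x. x \<notin> K \<Longrightarrow> f x = 0"
  shows "integrable (lebesgue_on \<Omega>) (\<lambda>x. g x * f x)"
proof -
  have gK: "integrable (lebesgue_on K) g"
    using g K by (auto simp: L1_loc_def)
  have sK: "K \<in> sets lebesgue" using K(1) by (simp add: borel_compact)
  have "compact (f ` K)"
    by (intro compact_continuous_image K continuous_on_subset[OF f]) auto
  then obtain M where M: "\<And>y. y \<in> f ` K \<Longrightarrow> norm y \<le> M"
    by (meson bounded_iff compact_imp_bounded)
  have "integrable (lebesgue_on K) (\<lambda>x. f x * g x)"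
  proof (rule Bochner_Integration.integrable_bound[where f="\<lambda>x. M * g x"])
    show "integrable (lebesgue_on K) (\<lambda>x. M * g x)" using gK by simp
    have "f \<in> borel_measurable (lebesgue_on K)"
      using f by (intro continuous_imp_measurable_on_sets_lebesgue sK) (auto intro:
          continuous_on_subset)
    then show "(\<lambda>x. f x * g x) \<in> borel_measurable (lebesgue_on K)"
      using borel_measurable_integrable[OF gK] by (rule borel_measurable_times)
    show "AE x in lebesgue_on K. norm (f x * g x) \<le> norm (M * g x)"
    proof (rule AE_I2)
      fix x assume "x \<in> space (lebesgue_on K)"
      then have "\<bar>f x\<bar> \<le> M" using M[of "f x"] by simp
      then show "norm (f x * g x) \<le> norm (M * g x)"
        by (auto simp: abs_mult intro!: mult_right_mono)
    qed
  qed
  then have "integrable lebesgue (\<lambda>x. if x \<in> K then f x * g x else 0)"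
    using Lebesgue_Measure.integrable_restrict_UNIV[OF sK, of "\<lambda>x. f x * g x"] by simp
  also have "(\<lambda>x. if x \<in> K then f x * g x else 0) = (\<lambda>x. if x \<in> \<Omega> then g x * f x else 0)"
    using K by (auto simp: fun_eq_iff mult.commute)
  finally show ?thesis
    using Lebesgue_Measure.integrable_restrict_UNIV[of \<Omega> "\<lambda>x. g x * f x"] \<Omega> by simp
qed

text \<open>The fundamental lemma of the calculus of variations. The bumps of a box converge boundedly to
  its indicator, so the integral over every box inside the domain vanishes, and boxes generate
  the measurable sets.\<close>

lemma AE_zero_if_test_integrals_zero:
  fixes h :: "'a::euclidean_space \<Rightarrow> real"
  assumes \<Omega>: "open \<Omega>" and h: "h \<in> L1_loc \<Omega>"
    and z: "\<And>\<phi>. \<phi> \<in> test_functions \<Omega> \<Longrightarrow> (\<integral>x. h x * \<phi> x \<partial>lebesgue_on \<Omega>) = 0"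
  shows "AE x in lebesgue_on \<Omega>. h x = 0"
proof -
  have s\<Omega>: "\<Omega> \<in> sets lebesgue" using \<Omega> by simp
  have hc: "integrable lebesgue (\<lambda>x. if x \<in> cbox a b then h x else 0)" if "cbox a b \<subseteq> \<Omega>" for a b
    using h that Lebesgue_Measure.integrable_restrict_UNIV[of "cbox a b" h]
    by (auto simp: L1_loc_def)
  have hb: "integrable lebesgue (\<lambda>x. indicator (box a b) x * h x)" if "cbox a b \<subseteq> \<Omega>" for a b
  proof -
    have "integrable lebesgue (\<lambda>x. indicator (box a b) x *\<^sub>R (if x \<in> cbox a b then h x else 0))"
      by (intro integrable_mult_indicator hc that) simp
    also have "(\<lambda>x. indicator (box a b) x *\<^sub>R (if x \<in> cbox a b then h x else 0))
        = (\<lambda>x. indicator (box a b) x * h x)"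
      using box_subset_cbox[of a b] by (auto simp: fun_eq_iff indicator_def)
    finally show ?thesis .
  qed
  have box0: "(\<integral>x. indicator (box a b) x * h x \<partial>lebesgue) = 0" if ab: "cbox a b \<subseteq> \<Omega>" for a b
  proof -
    let ?H = "\<lambda>x. if x \<in> cbox a b then h x else 0"
    have "(\<lambda>k. \<integral>x. ?H x * box_bump a b k x \<partial>lebesgue) \<longlonglongrightarrow> (\<integral>x. indicator (box a b) x * h x \<partial>lebesgue)"
    proof (rule integral_dominated_convergence[where w="\<lambda>x. \<bar>?H x\<bar>"])
      have C: "continuous_on UNIV (box_bump a b k)" for k
        using box_bump_test_function[OF ab] test_function_C1 C1_D(2) by blast
      have "box_bump a b k \<in> borel_measurable lebesgue" for k
        using borel_measurable_continuous_onI[OF C] by (intro measurable_completion) simp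
      then show "(\<lambda>x. ?H x * box_bump a b k x) \<in> borel_measurable lebesgue" for k
        using borel_measurable_integrable[OF hc[OF ab]] by (intro borel_measurable_times)
      show "(\<lambda>x. indicator (box a b) x * h x) \<in> borel_measurable lebesgue"
        using hb[OF ab] by (rule borel_measurable_integrable)
      show "integrable lebesgue (\<lambda>x. \<bar>?H x\<bar>)" using hc[OF ab] by (rule integrable_abs)
      show "AE x in lebesgue. norm (?H x * box_bump a b k x) \<le> \<bar>?H x\<bar>" for k
        using box_bump_bounds[of a b k] by (auto simp: abs_mult intro!: mult_left_le AE_I2)
      show "AE x in lebesgue. (\<lambda>k. ?H x * box_bump a b k x) \<longlonglongrightarrow> indicator (box a b) x * h x"
      proof (rule AE_I2)
        fix x
        have "(\<lambda>k. ?H x * box_bump a b k x) \<longlonglongrightarrow> ?H x * indicator (box a b) x"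
          by (intro tendsto_mult tendsto_const box_bump_tendsto)
        then show "(\<lambda>k. ?H x * box_bump a b k x) \<longlonglongrightarrow> indicator (box a b) x * h x"
          using box_subset_cbox[of a b] by (auto simp: indicator_def split: if_splits)
      qed
    qed
    moreover have "(\<integral>x. ?H x * box_bump a b k x \<partial>lebesgue) = 0" for k
    proof -
      have "(\<integral>x. (if x \<in> \<Omega> then h x * box_bump a b k x else 0) \<partial>lebesgue) = 0"
        using z[OF box_bump_test_function[OF ab]] Lebesgue_Measure.integral_restrict_UNIV[OF s\<Omega>]
            by metis
      moreover have "(if x \<in> \<Omega> then h x * box_bump a b k x else 0) = ?H x * box_bump a b k x" for x
        using ab box_bump_eq_0[of x a b k] box_subset_cbox[of a b] by auto
      ultimately show ?thesis by simp
    qed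
    ultimately show ?thesis
      by (simp add: LIMSEQ_const_iff)
  qed
  have cb: "AE x in lebesgue. x \<in> cbox c d \<longrightarrow> h x = 0" if cd: "cbox c d \<subseteq> \<Omega>" for c d
  proof -
    have "AE x in lebesgue. indicator (box c d) x * h x = 0"
    proof (rule AE_zero_if_box_integrals_zero[OF hb[OF cd]])
      fix a b
      obtain a' b' where ab': "box a b \<inter> box c d = box a' b'"
        using that[OF box_Int_box] .
      have "(\<integral>x. indicator (box a' b') x * h x \<partial>lebesgue) = 0"
      proof (cases "box a' b' = {}")
        case False
        then have "cbox a' b' \<subseteq> cbox c d"
          using closure_mono[of "box a' b'" "box c d"] closure_box[of a' b'] closure_box[of c d] ab'
          by (metis inf_bot_right inf_le2)
        then show ?thesis using box0 cd by blast
      qed simp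
      then show "(\<integral>x. indicator (box a b) x * (indicator (box c d) x * h x) \<partial>lebesgue) = 0"
        by (simp add: ab'[symmetric] indicator_inter_arith mult.assoc)
    qed
    moreover have "AE x in lebesgue. x \<notin> cbox c d - box c d"
      using negligible_frontier_interval[of c d] by (intro AE_not_in) (simp add:
          negligible_iff_null_sets)
    ultimately show ?thesis
      by eventually_elim (auto simp: indicator_def split: if_splits)
  qed
  obtain D where D: "countable D" "\<And>X. X \<in> D \<Longrightarrow> \<exists>a b. X = cbox a b" "\<Union>D = \<Omega>"
    using open_countable_Union_open_cbox[OF \<Omega>] by metis
  have "AE x in lebesgue. \<forall>X\<in>D. x \<in> X \<longrightarrow> h x = 0"
  proof (subst AE_ball_countable[OF D(1)], intro ballI)
    fix X assume "X \<in> D"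
    then obtain a b where "X = cbox a b" "X \<subseteq> \<Omega>" using D by blast
    with cb show "AE x in lebesgue. x \<in> X \<longrightarrow> h x = 0" by blast
  qed
  then have "AE x in lebesgue. x \<in> \<Omega> \<longrightarrow> h x = 0"
    by eventually_elim (use D(3) in blast)
  then show ?thesis
    using s\<Omega> by (simp add: AE_restrict_space_iff)
qed

lemma L1_loc_add: "u \<in> L1_loc \<Omega> \<Longrightarrow> v \<in> L1_loc \<Omega> \<Longrightarrow> (\<lambda>x. u x + c *\<^sub>R v x) \<in> L1_loc \<Omega>"
  unfolding L1_loc_def by (auto intro!: Bochner_Integration.integrable_add integrable_scaleR_right)

lemma L1_loc_inner: "g \<in> L1_loc \<Omega> \<Longrightarrow> (\<lambda>x. g x \<bullet> i) \<in> L1_loc \<Omega>"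
  unfolding L1_loc_def by (auto intro!: integrable_inner_left)

lemma integrable_mult_test:
  assumes "u \<in> L1_loc \<Omega>" "open \<Omega>" "\<phi> \<in> test_functions \<Omega>"
  shows "integrable (lebesgue_on \<Omega>) (\<lambda>x. u x * \<phi> x)"
    "integrable (lebesgue_on \<Omega>) (\<lambda>x. u x * frechet_derivative \<phi> (at x) v)"
proof -
  obtain K where K: "compact K" "K \<subseteq> \<Omega>" "\<And>x. x \<notin> K \<Longrightarrow> \<phi> x = 0"
    "\<And>x v. x \<notin> K \<Longrightarrow> frechet_derivative \<phi> (at x) v = 0"
    using test_function_support[OF assms(3)] by metis
  note C = C1_D[OF test_function_C1[OF assms(3)]]
  show "integrable (lebesgue_on \<Omega>) (\<lambda>x. u x * \<phi> x)"
    by (rule L1_loc_bounded_mult_integrable[OF assms(1,2) C(2) K(1-3)])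
  show "integrable (lebesgue_on \<Omega>) (\<lambda>x. u x * frechet_derivative \<phi> (at x) v)"
    by (rule L1_loc_bounded_mult_integrable[OF assms(1,2) C(3) K(1,2,4)])
qed

lemma has_weak_grad_add:
  assumes "open \<Omega>" "has_weak_grad \<Omega> u g" "has_weak_grad \<Omega> v h"
  shows "has_weak_grad \<Omega> (\<lambda>x. u x + c * v x) (\<lambda>x. g x + c *\<^sub>R h x)"
  unfolding has_weak_grad_def
proof (intro conjI ballI)
  note L = assms(2,3)[unfolded has_weak_grad_def]
  show "(\<lambda>x. u x + c * v x) \<in> L1_loc \<Omega>" "(\<lambda>x. g x + c *\<^sub>R h x) \<in> L1_loc \<Omega>"
    using L L1_loc_add[of u \<Omega> v c] L1_loc_add[of g \<Omega> h c] by simp_all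
  fix \<phi> and i :: 'a assume \<phi>: "\<phi> \<in> test_functions \<Omega>" and i: "i \<in> Basis"
  let ?M = "lebesgue_on \<Omega>" and ?d = "\<lambda>x. frechet_derivative \<phi> (at x) i"
  have 1: "integrable ?M (\<lambda>x. u x * ?d x)" "integrable ?M (\<lambda>x. v x * ?d x)"
    "integrable ?M (\<lambda>x. (g x \<bullet> i) * \<phi> x)" "integrable ?M (\<lambda>x. (h x \<bullet> i) * \<phi> x)"
    using L \<phi> assms(1) by (auto intro!: integrable_mult_test L1_loc_inner)
  have "(\<integral>x. (u x + c * v x) * ?d x \<partial>?M) = (\<integral>x. u x * ?d x \<partial>?M) + c * (\<integral>x. v x * ?d x \<partial>?M)"
    using 1 by (simp add: distrib_right mult.assoc)
  also have "\<dots> = - ((\<integral>x. (g x \<bullet> i) * \<phi> x \<partial>?M) + c * (\<integral>x. (h x \<bullet> i) * \<phi> x \<partial>?M))"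
    using L \<phi> i by (simp add: algebra_simps)
  also have "\<dots> = - (\<integral>x. ((g x + c *\<^sub>R h x) \<bullet> i) * \<phi> x \<partial>?M)"
    using 1 by (simp add: distrib_right mult.assoc inner_add_left)
  finally show "(\<integral>x. (u x + c * v x) * ?d x \<partial>?M) = - (\<integral>x. ((g x + c *\<^sub>R h x) \<bullet> i) * \<phi> x \<partial>?M)" .
qed

lemma has_weak_grad_unique:
  assumes \<Omega>: "open \<Omega>" and g: "has_weak_grad \<Omega> u g" and h: "has_weak_grad \<Omega> u h"
  shows "AE x in lebesgue_on \<Omega>. g x = h x"
proof -
  have gh: "has_weak_grad \<Omega> (\<lambda>x. u x + (-1) * u x) (\<lambda>x. g x + (-1) *\<^sub>R h x)"
    by (rule has_weak_grad_add[OF \<Omega> g h])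
  have "AE x in lebesgue_on \<Omega>. (g x + (-1) *\<^sub>R h x) \<bullet> i = 0" if "i \<in> Basis" for i
  proof (rule AE_zero_if_test_integrals_zero[OF \<Omega>])
    show "(\<lambda>x. (g x + (-1) *\<^sub>R h x) \<bullet> i) \<in> L1_loc \<Omega>"
      using gh by (auto simp: has_weak_grad_def intro: L1_loc_inner)
    show "(\<integral>x. (g x + (-1) *\<^sub>R h x) \<bullet> i * \<phi> x \<partial>lebesgue_on \<Omega>) = 0" if "\<phi> \<in> test_functions \<Omega>" for \<phi>
      using gh that \<open>i \<in> Basis\<close> by (auto simp: has_weak_grad_def)
  qed
  then have "AE x in lebesgue_on \<Omega>. \<forall>i\<in>Basis. (g x + (-1) *\<^sub>R h x) \<bullet> i = 0"
    by (simp add: AE_finite_all)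
  then show ?thesis
    by eventually_elim (auto simp: inner_diff_left intro: euclidean_eqI)
qed

text \<open>The gradient chosen by \<^const>\<open>weak_grad\<close> may be replaced by any other weak gradient under
  an integral.\<close>

lemma weak_grad_AE:
  assumes "open \<Omega>" "has_weak_grad \<Omega> u g"
  shows "AE x in lebesgue_on \<Omega>. weak_grad \<Omega> u x = g x"
  unfolding weak_grad_def by (rule has_weak_grad_unique[OF assms(1) someI[of _ g]]) fact+

lemma borel_measurable_lebesgue_on_AE:
  fixes f g :: "'a::euclidean_space \<Rightarrow> 'b::euclidean_space"
  assumes f: "f \<in> borel_measurable (lebesgue_on S)" and S: "S \<in> sets lebesgue"
    and ae: "AE x in lebesgue_on S. f x = g x"
  shows "g \<in> borel_measurable (lebesgue_on S)"
proof -
  have "AE x in lebesgue. (if x \<in> S then f x else 0) = (if x \<in> S then g x else 0)"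
    using ae unfolding AE_restrict_space_iff[of S lebesgue, simplified, OF S]
    by eventually_elim simp
  then have "(\<lambda>x. if x \<in> S then g x else 0) \<in> borel_measurable lebesgue"
    using f S by (intro borel_measurable_AE[OF iffD2[OF borel_measurable_if]])
  then show ?thesis by (rule borel_measurable_if_D)
qed

section \<open>Convergence in the mean of order p\<close>

text \<open>The gradient of \<^term>\<open>\<lambda>a. norm a powr p / p\<close>. Its value at the origin is zero for every
  exponent, because \<^term>\<open>flux p 0\<close> is a multiple of the zero vector.\<close>

definition flux :: "real \<Rightarrow> 'a::euclidean_space \<Rightarrow> 'a" where
  "flux p a = norm a powr (p - 2) *\<^sub>R a"

lemma norm_flux: "norm (flux p a) = norm a powr (p - 1)"
proof (cases "a = 0")
  case False
  then show ?thesis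
    using powr_mult_base[of "norm a" "p - 2"] by (simp add: flux_def mult.commute)
qed (simp add: flux_def)

lemma flux_inner_self: "flux p a \<bullet> a = norm a powr p"
proof (cases "a = 0")
  case False
  have "flux p a \<bullet> a = norm a powr (p - 2) * norm a powr 2"
    using False by (simp add: flux_def dot_square_norm powr_numeral)
  then show ?thesis
    by (simp only: powr_add[symmetric]) simp
qed (simp add: flux_def)

lemma flux_inner_le: "\<bar>flux p a \<bullet> b\<bar> \<le> norm a powr (p - 1) * norm b"
  using Cauchy_Schwarz_ineq2[of "flux p a" b] by (simp add: norm_flux)

lemma norm_add_powr_le:
  fixes a b :: "'a::real_normed_vector"
  assumes "p \<ge> 0"
  shows "norm (a + b) powr p \<le> 2 powr p * (norm a powr p + norm b powr p)"
proof -
  have "norm (a + b) powr p \<le> (2 * max (norm a) (norm b)) powr p"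
    using norm_triangle_ineq[of a b] assms by (intro powr_mono2) auto
  also have "\<dots> = 2 powr p * max (norm a) (norm b) powr p"
    by (simp add: powr_mult)
  also have "max (norm a) (norm b) powr p \<le> norm a powr p + norm b powr p"
    by (auto simp: max_def)
  finally show ?thesis by simp
qed

text \<open>A form of Young's inequality with a free parameter. Whichever of the two numbers dominates
  (up to the parameter) bounds the product by its own power.\<close>

lemma powr_mult_small_large:
  fixes x y e p :: real
  assumes "x \<ge> 0" "y \<ge> 0" "e > 0" "p \<ge> 1"
  shows "x powr (p - 1) * y \<le> e * x powr p + e powr (1 - p) * y powr p"
proof (cases "y \<le> e * x")
  case True
  have "x powr (p - 1) * y \<le> x powr (p - 1) * (e * x)"
    using True by (intro mult_left_mono) auto
  also have "\<dots> = e * x powr p"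
    using powr_mult_base[of x "p - 1"] assms by (simp add: mult_ac)
  finally show ?thesis using assms by (simp add: add_increasing2)
next
  case False
  then have "x \<le> y / e" using assms by (simp add: field_simps)
  then have "x powr (p - 1) * y \<le> (y / e) powr (p - 1) * y"
    using assms by (intro mult_right_mono powr_mono2) auto
  also have "\<dots> = e powr (1 - p) * (y * y powr (p - 1))"
    using assms powr_divide[of y e "p - 1"] powr_minus_divide[of e "p - 1"] by simp
  also have "y * y powr (p - 1) = y powr p"
    using powr_mult_base[of y "p - 1"] assms by simp
  finally show ?thesis using assms by (simp add: add_increasing)
qed

text \<open>Young's inequality for the pairing of a flux with a vector, with the weight split between the
  two factors as \<^term>\<open>s powr (1 / p)\<close> and its inverse. Integrated, it becomes the lower bound
  for the energy with conductivity \<^term>\<open>s\<close>; for \<^term>\<open>s = 1\<close> it is the convexity of the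
  energy density.\<close>

lemma flux_young:
  assumes p: "p > 1" and s: "s > 0"
  shows "p * (flux p a \<bullet> b) \<le> s * norm b powr p + (p - 1) * s powr (- 1 / (p - 1)) * norm a powr p"
proof -
  define q where "q = p / (p - 1)"
  have q: "q > 1" "1 / p + 1 / q = 1" using p by (auto simp: q_def field_simps)
  let ?x = "s powr (1 / p) * norm b" and ?y = "s powr (- 1 / p) * norm a powr (p - 1)"
  have XY: "?x * ?y \<le> ?x powr p / p + ?y powr q / q"
    using p q by (intro Youngs_inequality) auto
  have prod: "?x * ?y = norm a powr (p - 1) * norm b"
  proof -
    have "s powr (1 / p) * s powr (- 1 / p) = 1"
      using s by (simp flip: powr_add)
    then show ?thesis
      by (metis mult.assoc mult.commute mult.left_neutral)
  qed
  have X: "?x powr p = s * norm b powr p"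
    using p s by (simp add: powr_mult powr_powr)
  have Y: "?y powr q = s powr (- 1 / (p - 1)) * norm a powr p"
    using p by (simp add: powr_mult powr_powr q_def)
  have "p * (norm a powr (p - 1) * norm b)
      \<le> p * (s * norm b powr p / p + s powr (- 1 / (p - 1)) * norm a powr p / q)"
    using XY[unfolded prod X Y] p by (intro mult_left_mono) auto
  also have "\<dots> = s * norm b powr p + (p - 1) * s powr (- 1 / (p - 1)) * norm a powr p"
    using p by (simp add: q_def field_simps)
  finally show ?thesis
    using mult_left_mono[OF order_trans[OF abs_ge_self flux_inner_le[of p a b]], of p] p by linarith
qed

lemma flux_convexity:
  assumes "p > 1"
  shows "p * (flux p a \<bullet> b) \<le> norm b powr p + (p - 1) * norm a powr p"
  using flux_young[OF assms, of 1 a b] by simp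

lemma continuous_flux:
  assumes "p > 1"
  shows "continuous_on UNIV (flux p :: 'a::euclidean_space \<Rightarrow> 'a)"
  unfolding continuous_on_eq_continuous_at[OF open_UNIV]
proof (intro ballI)
  fix a :: 'a
  show "isCont (flux p) a"
  proof (cases "a = 0")
    case False
    then show ?thesis
      unfolding flux_def by (intro continuous_intros) auto
  next
    case True
    have "((\<lambda>b::'a. norm b powr (p - 1)) \<longlongrightarrow> 0) (at 0)"
      using assms by (intro tendsto_eq_intros tendsto_zero_powrI) (auto intro!: tendsto_norm_zero)
    then have "((\<lambda>b::'a. flux p b) \<longlongrightarrow> 0) (at 0)"
      by (subst tendsto_norm_zero_iff[symmetric]) (simp add: norm_flux)
    then show ?thesis
      using True by (simp add: isCont_def flux_def[where a=0])
  qed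
qed

text \<open>Fatou's lemma in the form in which it is used for lower semicontinuity: a common bound for
  the integrals passes to the pointwise limit.\<close>

lemma Fatou_bound:
  fixes h :: "nat \<Rightarrow> 'a \<Rightarrow> real"
  assumes h: "\<And>k. integrable M (h k)" "AE x in M. \<forall>k. 0 \<le> h k x" "\<And>k. (\<integral>x. h k x \<partial>M) \<le> C"
    and g: "g \<in> borel_measurable M" and lim: "AE x in M. (\<lambda>k. h k x) \<longlonglongrightarrow> g x"
  shows "integrable M g" "(\<integral>x. g x \<partial>M) \<le> C"
proof -
  have C: "0 \<le> C"
  proof -
    have "0 \<le> (\<integral>x. h 0 x \<partial>M)"
      by (rule integral_nonneg_AE) (use h(2) in eventually_elim, blast)
    with h(3)[of 0] show ?thesis by linarith
  qed
  have g0: "AE x in M. 0 \<le> g x"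
    using lim h(2) by eventually_elim (rule LIMSEQ_le_const, auto)
  have "(\<integral>\<^sup>+x. ennreal (g x) \<partial>M) = (\<integral>\<^sup>+x. liminf (\<lambda>k. ennreal (h k x)) \<partial>M)"
  proof (rule nn_integral_cong_AE)
    show "AE x in M. ennreal (g x) = liminf (\<lambda>k. ennreal (h k x))"
      using lim
    proof eventually_elim
      case (elim x)
      then have "(\<lambda>k. ennreal (h k x)) \<longlonglongrightarrow> ennreal (g x)" by (rule tendsto_ennrealI)
      then show ?case by (simp add: lim_imp_Liminf)
    qed
  qed
  also have "\<dots> \<le> liminf (\<lambda>k. \<integral>\<^sup>+x. ennreal (h k x) \<partial>M)"
    using h(1) by (intro nn_integral_liminf) auto
  also have "\<dots> \<le> liminf (\<lambda>k. ennreal C)"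
  proof (intro Liminf_mono always_eventually allI)
    fix k
    have "(\<integral>\<^sup>+x. ennreal (h k x) \<partial>M) = ennreal (\<integral>x. h k x \<partial>M)"
      by (intro nn_integral_eq_integral h(1)) (use h(2) in eventually_elim, blast)
    then show "(\<integral>\<^sup>+x. ennreal (h k x) \<partial>M) \<le> ennreal C"
      using h(3) C by (simp add: ennreal_leI)
  qed
  also have "\<dots> = ennreal C" by (simp add: Liminf_const)
  finally have le: "(\<integral>\<^sup>+x. ennreal (g x) \<partial>M) \<le> ennreal C" .
  show int: "integrable M g"
    using g le g0 by (intro integrableI_nonneg) (auto simp: less_top[symmetric] top_unique)
  show "(\<integral>x. g x \<partial>M) \<le> C"
    using le C nn_integral_eq_integral[OF int g0] by simp
qed

text \<open>A rapidly converging subsequence converges almost everywhere by the Borel-Cantelli lemma, and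
  Fatou's lemma turns its pointwise limit into the limit in the mean. The subsequence is part of
  the conclusion because lower semicontinuity of the energy needs pointwise convergence.\<close>

lemma Lp_complete:
  fixes f :: "nat \<Rightarrow> 'a \<Rightarrow> 'b::euclidean_space"
  assumes p: "p > 1" and m: "\<And>k. f k \<in> borel_measurable M"
    and int: "\<And>k. integrable M (\<lambda>x. norm (f k x) powr p)"
    and cauchy: "\<And>e. e > 0 \<Longrightarrow> \<exists>N. \<forall>m\<ge>N. \<forall>n\<ge>N. (\<integral>x. norm (f m x - f n x) powr p \<partial>M) < e"
  obtains g r where "g \<in> borel_measurable M" "integrable M (\<lambda>x. norm (g x) powr p)"
    "(\<lambda>k. \<integral>x. norm (f k x - g x) powr p \<partial>M) \<longlonglongrightarrow> 0"
    "strict_mono (r :: nat \<Rightarrow> nat)" "AE x in M. (\<lambda>k. f (r k) x) \<longlonglongrightarrow> g x"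
proof -
  have idiff: "integrable M (\<lambda>x. norm (f i x - f j x) powr p)" for i j
  proof (rule Bochner_Integration.integrable_bound)
    show "integrable M (\<lambda>x. 2 powr p * (norm (f i x) powr p + norm (f j x) powr p))"
      using int by simp
    show "AE x in M. norm (norm (f i x - f j x) powr p)
        \<le> norm (2 powr p * (norm (f i x) powr p + norm (f j x) powr p))"
      using norm_add_powr_le[of p "f i x" "- f j x" for x] p by (intro AE_I2) simp
    show "(\<lambda>x. norm (f i x - f j x) powr p) \<in> borel_measurable M"
      using m[of i] m[of j] by measurable
  qed
  \<comment> \<open>Consecutive terms of the subsequence differ by at most \<^term>\<open>e k\<close> in the mean. Dividing by
    the threshold \<^term>\<open>((1 / 2) ^ k) powr p\<close> in Markov's inequality leaves a geometric series.\<close>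
  define e where "e k = (1 / 2 :: real) ^ k * ((1 / 2) ^ k) powr p" for k :: nat
  have e: "e k > 0" for k by (simp add: e_def)
  obtain N where N: "\<And>k m n. m \<ge> N k \<Longrightarrow> n \<ge> N k \<Longrightarrow> (\<integral>x. norm (f m x - f n x) powr p \<partial>M) < e k"
    using cauchy[OF e] by metis
  define r where "r = rec_nat (N 0) (\<lambda>k i. max (Suc i) (N (Suc k)))"
  have r_Suc: "r (Suc k) = max (Suc (r k)) (N (Suc k))" for k by (simp add: r_def)
  have r_mono: "strict_mono r"
    unfolding strict_mono_Suc_iff r_Suc by (simp add: less_max_iff_disj)
  have rN: "r k \<ge> N k" for k by (cases k) (auto simp: r_Suc, simp add: r_def)
  define d where "d k x = f (r (Suc k)) x - f (r k) x" for k x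
  have dm: "d k \<in> borel_measurable M" for k
    unfolding d_def using m[of "r (Suc k)"] m[of "r k"] by measurable
  have di: "integrable M (\<lambda>x. norm (d k x) powr p)" for k
    unfolding d_def by (rule idiff)
  have de: "(\<integral>x. norm (d k x) powr p \<partial>M) < e k" for k
    unfolding d_def using N[of k "r (Suc k)"
        "r k"] rN[of k] strict_mono_less[OF r_mono, of k "Suc k"] by simp
  define A where "A k = {x \<in> space M. norm (d k x) powr p \<ge> ((1 / 2) ^ k) powr p}" for k
  have Am: "A k \<in> sets M" for k
    unfolding A_def using dm[of k] by measurable
  have A_le: "emeasure M (A k) \<le> ennreal ((1 / 2) ^ k)" for k
  proof -
    have pos: "((1 / 2 :: real) ^ k) powr p > 0" by simp
    have "emeasure M (A k) \<le> ennreal (1 / ((1 / 2) ^ k) powr p * (\<integral>x. norm (d k x) powr p \<partial>M))"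
      unfolding A_def by (intro integral_Markov_inequality di) auto
    also have "\<dots> \<le> ennreal (1 / ((1 / 2) ^ k) powr p * e k)"
      using de[of k] pos by (intro ennreal_leI mult_left_mono) auto
    also have "1 / ((1 / 2) ^ k) powr p * e k = (1 / 2) ^ k"
      using pos by (simp add: e_def)
    finally show ?thesis .
  qed
  have Afin: "emeasure M (A k) < \<infinity>" for k
    using A_le[of k] ennreal_less_top[of "(1 / 2) ^ k"] by (auto intro: le_less_trans)
  have "measure M (A k) \<le> (1 / 2) ^ k" for k
    using A_le[of k] by (simp add: measure_def enn2real_leI)
  then have "norm (measure M (A k)) \<le> (1 / 2) ^ k" for k
    by simp
  moreover have geo: "summable (\<lambda>k. (1 / 2 :: real) ^ k)"
    by (rule summable_geometric) simp
  ultimately have "summable (\<lambda>k. measure M (A k))"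
    by (rule summable_comparison_test'[rotated])
  then have "AE x in M. eventually (\<lambda>k. x \<in> space M - A k) sequentially"
    using Am Afin by (intro borel_cantelli_AE1) auto
  then have conv: "AE x in M. convergent (\<lambda>k. f (r k) x)"
  proof eventually_elim
    case (elim x)
    then obtain K where K: "\<And>k. k \<ge> K \<Longrightarrow> x \<in> space M - A k"
      by (auto simp: eventually_sequentially)
    have "norm (d k x) \<le> (1 / 2) ^ k" if "k \<ge> K" for k
    proof (rule ccontr)
      assume "\<not> ?thesis"
      then have "((1 / 2) ^ k) powr p \<le> norm (d k x) powr p"
        using p by (intro powr_mono2) auto
      with K[OF that] show False by (auto simp: A_def)
    qed
    with geo have "summable (\<lambda>k. d k x)"
      by (rule summable_comparison_test')
    then have "convergent (\<lambda>n. \<Sum>k<n. d k x)"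
      by (simp add: summable_iff_convergent)
    then have "convergent (\<lambda>n. f (r 0) x + (\<Sum>k<n. d k x))"
      by (intro convergent_add convergent_const)
    also have "(\<lambda>n. f (r 0) x + (\<Sum>k<n. d k x)) = (\<lambda>n. f (r n) x)"
      unfolding d_def sum_lessThan_telescope[of "\<lambda>n. f (r n) x"] by simp
    finally show ?case .
  qed
  define g where "g x = lim (\<lambda>k. f (r k) x)" for x
  have gm: "g \<in> borel_measurable M"
    unfolding g_def[abs_def] using m by (intro borel_measurable_lim_metric)
  have lim: "AE x in M. (\<lambda>k. f (r k) x) \<longlonglongrightarrow> g x"
    using conv by eventually_elim (simp add: g_def convergent_LIMSEQ_iff)
  have bound: "integrable M (\<lambda>x. norm (f n x - g x) powr p) \<and> (\<integral>x. norm (f n x - g x) powr p \<partial>M) \<le> c"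
    if c: "\<And>m. m \<ge> K \<Longrightarrow> (\<integral>x. norm (f n x - f m x) powr p \<partial>M) \<le> c" for n c K
  proof -
    have L: "AE x in M. (\<lambda>k. norm (f n x - f (r (k + K)) x) powr p) \<longlonglongrightarrow> norm (f n x - g x) powr p"
      using lim
    proof eventually_elim
      case (elim x)
      then have "(\<lambda>k. f (r (k + K)) x) \<longlonglongrightarrow> g x"
        by (rule LIMSEQ_ignore_initial_segment)
      then show ?case
        using p by (intro tendsto_powr2 tendsto_intros) auto
    qed
    have mm: "(\<lambda>x. norm (f n x - g x) powr p) \<in> borel_measurable M"
      using m[of n] gm by measurable
    have rK: "r (k + K) \<ge> K" for k
      using seq_suble[OF r_mono, of "k + K"] by simp
    from Fatou_bound[OF idiff _ c[OF rK] mm L] show ?thesis by simp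
  qed
  obtain N1 where N1: "\<And>m n. m \<ge> N1 \<Longrightarrow> n \<ge> N1 \<Longrightarrow> (\<integral>x. norm (f m x - f n x) powr p \<partial>M) < 1"
    using cauchy[of 1] by auto
  have fg: "integrable M (\<lambda>x. norm (f N1 x - g x) powr p)"
    using bound[of N1 N1 1] N1 by (auto intro: less_imp_le)
  have "integrable M (\<lambda>x. norm (g x) powr p)"
  proof (rule Bochner_Integration.integrable_bound)
    show "integrable M (\<lambda>x. 2 powr p * (norm (f N1 x) powr p + norm (f N1 x - g x) powr p))"
      using int fg by simp
    show "AE x in M. norm (norm (g x) powr p)
        \<le> norm (2 powr p * (norm (f N1 x) powr p + norm (f N1 x - g x) powr p))"
      using norm_add_powr_le[of p "f N1 x" "- (f N1 x - g x)" for x] p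
      by (intro AE_I2) (simp add: norm_minus_commute)
    show "(\<lambda>x. norm (g x) powr p) \<in> borel_measurable M" using gm by measurable
  qed
  moreover have "(\<lambda>k. \<integral>x. norm (f k x - g x) powr p \<partial>M) \<longlonglongrightarrow> 0"
  proof (rule LIMSEQ_I)
    fix c :: real assume "c > 0"
    then obtain N2 where N2: "\<And>m n. m \<ge> N2 \<Longrightarrow> n \<ge> N2 \<Longrightarrow> (\<integral>x. norm (f m x - f n x) powr p \<partial>M) < c / 2"
      using cauchy[of "c / 2"] by auto
    have "(\<integral>x. norm (f n x - g x) powr p \<partial>M) \<le> c / 2" if "n \<ge> N2" for n
      using bound[of N2 n "c / 2"] N2[OF that] by (auto intro: less_imp_le)
    then show "\<exists>no. \<forall>n\<ge>no. norm ((\<integral>x. norm (f n x - g x) powr p \<partial>M) - 0) < c"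
      using \<open>c > 0\<close> by (intro exI[of _ N2]) (force simp: abs_of_nonneg
          Bochner_Integration.integral_nonneg)
  qed
  ultimately show thesis
    using that[OF gm _ _ r_mono lim] by blast
qed

section \<open>Sobolev spaces on a bounded open set\<close>

lemma smooth_lincomb: "smooth f \<Longrightarrow> smooth g \<Longrightarrow> smooth (\<lambda>x. f x + c * g x)"
  unfolding smooth_def by (auto intro!: C_diff_add C_diff_mult C_diff_const)

lemma test_functions_lincomb:
  assumes "\<phi> \<in> test_functions \<Omega>" "\<psi> \<in> test_functions \<Omega>"
  shows "(\<lambda>x. \<phi> x + c * \<psi> x) \<in> test_functions \<Omega>"
proof -
  let ?A = "closure {x. \<phi> x \<noteq> 0}" and ?B = "closure {x. \<psi> x \<noteq> 0}"
  have sub: "closure {x. \<phi> x + c * \<psi> x \<noteq> 0} \<subseteq> ?A \<union> ?B"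
  proof (rule closure_minimal)
    show "{x. \<phi> x + c * \<psi> x \<noteq> 0} \<subseteq> ?A \<union> ?B"
      using closure_subset[of "{x. \<phi> x \<noteq> 0}"] closure_subset[of "{x. \<psi> x \<noteq> 0}"] by fastforce
  qed auto
  have "compact (?A \<union> ?B)" "?A \<union> ?B \<subseteq> \<Omega>"
    using assms by (auto simp: test_functions_def intro: compact_Un)
  with sub have "compact (closure {x. \<phi> x + c * \<psi> x \<noteq> 0})" "closure {x. \<phi> x + c * \<psi> x \<noteq> 0} \<subseteq> \<Omega>"
    using compact_Int_closed[of "?A \<union> ?B" "closure {x. \<phi> x + c * \<psi> x \<noteq> 0}"]
    by (auto simp: inf.absorb2)
  then show ?thesis
    using assms by (auto simp: test_functions_def smooth_lincomb)
qed

lemma zero_test_function: "(\<lambda>x. 0) \<in> test_functions \<Omega>"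
  by (auto simp: test_functions_def smooth_def C_diff_const)

text \<open>The derivative is continuous also at zero, which makes \<^term>\<open>\<lambda>x. \<bar>\<phi> x\<bar> powr p\<close> admissible
  for integration by parts.\<close>

lemma abs_powr_has_derivative:
  assumes p: "p > 1"
  shows "((\<lambda>s::real. \<bar>s\<bar> powr p) has_real_derivative p * flux p s) (at s)"
proof -
  consider "s > 0" | "s < 0" | "s = 0" by linarith
  then show ?thesis
  proof cases
    case 1
    then have "((\<lambda>s. s powr p) has_real_derivative p * flux p s) (at s)"
      using powr_mult_base[of s "p - 2"]
      by (auto intro!: derivative_eq_intros simp: flux_def mult.commute)
    then show ?thesis
      by (rule has_field_derivative_transform_within_open[where S="{0<..}"]) (use 1 in auto)
  next
    case 2
    have "(- s) powr (p - 1) = - (s * (- s) powr (p - 2))"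
      using 2 powr_mult_base[of "- s" "p - 2"] by simp
    then have "p * flux p s = - (p * (- s) powr (p - 1))"
      using 2 by (simp add: flux_def)
    then have "((\<lambda>s. (- s) powr p) has_real_derivative p * flux p s) (at s)"
      using 2 by (auto intro!: derivative_eq_intros)
    then show ?thesis
      by (rule has_field_derivative_transform_within_open[where S="{..<0}"]) (use 2 in auto)
  next
    case 3
    have "((\<lambda>s::real. flux p s) \<longlongrightarrow> flux p 0) (at 0)"
      using continuous_flux[OF p, where 'a=real] by (simp add: continuous_on_def)
    moreover have "flux p s = \<bar>s\<bar> powr p / s" for s :: real
      using flux_inner_self[of p s] by (cases "s = 0") (auto simp: flux_def field_simps)
    ultimately show ?thesis
      using 3 by (simp add: has_field_derivative_iff flux_def)
  qed
qed

definition pmean :: "'a measure \<Rightarrow> real \<Rightarrow> ('a \<Rightarrow> 'b::euclidean_space) \<Rightarrow> real" where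
  "pmean M p f = (\<integral>x. norm (f x) powr p \<partial>M)"

lemma borel_measurable_norm_powr:
  fixes f :: "'a \<Rightarrow> 'b::euclidean_space"
  assumes "f \<in> borel_measurable M"
  shows "(\<lambda>x. norm (f x) powr p) \<in> borel_measurable M"
  using assms by measurable

lemma pmean_nonneg: "0 \<le> pmean M p f"
  unfolding pmean_def by (rule integral_nonneg_AE) auto

locale sobolev_domain =
  fixes \<Omega> :: "'a::euclidean_space set" and p :: real
  assumes open_dom: "open \<Omega>" and bounded_dom: "bounded \<Omega>" and p: "1 < p"
begin

abbreviation "M \<equiv> lebesgue_on \<Omega>"

lemma sets_dom: "\<Omega> \<in> sets lebesgue"
  using open_dom by simp

lemma finite_measure_dom: "finite_measure M"
  using bounded_dom open_dom by (intro finite_measure_lebesgue_on lmeasurable_open)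

lemma integrable_const_dom: "integrable M (\<lambda>x. c :: real)"
  using finite_measure.integrable_const[OF finite_measure_dom] .

lemma LpD:
  assumes "f \<in> Lp \<Omega> p"
  shows "f \<in> borel_measurable M" "integrable M (\<lambda>x. norm (f x) powr p)"
  using assms by (auto simp: Lp_def)

lemma Lp_lincomb:
  assumes "f \<in> Lp \<Omega> p" "g \<in> Lp \<Omega> p"
  shows "(\<lambda>x. f x + c *\<^sub>R g x) \<in> Lp \<Omega> p"
proof -
  note D = LpD[OF assms(1)] LpD[OF assms(2)]
  have m: "(\<lambda>x. f x + c *\<^sub>R g x) \<in> borel_measurable M"
    using D by (intro borel_measurable_add borel_measurable_scaleR borel_measurable_const)
  have "integrable M (\<lambda>x. norm (f x + c *\<^sub>R g x) powr p)"
  proof (rule Bochner_Integration.integrable_bound)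
    show "integrable M (\<lambda>x. 2 powr p * (norm (f x) powr p + \<bar>c\<bar> powr p * norm (g x) powr p))"
      using D by simp
    show "AE x in M. norm (norm (f x + c *\<^sub>R g x) powr p)
        \<le> norm (2 powr p * (norm (f x) powr p + \<bar>c\<bar> powr p * norm (g x) powr p))"
      using norm_add_powr_le[of p "f x" "c *\<^sub>R g x" for x] p by (intro AE_I2) (simp add: powr_mult)
    show "(\<lambda>x. norm (f x + c *\<^sub>R g x) powr p) \<in> borel_measurable M"
      using m by (rule borel_measurable_norm_powr)
  qed
  with m show ?thesis by (simp add: Lp_def)
qed

lemma Lp_diff: "f \<in> Lp \<Omega> p \<Longrightarrow> g \<in> Lp \<Omega> p \<Longrightarrow> (\<lambda>x. f x - g x) \<in> Lp \<Omega> p"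
  using Lp_lincomb[of f g "-1"] by simp

lemma pmean_lincomb_le:
  assumes "f \<in> Lp \<Omega> p" "g \<in> Lp \<Omega> p" "h \<in> Lp \<Omega> p" "AE x in M. h x = f x + c *\<^sub>R g x"
  shows "pmean M p h \<le> 2 powr p * (pmean M p f + \<bar>c\<bar> powr p * pmean M p g)"
proof -
  have "pmean M p h \<le> (\<integral>x. 2 powr p * (norm (f x) powr p + \<bar>c\<bar> powr p * norm (g x) powr p) \<partial>M)"
    unfolding pmean_def
  proof (rule integral_mono_AE)
    show "AE x in M. norm (h x) powr p \<le> 2 powr p * (norm (f x) powr p
        + \<bar>c\<bar> powr p * norm (g x) powr p)"
      using assms(4)
    proof eventually_elim
      case (elim x)
      then show ?case
        using norm_add_powr_le[of p "f x" "c *\<^sub>R g x"] p by (simp add: powr_mult)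
    qed
  qed (use LpD[OF assms(1)] LpD[OF assms(2)] LpD[OF assms(3)] in auto)
  also have "\<dots> = 2 powr p * (pmean M p f + \<bar>c\<bar> powr p * pmean M p g)"
    unfolding pmean_def using LpD[OF assms(1)] LpD[OF assms(2)] by simp
  finally show ?thesis .
qed

lemma pmean_cong_AE:
  assumes "f \<in> Lp \<Omega> p" "g \<in> Lp \<Omega> p" "AE x in M. f x = g x"
  shows "pmean M p f = pmean M p g"
  unfolding pmean_def
  by (rule integral_cong_AE)
    (use LpD[OF assms(1)] LpD[OF assms(2)] assms(3) in \<open>auto elim: eventually_mono\<close>)

lemma Lp_cong_AE:
  assumes "f \<in> Lp \<Omega> p" "AE x in M. f x = g x"
  shows "g \<in> Lp \<Omega> p"
proof -
  have g: "g \<in> borel_measurable M"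
    using borel_measurable_lebesgue_on_AE[OF LpD(1)[OF assms(1)] sets_dom assms(2)] .
  have "integrable M (\<lambda>x. norm (g x) powr p)"
  proof (rule integrable_cong_AE_imp[OF LpD(2)[OF assms(1)]])
    show "(\<lambda>x. norm (g x) powr p) \<in> borel_measurable M"
      using g by (rule borel_measurable_norm_powr)
    show "AE x in M. norm (f x) powr p = norm (g x) powr p"
      using assms(2) by eventually_elim simp
  qed
  with g show ?thesis by (simp add: Lp_def)
qed

lemma norm_le_Lp: "e > 0 \<Longrightarrow> norm a \<le> e + e powr (1 - p) * norm a powr p"
  using powr_mult_small_large[of 1 "norm a" e p] p by simp

lemma Lp_integrable:
  fixes f :: "'a \<Rightarrow> 'b::euclidean_space"
  assumes "f \<in> Lp \<Omega> p"
  shows "integrable M f"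
proof (rule Bochner_Integration.integrable_bound)
  show "integrable M (\<lambda>x. 1 + norm (f x) powr p)"
    using LpD[OF assms] integrable_const_dom by simp
  show "AE x in M. norm (f x) \<le> norm (1 + norm (f x) powr p)"
    using norm_le_Lp[of 1 "f x" for x] by (intro AE_I2) simp
qed (rule LpD[OF assms])

lemma Lp_L1_loc:
  fixes f :: "'a \<Rightarrow> 'b::euclidean_space"
  assumes "f \<in> Lp \<Omega> p"
  shows "f \<in> L1_loc \<Omega>"
  unfolding L1_loc_def
proof safe
  fix K :: "'a set" assume K: "compact K" "K \<subseteq> \<Omega>"
  have sK: "K \<in> sets lebesgue" using K(1) by (simp add: borel_compact)
  have "integrable lebesgue (\<lambda>x. indicator \<Omega> x *\<^sub>R f x)"
    using Lp_integrable[OF assms] sets_dom by (simp add: integrable_restrict_space)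
  then have "integrable lebesgue (\<lambda>x. indicator K x *\<^sub>R (indicator \<Omega> x *\<^sub>R f x))"
    by (rule integrable_mult_indicator[OF sK])
  also have "(\<lambda>x. indicator K x *\<^sub>R (indicator \<Omega> x *\<^sub>R f x)) = (\<lambda>x. indicator K x *\<^sub>R f x)"
    using K(2) by (auto simp: fun_eq_iff indicator_def)
  finally show "integrable (lebesgue_on K) f"
    using sK by (simp add: integrable_restrict_space)
qed

lemma continuous_bounded_dom:
  fixes f :: "'a \<Rightarrow> 'b::euclidean_space"
  assumes "continuous_on UNIV f"
  obtains B where "B \<ge> 0" "\<And>x. x \<in> \<Omega> \<Longrightarrow> norm (f x) \<le> B"
proof -
  have "compact (f ` closure \<Omega>)"
    using bounded_dom assms by (intro compact_continuous_image) (auto intro: continuous_on_subset)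
  then obtain B where "\<And>x. x \<in> \<Omega> \<Longrightarrow> norm (f x) \<le> B"
    using compact_imp_bounded[of "f ` closure \<Omega>"] closure_subset[of \<Omega>] by (fastforce simp: bounded_iff)
  then show thesis
    by (intro that[of "max B 0"]) (auto simp: le_max_iff_disj)
qed

lemma continuous_Lp:
  fixes f :: "'a \<Rightarrow> 'b::euclidean_space"
  assumes "continuous_on UNIV f"
  shows "f \<in> Lp \<Omega> p"
proof -
  obtain B where B: "\<And>x. x \<in> \<Omega> \<Longrightarrow> norm (f x) \<le> B"
    using continuous_bounded_dom[OF assms] by metis
  have m: "f \<in> borel_measurable M"
    using continuous_imp_measurable_on_sets_lebesgue[OF continuous_on_subset[OF assms] sets_dom] by simp
  have "integrable M (\<lambda>x. norm (f x) powr p)"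
  proof (rule Bochner_Integration.integrable_bound[OF integrable_const_dom[of "\<bar>B\<bar> powr p"]])
    show "(\<lambda>x. norm (f x) powr p) \<in> borel_measurable M"
      using m by (rule borel_measurable_norm_powr)
    show "AE x in M. norm (norm (f x) powr p) \<le> norm (\<bar>B\<bar> powr p)"
      using B p by (intro AE_I2) (force intro!: powr_mono2)
  qed
  with m show ?thesis by (simp add: Lp_def)
qed

lemma W1pD:
  assumes "u \<in> W1p \<Omega> p"
  shows "u \<in> Lp \<Omega> p" "weak_grad \<Omega> u \<in> Lp \<Omega> p" "has_weak_grad \<Omega> u (weak_grad \<Omega> u)"
proof -
  obtain g where g: "g \<in> Lp \<Omega> p" "has_weak_grad \<Omega> u g"
    using assms by (auto simp: W1p_def)
  show "u \<in> Lp \<Omega> p" using assms by (simp add: W1p_def)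
  show "has_weak_grad \<Omega> u (weak_grad \<Omega> u)"
    unfolding weak_grad_def by (rule someI[of _ g]) (rule g)
  have "AE x in M. g x = weak_grad \<Omega> u x"
    using weak_grad_AE[OF open_dom g(2)] by eventually_elim simp
  then show "weak_grad \<Omega> u \<in> Lp \<Omega> p"
    by (rule Lp_cong_AE[OF g(1)])
qed

lemma W1pI: "u \<in> Lp \<Omega> p \<Longrightarrow> g \<in> Lp \<Omega> p \<Longrightarrow> has_weak_grad \<Omega> u g \<Longrightarrow> u \<in> W1p \<Omega> p"
  by (auto simp: W1p_def)

lemma W1p_lincomb:
  assumes "u \<in> W1p \<Omega> p" "v \<in> W1p \<Omega> p"
  shows "(\<lambda>x. u x + c * v x) \<in> W1p \<Omega> p"
    "AE x in M. weak_grad \<Omega> (\<lambda>x. u x + c * v x) x = weak_grad \<Omega> u x + c *\<^sub>R weak_grad \<Omega> v x"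
proof -
  note D = W1pD[OF assms(1)] W1pD[OF assms(2)]
  have g: "has_weak_grad \<Omega> (\<lambda>x. u x + c * v x) (\<lambda>x. weak_grad \<Omega> u x + c *\<^sub>R weak_grad \<Omega> v x)"
    by (rule has_weak_grad_add[OF open_dom D(3) D(6)])
  show "AE x in M. weak_grad \<Omega> (\<lambda>x. u x + c * v x) x = weak_grad \<Omega> u x + c *\<^sub>R weak_grad \<Omega> v x"
    by (rule weak_grad_AE[OF open_dom g])
  show "(\<lambda>x. u x + c * v x) \<in> W1p \<Omega> p"
    using Lp_lincomb[OF D(1) D(4), of c] by (intro W1pI[OF _ Lp_lincomb[OF D(2) D(5)] g]) simp
qed

lemma W1p_diff:
  assumes "u \<in> W1p \<Omega> p" "v \<in> W1p \<Omega> p"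
  shows "(\<lambda>x. u x - v x) \<in> W1p \<Omega> p"
    "AE x in M. weak_grad \<Omega> (\<lambda>x. u x - v x) x = weak_grad \<Omega> u x - weak_grad \<Omega> v x"
  using W1p_lincomb[OF assms, of "-1"] by simp_all

lemma C1_W1p:
  assumes "C_diff (Suc 0) u"
  shows "u \<in> W1p \<Omega> p" "AE x in M. weak_grad \<Omega> u x = classical_grad u x"
proof -
  have g: "has_weak_grad \<Omega> u (classical_grad u)"
    by (rule C1_has_weak_grad[OF open_dom assms])
  show "AE x in M. weak_grad \<Omega> u x = classical_grad u x"
    by (rule weak_grad_AE[OF open_dom g])
  show "u \<in> W1p \<Omega> p"
    by (rule W1pI[OF _ _ g]) (intro continuous_Lp C1_D continuous_classical_grad assms)+
qed

lemma test_function_W1p: "\<phi> \<in> test_functions \<Omega> \<Longrightarrow> \<phi> \<in> W1p \<Omega> p"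
  by (intro C1_W1p test_function_C1)

text \<open>The \<^term>\<open>p\<close>-th power of the Sobolev norm. Convergence in the norm is convergence of the
  modular to zero, and for the modular the inequality
  \<^term>\<open>norm (a + b) powr p \<le> 2 powr p * (norm a powr p + norm b powr p)\<close> replaces the triangle
  inequality, so Minkowski's inequality is avoided.\<close>

definition modular :: "('a \<Rightarrow> real) \<Rightarrow> real" where
  "modular u = pmean M p u + pmean M p (weak_grad \<Omega> u)"

lemma modular_nonneg: "0 \<le> modular u"
  by (simp add: modular_def pmean_nonneg)

lemma pmean_le_modular: "pmean M p u \<le> modular u" "pmean M p (weak_grad \<Omega> u) \<le> modular u"
  by (simp_all add: modular_def pmean_nonneg)

lemma W1p_norm_less_iff:
  assumes "e > 0"
  shows "W1p_norm \<Omega> p u < e \<longleftrightarrow> modular u < e powr p"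
proof -
  have N: "W1p_norm \<Omega> p u = modular u powr (1 / p)"
    by (simp add: W1p_norm_def modular_def pmean_def)
  show ?thesis
  proof
    assume "W1p_norm \<Omega> p u < e"
    then have "(modular u powr (1 / p)) powr p < e powr p"
      unfolding N using p by (intro powr_less_mono2) auto
    then show "modular u < e powr p"
      using p modular_nonneg[of u] by (simp add: powr_powr)
  next
    assume "modular u < e powr p"
    then have "modular u powr (1 / p) < (e powr p) powr (1 / p)"
      using p modular_nonneg[of u] by (intro powr_less_mono2) auto
    then show "W1p_norm \<Omega> p u < e"
      unfolding N using p assms by (simp add: powr_powr)
  qed
qed

lemma W0p_iff:
  "u \<in> W0p \<Omega> p \<longleftrightarrow> u \<in> W1p \<Omega> p \<and> (\<forall>e>0. \<exists>\<phi>\<in>test_functions \<Omega>. modular (\<lambda>x. u x - \<phi> x) < e)"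
proof -
  have "(\<forall>\<epsilon>>0. \<exists>\<phi>\<in>test_functions \<Omega>. W1p_norm \<Omega> p (\<lambda>x. u x - \<phi> x) < \<epsilon>)
      \<longleftrightarrow> (\<forall>e>0. \<exists>\<phi>\<in>test_functions \<Omega>. modular (\<lambda>x. u x - \<phi> x) < e)"
  proof (intro iffI allI impI)
    fix e :: real
    assume *: "\<forall>\<epsilon>>0. \<exists>\<phi>\<in>test_functions \<Omega>. W1p_norm \<Omega> p (\<lambda>x. u x - \<phi> x) < \<epsilon>" and "e > 0"
    then have "e powr (1 / p) > 0" by simp
    with * obtain \<phi> where "\<phi> \<in> test_functions \<Omega>" "W1p_norm \<Omega> p (\<lambda>x. u x - \<phi> x) < e powr (1 / p)"
      by blast
    then show "\<exists>\<phi>\<in>test_functions \<Omega>. modular (\<lambda>x. u x - \<phi> x) < e"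
      using W1p_norm_less_iff[OF \<open>e powr (1 / p) > 0\<close>] p \<open>e > 0\<close> by (auto simp: powr_powr)
  next
    fix e :: real
    assume *: "\<forall>e>0. \<exists>\<phi>\<in>test_functions \<Omega>. modular (\<lambda>x. u x - \<phi> x) < e" and "e > 0"
    then have "e powr p > 0" by simp
    with * obtain \<phi> where "\<phi> \<in> test_functions \<Omega>" "modular (\<lambda>x. u x - \<phi> x) < e powr p"
      by blast
    then show "\<exists>\<phi>\<in>test_functions \<Omega>. W1p_norm \<Omega> p (\<lambda>x. u x - \<phi> x) < e"
      using W1p_norm_less_iff[OF \<open>e > 0\<close>] by blast
  qed
  then show ?thesis by (simp add: W0p_def)
qed

lemma modular_lincomb_le:
  assumes "u \<in> W1p \<Omega> p" "v \<in> W1p \<Omega> p"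
  shows "modular (\<lambda>x. u x + c * v x) \<le> 2 powr p * (modular u + \<bar>c\<bar> powr p * modular v)"
proof -
  note D = W1pD[OF assms(1)] W1pD[OF assms(2)] W1pD[OF W1p_lincomb(1)[OF assms, of c]]
  have "pmean M p (\<lambda>x. u x + c * v x) \<le> 2 powr p * (pmean M p u + \<bar>c\<bar> powr p * pmean M p v)"
    by (rule pmean_lincomb_le[OF D(1) D(4) D(7)]) simp
  moreover have "pmean M p (weak_grad \<Omega> (\<lambda>x. u x + c * v x))
      \<le> 2 powr p * (pmean M p (weak_grad \<Omega> u) + \<bar>c\<bar> powr p * pmean M p (weak_grad \<Omega> v))"
    by (rule pmean_lincomb_le[OF D(2) D(5) D(8) W1p_lincomb(2)[OF assms]])
  ultimately show ?thesis
    by (simp add: modular_def algebra_simps)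
qed

lemma W0p_W1p: "u \<in> W0p \<Omega> p \<Longrightarrow> u \<in> W1p \<Omega> p"
  by (simp add: W0p_iff)

lemma modular_zero: "modular (\<lambda>x. 0) = 0"
proof -
  have "(\<lambda>x. 0) \<in> W1p \<Omega> p" using zero_test_function by (rule test_function_W1p)
  from W1p_lincomb(2)[OF this this, of "-1"]
  have "AE x in M. weak_grad \<Omega> (\<lambda>x. 0) x = 0" by simp
  then have "pmean M p (weak_grad \<Omega> (\<lambda>x. 0)) = 0"
    unfolding pmean_def by (intro integral_eq_zero_AE) (auto elim: eventually_mono)
  then show ?thesis by (simp add: modular_def pmean_def)
qed

lemma test_function_W0p: "\<phi> \<in> test_functions \<Omega> \<Longrightarrow> \<phi> \<in> W0p \<Omega> p"
  unfolding W0p_iff by (auto intro!: bexI[of _ \<phi>] test_function_W1p simp: modular_zero)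

lemma W0p_lincomb:
  assumes u: "u \<in> W0p \<Omega> p" and v: "v \<in> W0p \<Omega> p"
  shows "(\<lambda>x. u x + c * v x) \<in> W0p \<Omega> p"
  unfolding W0p_iff
proof (intro conjI allI impI)
  note W = W0p_W1p[OF u] W0p_W1p[OF v]
  show "(\<lambda>x. u x + c * v x) \<in> W1p \<Omega> p" by (rule W1p_lincomb(1)[OF W])
  fix e :: real assume "e > 0"
  define K where "K = 2 powr p * (1 + \<bar>c\<bar> powr p)"
  have K: "K > 0" by (auto simp: K_def intro!: mult_pos_pos add_pos_nonneg)
  then have "e / K > 0" using \<open>e > 0\<close> by simp
  then obtain \<phi> \<psi> where \<phi>: "\<phi> \<in> test_functions \<Omega>" "modular (\<lambda>x. u x - \<phi> x) < e / K"
    and \<psi>: "\<psi> \<in> test_functions \<Omega>" "modular (\<lambda>x. v x - \<psi> x) < e / K"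
    using u v unfolding W0p_iff by meson
  have "(\<lambda>x. (u x - \<phi> x) + c * (v x - \<psi> x)) = (\<lambda>x. u x + c * v x - (\<phi> x + c * \<psi> x))"
    by (simp add: fun_eq_iff algebra_simps)
  then have "modular (\<lambda>x. u x + c * v x - (\<phi> x + c * \<psi> x))
      \<le> 2 powr p * (modular (\<lambda>x. u x - \<phi> x) + \<bar>c\<bar> powr p * modular (\<lambda>x. v x - \<psi> x))"
    using modular_lincomb_le[OF W1p_diff(1)[OF W(1) test_function_W1p[OF \<phi>(1)]]
        W1p_diff(1)[OF W(2) test_function_W1p[OF \<psi>(1)]], of c] by simp
  also have "\<dots> < 2 powr p * (e / K + \<bar>c\<bar> powr p * (e / K))"
    using \<phi>(2) \<psi>(2) by (intro mult_strict_left_mono add_less_le_mono mult_left_mono) auto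
  also have "\<dots> = K * (e / K)"
    unfolding K_def by (simp only: distrib_left distrib_right mult.assoc mult_1_left)
  also have "\<dots> = e"
    using K by simp
  finally show "\<exists>\<eta>\<in>test_functions \<Omega>. modular (\<lambda>x. u x + c * v x - \<eta> x) < e"
    using test_functions_lincomb[OF \<phi>(1) \<psi>(1), of c] by (rule bexI)
qed

lemma W0p_closed:
  assumes u: "u \<in> W1p \<Omega> p" and v: "\<And>k. v k \<in> W0p \<Omega> p"
    and lim: "(\<lambda>k. modular (\<lambda>x. u x - v k x)) \<longlonglongrightarrow> 0"
  shows "u \<in> W0p \<Omega> p"
  unfolding W0p_iff
proof (intro conjI allI impI u)
  fix e :: real assume "e > 0"
  define K where "K = 2 powr p * 2"
  have K: "K > 0" by (simp add: K_def)
  then have "e / K > 0" using \<open>e > 0\<close> by simp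
  then obtain k where k: "modular (\<lambda>x. u x - v k x) < e / K"
    using order_tendstoD(2)[OF lim] by (meson eventually_happens sequentially_bot)
  obtain \<phi> where \<phi>: "\<phi> \<in> test_functions \<Omega>" "modular (\<lambda>x. v k x - \<phi> x) < e / K"
    using v[of k] \<open>e / K > 0\<close> unfolding W0p_iff by meson
  have "(\<lambda>x. (u x - v k x) + 1 * (v k x - \<phi> x)) = (\<lambda>x. u x - \<phi> x)" by simp
  then have "modular (\<lambda>x. u x - \<phi> x)
      \<le> 2 powr p * (modular (\<lambda>x. u x - v k x) + \<bar>1\<bar> powr p * modular (\<lambda>x. v k x - \<phi> x))"
    using modular_lincomb_le[OF W1p_diff(1)[OF u W0p_W1p[OF v]]
        W1p_diff(1)[OF W0p_W1p[OF v] test_function_W1p[OF \<phi>(1)]], of k 1 k] by simp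
  also have "\<dots> < 2 powr p * (e / K + e / K)"
    using k \<phi>(2) by (intro mult_strict_left_mono) auto
  also have "\<dots> = e"
    using K by (simp add: K_def field_simps)
  finally show "\<exists>\<phi>\<in>test_functions \<Omega>. modular (\<lambda>x. u x - \<phi> x) < e"
    using \<phi>(1) by blast
qed

end

section \<open>The inequality of Poincare and limits of weak gradients\<close>

context sobolev_domain
begin

text \<open>The integral of the derivative of \<^term>\<open>\<lambda>x. (x \<bullet> e) * \<bar>\<phi> x\<bar> powr p\<close> in a coordinate
  direction \<^term>\<open>e\<close> is zero. Since \<^term>\<open>x \<bullet> e\<close> has derivative one, this expresses the
  mean of \<^term>\<open>\<phi>\<close> through its gradient, up to a factor that Young's inequality absorbs.\<close>

lemma poincare_test_function:
  "\<exists>C\<ge>0. \<forall>\<phi>\<in>test_functions \<Omega>. pmean M p \<phi> \<le> C * pmean M p (classical_grad \<phi>)"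
proof -
  obtain e :: 'a where e: "e \<in> Basis" using nonempty_Basis by blast
  obtain R where R: "R \<ge> 1" "\<And>x. x \<in> \<Omega> \<Longrightarrow> norm x \<le> R"
    using bounded_dom unfolding bounded_iff by (metis le_max_iff_disj order_refl)
  \<comment> \<open>Chosen so that Young's inequality returns exactly half of the left-hand side.\<close>
  define \<epsilon> where "\<epsilon> = 1 / (2 * p * R)"
  have \<epsilon>: "\<epsilon> > 0" "p * R * \<epsilon> = 1 / 2" using R p by (auto simp: \<epsilon>_def field_simps)
  define C where "C = 2 * (p * R * \<epsilon> powr (1 - p))"
  have C: "C \<ge> 0" using R p by (simp add: C_def)
  have "pmean M p \<phi> \<le> C * pmean M p (classical_grad \<phi>)" if \<phi>: "\<phi> \<in> test_functions \<Omega>" for \<phi>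
  proof -
    obtain K where K: "compact K" "K \<subseteq> \<Omega>" "\<And>x. x \<notin> K \<Longrightarrow> \<phi> x = 0"
      "\<And>x v. x \<notin> K \<Longrightarrow> frechet_derivative \<phi> (at x) v = 0"
      using test_function_support[OF \<phi>] by metis
    note C1 = test_function_C1[OF \<phi>]
    let ?d = "\<lambda>x. frechet_derivative \<phi> (at x) e"
    let ?T1 = "\<lambda>x. (x \<bullet> e) * (p * flux p (\<phi> x) * ?d x)" and ?T2 = "\<lambda>x. \<bar>\<phi> x\<bar> powr p"
    have h': "continuous_on UNIV (\<lambda>s::real. p * flux p s)"
      by (intro continuous_intros continuous_flux p)
    have P1: "C_diff (Suc 0) ?T2"
      using abs_powr_has_derivative[OF p] h' C1 by (rule C1_comp_real)
    have dP: "frechet_derivative ?T2 (at x) v = p * flux p (\<phi> x) * frechet_derivative \<phi> (at x) v"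
        for x v
      by (rule frechet_derivative_comp_real[OF abs_powr_has_derivative[OF p] C1_D(1)[OF C1]])
    have dL: "((\<lambda>x. x \<bullet> e) has_derivative (\<lambda>v. v \<bullet> e)) (at x)" for x
      by (auto intro!: derivative_eq_intros)
    have dL': "(\<lambda>x. x \<bullet> e) differentiable (at x)" "frechet_derivative (\<lambda>x. x \<bullet> e) (at x) e = 1" for x
      using dL[of x] e by (auto simp: differentiable_def frechet_derivative_at')
    have dF: "frechet_derivative (\<lambda>x. (x \<bullet> e) * ?T2 x) (at x) e = ?T1 x + ?T2 x" for x
      by (subst frechet_derivative_mult_real[OF dL'(1) C1_D(1)[OF P1]]) (simp only: dP dL'(2)
          mult_1_left)
    have cT1: "continuous_on UNIV ?T1"
      by (intro continuous_intros continuous_on_compose2[OF continuous_flux[OF p]] C1_D[OF C1]) auto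
    have cT2: "continuous_on UNIV ?T2"
      by (rule C1_D(2)[OF P1])
    have z: "?T1 x = 0" "?T2 x = 0" if "x \<notin> K" for x
      using K that by auto
    have "(\<integral>x. frechet_derivative (\<lambda>x. (x \<bullet> e) * ?T2 x) (at x) e \<partial>lborel) = 0"
    proof (rule integral_directional_derivative_eq_0[OF _ _ K(1)])
      show "(\<lambda>x. (x \<bullet> e) * ?T2 x) differentiable at x" for x
        by (intro differentiable_mult dL' C1_D(1)[OF P1])
      show "continuous_on UNIV (\<lambda>x. frechet_derivative (\<lambda>x. (x \<bullet> e) * ?T2 x) (at x) e)"
        unfolding dF by (intro continuous_on_add cT1 cT2)
    qed (use z in auto)
    moreover note int = integrable_lborel_continuous_compact_support[OF cT1 K(1) z(1)]
      integrable_lborel_continuous_compact_support[OF cT2 K(1) z(2)]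
    ultimately have sum0: "(\<integral>x. ?T1 x \<partial>lborel) + (\<integral>x. ?T2 x \<partial>lborel) = 0"
      unfolding dF by simp
    have out: "?T1 x = 0" "?T2 x = 0" if "x \<notin> \<Omega>" for x
      by (rule z(1), use K(2) that in blast) (rule z(2), use K(2) that in blast)
    note conv1 = integral_lebesgue_on_support[OF borel_measurable_continuous_onI[OF cT1] sets_dom
        out(1)]
    note conv2 = integral_lebesgue_on_support[OF borel_measurable_continuous_onI[OF cT2] sets_dom
        out(2)]
    have intM: "integrable M ?T1" "integrable M ?T2"
      using int conv1 conv2 by blast+
    have "(\<integral>x. ?T1 x \<partial>M) + (\<integral>x. ?T2 x \<partial>M) = 0"
      by (subst conv1(1), assumption, subst conv2(1), assumption) (rule sum0)
    then have "(\<integral>x. ?T2 x \<partial>M) = (\<integral>x. - ?T1 x \<partial>M)"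
      using intM by simp
    also have "\<dots> \<le> (\<integral>x. 1 / 2 * ?T2 x + C / 2 * norm (classical_grad \<phi> x) powr p \<partial>M)"
    proof (rule integral_mono)
      have "classical_grad \<phi> \<in> Lp \<Omega> p"
        by (intro continuous_Lp continuous_classical_grad C1)
      then show "integrable M (\<lambda>x. 1 / 2 * ?T2 x + C / 2 * norm (classical_grad \<phi> x) powr p)"
        using intM LpD(2) by (intro Bochner_Integration.integrable_add integrable_mult_right)
      show "integrable M (\<lambda>x. - ?T1 x)" using intM(1) by (rule Bochner_Integration.integrable_minus)
      fix x assume "x \<in> space M"
      then have "\<bar>x \<bullet> e\<bar> \<le> R"
        using R(2)[of x] Basis_le_norm[OF e, of x] by simp
      have "\<bar>?d x\<bar> \<le> norm (classical_grad \<phi> x)"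
        using Basis_le_norm[OF e, of "classical_grad \<phi> x"] classical_grad_inner[OF C1_D(1)[OF C1]]
            by simp
      have "- ?T1 x \<le> \<bar>?T1 x\<bar>" by (rule abs_ge_minus_self)
      also have "\<dots> = \<bar>x \<bullet> e\<bar> * (p * (\<bar>\<phi> x\<bar> powr (p - 1) * \<bar>?d x\<bar>))"
        using p norm_flux[of p "\<phi> x"] by (simp add: abs_mult mult.assoc)
      also have "\<dots> \<le> R * (p * (\<bar>\<phi> x\<bar> powr (p - 1) * norm (classical_grad \<phi> x)))"
        using \<open>\<bar>x \<bullet> e\<bar> \<le> R\<close> \<open>\<bar>?d x\<bar> \<le> norm (classical_grad \<phi> x)\<close> p R(1)
        by (intro mult_mono mult_left_mono) auto
      also have "\<dots> \<le> R * (p * (\<epsilon> * \<bar>\<phi> x\<bar> powr p + \<epsilon> powr (1 - p) * norm (classical_grad \<phi> x) powr p))"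
        using powr_mult_small_large[of "\<bar>\<phi> x\<bar>" "norm (classical_grad \<phi> x)" \<epsilon> p] \<epsilon> p R(1)
        by (intro mult_left_mono) auto
      also have "\<dots> = (p * R * \<epsilon>) * \<bar>\<phi> x\<bar> powr p + C / 2 * norm (classical_grad \<phi> x) powr p"
        by (simp add: C_def algebra_simps)
      finally show "- ?T1 x \<le> 1 / 2 * ?T2 x + C / 2 * norm (classical_grad \<phi> x) powr p"
        unfolding \<epsilon>(2) .
    qed
    also have "\<dots> = 1 / 2 * (\<integral>x. ?T2 x \<partial>M) + C / 2 * pmean M p (classical_grad \<phi>)"
      using intM LpD(2)[OF continuous_Lp[OF continuous_classical_grad[OF C1]]]
      unfolding pmean_def by (subst Bochner_Integration.integral_add) auto
    finally show ?thesis
      by (simp add: pmean_def)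
  qed
  with C show ?thesis by blast
qed

text \<open>The inequality passes to the closure of the test functions, with a worse constant because
  the triangle inequality is only available up to the factor \<^term>\<open>2 powr p\<close>.\<close>

lemma poincare:
  "\<exists>C\<ge>0. \<forall>u\<in>W0p \<Omega> p. pmean M p u \<le> C * pmean M p (weak_grad \<Omega> u)"
proof -
  obtain C0 where C0: "C0 \<ge> 0" "\<And>\<phi>. \<phi> \<in> test_functions \<Omega> \<Longrightarrow> pmean M p \<phi>
      \<le> C0 * pmean M p (classical_grad \<phi>)"
    using poincare_test_function by blast
  define t where "t = (2::real) powr p"
  have t: "t > 0" by (simp add: t_def)
  have "pmean M p u \<le> (t * C0 * t) * pmean M p (weak_grad \<Omega> u)" if u: "u \<in> W0p \<Omega> p" for u
  proof (rule field_le_epsilon)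
    fix e :: real assume "e > 0"
    define K where "K = t * C0 * t + t"
    have K: "K > 0" using t C0(1) by (auto simp: K_def intro!: add_nonneg_pos mult_nonneg_nonneg)
    obtain \<phi> where \<phi>: "\<phi> \<in> test_functions \<Omega>" "modular (\<lambda>x. u x - \<phi> x) < e / K"
      using u \<open>e > 0\<close> K unfolding W0p_iff by (meson divide_pos_pos)
    note W = W0p_W1p[OF u] test_function_W1p[OF \<phi>(1)]
    note D = W1pD[OF W(1)] W1pD[OF W(2)] W1pD[OF W1p_diff(1)[OF W]]
    have less: "pmean M p (\<lambda>x. u x - \<phi> x) \<le> e / K" "pmean M p (weak_grad \<Omega> (\<lambda>x. u x - \<phi> x)) \<le> e / K"
      using \<phi>(2) pmean_le_modular[of "\<lambda>x. u x - \<phi> x"] by linarith+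
    have "pmean M p u \<le> t * (pmean M p \<phi> + \<bar>1\<bar> powr p * pmean M p (\<lambda>x. u x - \<phi> x))"
      unfolding t_def by (rule pmean_lincomb_le[OF D(4) D(7) D(1)]) simp
    also have "\<dots> \<le> t * (C0 * pmean M p (classical_grad \<phi>) + e / K)"
      using t C0(2)[OF \<phi>(1)] less by (intro mult_left_mono add_mono) auto
    also have "pmean M p (classical_grad \<phi>) = pmean M p (weak_grad \<Omega> \<phi>)"
      using C1_W1p(2)[OF test_function_C1[OF \<phi>(1)]] D(5)
        continuous_Lp[OF continuous_classical_grad[OF test_function_C1[OF \<phi>(1)]]]
      by (intro pmean_cong_AE) (auto elim: eventually_mono)
    also have "pmean M p (weak_grad \<Omega> \<phi>)
        \<le> t * (pmean M p (weak_grad \<Omega> u) + \<bar>-1\<bar> powr p * pmean M p (weak_grad \<Omega> (\<lambda>x. u x - \<phi> x)))"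
      unfolding t_def
    proof (rule pmean_lincomb_le[OF D(2) D(8) D(5)])
      show "AE x in M. weak_grad \<Omega> \<phi> x = weak_grad \<Omega> u x + -1 *\<^sub>R weak_grad \<Omega> (\<lambda>x. u x - \<phi> x) x"
        using W1p_diff(2)[OF W] by eventually_elim simp
    qed
    also have "\<dots> \<le> t * (pmean M p (weak_grad \<Omega> u) + e / K)"
      using t less by (intro mult_left_mono) auto
    finally have "pmean M p u \<le> t * (C0 * (t * (pmean M p (weak_grad \<Omega> u) + e / K)) + e / K)"
      using t C0(1) by (simp add: mult_left_mono)
    also have "\<dots> = (t * C0 * t) * pmean M p (weak_grad \<Omega> u) + K * (e / K)"
      unfolding K_def by (simp only: distrib_left distrib_right mult.assoc add.assoc)
    also have "K * (e / K) = e" using K by simp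
    finally show "pmean M p u \<le> (t * C0 * t) * pmean M p (weak_grad \<Omega> u) + e" .
  qed
  then show ?thesis
    using C0(1) t by (intro exI[of _ "t * C0 * t"]) auto
qed

lemma integrable_Lp_inner_continuous:
  fixes f b :: "'a \<Rightarrow> 'b::euclidean_space"
  assumes "f \<in> Lp \<Omega> p" "continuous_on UNIV b"
  shows "integrable M (\<lambda>x. f x \<bullet> b x)"
proof -
  obtain B where B: "\<And>x. x \<in> \<Omega> \<Longrightarrow> norm (b x) \<le> B"
    using continuous_bounded_dom[OF assms(2)] by metis
  show ?thesis
  proof (rule Bochner_Integration.integrable_bound)
    show "integrable M (\<lambda>x. norm (f x) * B)"
      using Lp_integrable[OF assms(1)] by simp
    show "(\<lambda>x. f x \<bullet> b x) \<in> borel_measurable M"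
      using LpD(1)[OF assms(1)] LpD(1)[OF continuous_Lp[OF assms(2)]] by (rule borel_measurable_inner)
    show "AE x in M. norm (f x \<bullet> b x) \<le> norm (norm (f x) * B)"
    proof (rule AE_I2)
      fix x assume "x \<in> space M"
      then have "norm (f x) * norm (b x) \<le> norm (f x) * B"
        using B by (intro mult_left_mono) auto
      then show "norm (f x \<bullet> b x) \<le> norm (norm (f x) * B)"
        using Cauchy_Schwarz_ineq2[of "f x" "b x"] by simp
    qed
  qed
qed

text \<open>Convergence in the mean of order \<^term>\<open>p\<close> on a set of finite measure implies convergence in
  the mean: a number is at most \<^term>\<open>e\<close> plus a multiple of its \<^term>\<open>p\<close>-th power.\<close>

lemma Lp_tendsto_integral_inner:
  fixes f :: "nat \<Rightarrow> 'a \<Rightarrow> 'b::euclidean_space"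
  assumes f: "\<And>k. f k \<in> Lp \<Omega> p" and g: "g \<in> Lp \<Omega> p" and b: "continuous_on UNIV b"
    and lim: "(\<lambda>k. pmean M p (\<lambda>x. f k x - g x)) \<longlonglongrightarrow> 0"
  shows "(\<lambda>k. \<integral>x. f k x \<bullet> b x \<partial>M) \<longlonglongrightarrow> (\<integral>x. g x \<bullet> b x \<partial>M)"
proof -
  obtain B where B: "B \<ge> 0" "\<And>x. x \<in> \<Omega> \<Longrightarrow> norm (b x) \<le> B"
    using continuous_bounded_dom[OF b] by blast
  define \<mu> where "\<mu> = measure M (space M)"
  have bound: "\<bar>(\<integral>x. f k x \<bullet> b x \<partial>M) - (\<integral>x. g x \<bullet> b x \<partial>M)\<bar>
      \<le> B * (e * \<mu> + e powr (1 - p) * pmean M p (\<lambda>x. f k x - g x))" if "e > 0" for e k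
  proof -
    note d = Lp_diff[OF f[of k] g]
    have "\<bar>(\<integral>x. f k x \<bullet> b x \<partial>M) - (\<integral>x. g x \<bullet> b x \<partial>M)\<bar> = \<bar>\<integral>x. (f k x - g x) \<bullet> b x \<partial>M\<bar>"
      using integrable_Lp_inner_continuous[OF f[of k] b] integrable_Lp_inner_continuous[OF g b]
      by (simp add: inner_diff_left)
    also have "\<dots> \<le> (\<integral>x. B * (e + e powr (1 - p) * norm (f k x - g x) powr p) \<partial>M)"
    proof (rule integral_abs_bound_integral)
      show "integrable M (\<lambda>x. (f k x - g x) \<bullet> b x)"
        by (rule integrable_Lp_inner_continuous[OF d b])
      show "integrable M (\<lambda>x. B * (e + e powr (1 - p) * norm (f k x - g x) powr p))"
        using LpD(2)[OF d] integrable_const_dom by simp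
      fix x assume "x \<in> space M"
      have "\<bar>(f k x - g x) \<bullet> b x\<bar> \<le> norm (f k x - g x) * norm (b x)"
        by (rule Cauchy_Schwarz_ineq2)
      also have "\<dots> \<le> (e + e powr (1 - p) * norm (f k x - g x) powr p) * B"
        using B \<open>x \<in> space M\<close> norm_le_Lp[OF \<open>e > 0\<close>, of "f k x - g x"] \<open>e > 0\<close>
        by (intro mult_mono) auto
      finally show "\<bar>(f k x - g x) \<bullet> b x\<bar> \<le> B * (e + e powr (1 - p) * norm (f k x - g x) powr p)"
        by (simp add: mult.commute)
    qed
    also have "\<dots> = B * (e * \<mu> + e powr (1 - p) * pmean M p (\<lambda>x. f k x - g x))"
      using LpD(2)[OF d] integrable_const_dom by (simp add: pmean_def \<mu>_def mult.commute)
    finally show ?thesis .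
  qed
  show ?thesis
  proof (rule LIMSEQ_I)
    fix c :: real assume "c > 0"
    have "\<mu> \<ge> 0" by (simp add: \<mu>_def)
    define e where "e = c / (2 * (B * \<mu> + 1))"
    have pos: "B * \<mu> + 1 > 0" using B \<open>\<mu> \<ge> 0\<close> by (simp add: add_nonneg_pos)
    then have e: "e > 0" using \<open>c > 0\<close> by (simp add: e_def)
    have "(\<lambda>k. B * (e * \<mu> + e powr (1 - p) * pmean M p (\<lambda>x. f k x - g x))) \<longlonglongrightarrow> B * (e * \<mu>
        + e powr (1 - p) * 0)"
      by (intro tendsto_intros lim)
    moreover have "B * (e * \<mu> + e powr (1 - p) * 0) < c"
    proof -
      have "B * (e * \<mu>) = e * (B * \<mu>)" by simp
      also have "\<dots> < e * (2 * (B * \<mu> + 1))"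
        using e B \<open>\<mu> \<ge> 0\<close> by (intro mult_strict_left_mono) (auto simp: add_nonneg_pos)
      also have "\<dots> = c" using pos by (simp add: e_def)
      finally show ?thesis by simp
    qed
    ultimately have "\<forall>\<^sub>F k in sequentially. B * (e * \<mu>
        + e powr (1 - p) * pmean M p (\<lambda>x. f k x - g x)) < c"
      by (rule order_tendstoD)
    then have "\<forall>\<^sub>F k in sequentially. norm ((\<integral>x. f k x \<bullet> b x \<partial>M) - (\<integral>x. g x \<bullet> b x \<partial>M)) < c"
      by eventually_elim (use bound[OF e] in \<open>auto intro: le_less_trans\<close>)
    then show "\<exists>no. \<forall>n\<ge>no. norm ((\<integral>x. f n x \<bullet> b x \<partial>M) - (\<integral>x. g x \<bullet> b x \<partial>M)) < c"
      by (simp add: eventually_sequentially)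
  qed
qed

lemma has_weak_grad_limit:
  assumes u: "\<And>k. u k \<in> Lp \<Omega> p" and g: "\<And>k. g k \<in> Lp \<Omega> p" and w: "\<And>k. has_weak_grad \<Omega> (u k) (g k)"
    and U: "U \<in> Lp \<Omega> p" and G: "G \<in> Lp \<Omega> p"
    and limu: "(\<lambda>k. pmean M p (\<lambda>x. u k x - U x)) \<longlonglongrightarrow> 0"
    and limg: "(\<lambda>k. pmean M p (\<lambda>x. g k x - G x)) \<longlonglongrightarrow> 0"
  shows "has_weak_grad \<Omega> U G"
  unfolding has_weak_grad_def
proof (intro conjI ballI)
  show "U \<in> L1_loc \<Omega>" "G \<in> L1_loc \<Omega>" using U G by (auto intro: Lp_L1_loc)
  fix \<phi> and i :: 'a assume \<phi>: "\<phi> \<in> test_functions \<Omega>" and i: "i \<in> Basis"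
  note C = C1_D[OF test_function_C1[OF \<phi>]]
  have "(\<lambda>k. \<integral>x. u k x \<bullet> frechet_derivative \<phi> (at x) i \<partial>M)
      \<longlonglongrightarrow> (\<integral>x. U x \<bullet> frechet_derivative \<phi> (at x) i \<partial>M)"
    by (rule Lp_tendsto_integral_inner[OF u U C(3) limu])
  moreover have "(\<lambda>k. \<integral>x. g k x \<bullet> (\<phi> x *\<^sub>R i) \<partial>M) \<longlonglongrightarrow> (\<integral>x. G x \<bullet> (\<phi> x *\<^sub>R i) \<partial>M)"
    by (rule Lp_tendsto_integral_inner[OF g G _ limg]) (intro continuous_intros C(2))
  then have "(\<lambda>k. - (\<integral>x. g k x \<bullet> (\<phi> x *\<^sub>R i) \<partial>M)) \<longlonglongrightarrow> - (\<integral>x. G x \<bullet> (\<phi> x *\<^sub>R i) \<partial>M)"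
    by (rule tendsto_minus)
  moreover have "(\<integral>x. u k x \<bullet> frechet_derivative \<phi> (at x) i \<partial>M) = - (\<integral>x. g k x \<bullet> (\<phi> x *\<^sub>R i) \<partial>M)" for k
    using w[of k] \<phi> i by (simp add: has_weak_grad_def mult.commute)
  ultimately have "(\<integral>x. U x \<bullet> frechet_derivative \<phi> (at x) i \<partial>M) = - (\<integral>x. G x \<bullet> (\<phi> x *\<^sub>R i) \<partial>M)"
    using LIMSEQ_unique by simp
  then show "(\<integral>x. U x * frechet_derivative \<phi> (at x) i \<partial>M) = - (\<integral>x. (G x \<bullet> i) * \<phi> x \<partial>M)"
    by (simp add: mult.commute)
qed

end

section \<open>Uniform convexity of the p-th power of the norm\<close>

lemma flux_real_nonneg: "s \<ge> 0 \<Longrightarrow> flux p (s::real) = s powr (p - 1)"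
  using powr_mult_base[of s "p - 2"] by (cases "s = 0") (auto simp: flux_def mult.commute)

lemma powr_midpoint_less:
  fixes x y :: real
  assumes p: "p > 1" and xy: "0 \<le> x" "x < y"
  shows "((x + y) / 2) powr p < (x powr p + y powr p) / 2"
proof -
  define m where "m = (x + y) / 2"
  have m: "x < m" "m < y" "m - x = y - m" using xy by (auto simp: m_def field_simps)
  obtain z where z: "x < z" "z < m" "\<bar>m\<bar> powr p - \<bar>x\<bar> powr p = (m - x) * (p * flux p z)"
    using MVT2[of x m "\<lambda>s. \<bar>s\<bar> powr p" "\<lambda>s. p * flux p s"] m abs_powr_has_derivative[OF p] by blast
  obtain z' where z': "m < z'" "z' < y" "\<bar>y\<bar> powr p - \<bar>m\<bar> powr p = (y - m) * (p * flux p z')"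
    using MVT2[of m y "\<lambda>s. \<bar>s\<bar> powr p" "\<lambda>s. p * flux p s"] m abs_powr_has_derivative[OF p] by blast
  have "flux p z < flux p z'"
    using z z' xy p m by (simp add: flux_real_nonneg powr_less_mono2)
  then have "(m - x) * (p * flux p z) < (y - m) * (p * flux p z')"
    unfolding m(3) using m p by (intro mult_strict_left_mono) auto
  then show ?thesis
    using z(3) z'(3) xy m by (simp add: m_def)
qed

text \<open>Strict convexity has two sources: vectors of different length are separated by the strict
  convexity of the power, vectors of equal length by the parallelogram law.\<close>

lemma norm_powr_midpoint_less:
  fixes a b :: "'a::euclidean_space"
  assumes p: "p > 1" and ab: "a \<noteq> b"
  shows "norm ((1 / 2) *\<^sub>R (a + b)) powr p < (norm a powr p + norm b powr p) / 2"
proof (cases "norm a = norm b")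
  case True
  have "(norm (a + b))\<^sup>2 + (norm (a - b))\<^sup>2 = 4 * (norm a)\<^sup>2"
  proof -
    have "a \<bullet> a = b \<bullet> b" using True by (metis power2_norm_eq_inner)
    then show ?thesis by (simp add: power2_norm_eq_inner inner_simps inner_commute)
  qed
  moreover have "(norm (a - b))\<^sup>2 > 0" using ab by simp
  ultimately have "(norm (a + b))\<^sup>2 < 4 * (norm a)\<^sup>2"
    by linarith
  then have "(norm (a + b))\<^sup>2 < (2 * norm a)\<^sup>2"
    by (simp add: power_mult_distrib)
  then have "norm (a + b) < 2 * norm a"
    by (rule power2_less_imp_less) simp
  then have "norm ((1 / 2) *\<^sub>R (a + b)) powr p < norm a powr p"
    using p by (intro powr_less_mono2) auto
  with True show ?thesis by simp
next
  case False
  have "norm ((1 / 2) *\<^sub>R (a + b)) powr p \<le> ((norm a + norm b) / 2) powr p"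
    using p norm_triangle_ineq[of a b] by (intro powr_mono2) auto
  also have "\<dots> < (norm a powr p + norm b powr p) / 2"
  proof (cases "norm a < norm b")
    case True
    then show ?thesis using powr_midpoint_less[OF p, of "norm a" "norm b"] by simp
  next
    case False
    then show ?thesis
      using \<open>norm a \<noteq> norm b\<close> powr_midpoint_less[OF p, of "norm b" "norm a"] by (simp add: add.commute)
  qed
  finally show ?thesis .
qed

text \<open>A qualitative substitute for Clarkson's inequalities that treats all exponents above one
  alike. On the compact set of normalised pairs that are not too close the convexity defect has a
  positive minimum; all terms are homogeneous of degree \<^term>\<open>p\<close>, which extends the estimate
  to all pairs.\<close>

lemma uniform_convexity_powr:
  fixes p \<epsilon> :: real
  assumes p: "p > 1" and \<epsilon>: "\<epsilon> > 0"
  obtains C where "C \<ge> 0" "\<And>a b :: 'a::euclidean_space. norm (a - b) powr p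
     \<le> \<epsilon> * (norm a powr p + norm b powr p)
       + C * ((norm a powr p + norm b powr p) / 2 - norm ((1 / 2) *\<^sub>R (a + b)) powr p)"
proof -
  define N where "N z = norm (fst z :: 'a) powr p + norm (snd z :: 'a) powr p" for z
  define d where "d z = norm (fst z - snd z :: 'a) powr p" for z
  define g where "g z = N z / 2 - norm ((1 / 2) *\<^sub>R (fst z + snd z :: 'a)) powr p" for z
  have cont: "continuous_on UNIV N" "continuous_on UNIV d" "continuous_on UNIV g"
    unfolding N_def d_def g_def using p by (intro continuous_intros continuous_on_powr' ; simp)+
  have g_nonneg: "g z \<ge> 0" and g_pos: "fst z \<noteq> snd z \<Longrightarrow> g z > 0" for z
  proof -
    show pos: "g z > 0" if "fst z \<noteq> snd z" for z
      using norm_powr_midpoint_less[OF p that] by (simp add: g_def N_def)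
    show "g z \<ge> 0"
    proof (cases "fst z = snd z")
      case True
      have "(1 / 2) *\<^sub>R (snd z + snd z) = snd z" by (simp flip: scaleR_2)
      then show ?thesis using True by (simp add: g_def N_def)
    qed (use pos in force)
  qed
  define S where "S = {z. N z = 1 \<and> d z \<ge> \<epsilon>}"
  have "closed S"
    unfolding S_def Collect_conj_eq using cont
    by (intro closed_Int closed_Collect_eq closed_Collect_le continuous_on_const)
  moreover have "bounded S"
  proof -
    have "norm z \<le> 2" if "z \<in> S" for z
    proof -
      have "norm (fst z) powr p \<le> 1 powr p" "norm (snd z) powr p \<le> 1 powr p"
        using that by (auto simp: S_def N_def) (smt (verit) powr_ge_zero)+
      then have "norm (fst z) \<le> 1" "norm (snd z) \<le> 1"
        using p by (smt (verit) norm_ge_zero powr_less_mono2)+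
      then show ?thesis
        using norm_Pair_le[of "fst z" "snd z"] by simp
    qed
    then show ?thesis by (meson bounded_iff)
  qed
  ultimately have "compact S" by (simp add: compact_eq_bounded_closed)
  obtain \<delta> where \<delta>: "\<delta> > 0" "\<And>z. z \<in> S \<Longrightarrow> \<delta> \<le> g z"
  proof (cases "S = {}")
    case True
    then show ?thesis using that[of 1] by simp
  next
    case False
    obtain z0 where z0: "z0 \<in> S" "\<And>z. z \<in> S \<Longrightarrow> g z0 \<le> g z"
      using continuous_attains_inf[OF \<open>compact S\<close> False continuous_on_subset[OF cont(3)]] by auto
    have "fst z0 \<noteq> snd z0" using z0(1) \<epsilon> p by (auto simp: S_def d_def)
    then show ?thesis using that[of "g z0"] g_pos z0(2) by blast
  qed
  define C where "C = 2 powr p / \<delta>"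
  have C: "C \<ge> 0" using \<delta> by (simp add: C_def)
  have unit: "d z \<le> \<epsilon> * N z + C * g z" if "N z = 1" for z
  proof (cases "d z \<ge> \<epsilon>")
    case True
    have "d z \<le> 2 powr p * N z"
      using norm_add_powr_le[of p "fst z" "- snd z"] p by (simp add: d_def N_def)
    also have "\<dots> = C * \<delta>" using \<delta> that by (simp add: C_def)
    also have "\<dots> \<le> C * g z"
      using True that \<delta>(2)[of z] C by (intro mult_left_mono) (auto simp: S_def)
    finally show ?thesis using \<epsilon> that by simp
  next
    case False
    then show ?thesis using that C g_nonneg[of z] by (simp add: add_increasing2)
  qed
  have hom: "N (t *\<^sub>R z) = t powr p * N z" "d (t *\<^sub>R z) = t powr p * d z"
    "g (t *\<^sub>R z) = t powr p * g z" if "t > 0" for t z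
  proof -
    have n: "norm (t *\<^sub>R a) powr p = t powr p * norm a powr p" for a :: 'a
      using that by (simp add: powr_mult)
    have h: "(1 / 2) *\<^sub>R (t *\<^sub>R a + t *\<^sub>R b) = t *\<^sub>R ((1 / 2) *\<^sub>R (a + b))" for a b :: 'a
      by (simp add: algebra_simps)
    show N: "N (t *\<^sub>R z) = t powr p * N z"
      by (simp only: N_def fst_scaleR snd_scaleR n distrib_left)
    show "d (t *\<^sub>R z) = t powr p * d z"
      by (simp only: d_def fst_scaleR snd_scaleR n scaleR_diff_right[symmetric])
    show "g (t *\<^sub>R z) = t powr p * g z"
      unfolding g_def N by (simp only: fst_scaleR snd_scaleR h n right_diff_distrib
          times_divide_eq_right)
  qed
  have "d z \<le> \<epsilon> * N z + C * g z" for z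
  proof (cases "N z = 0")
    case True
    then have "fst z = 0" "snd z = 0"
      by (auto simp: N_def) (smt (verit) powr_eq_0_iff powr_ge_zero norm_eq_zero)+
    then show ?thesis using True C by (simp add: d_def g_def)
  next
    case False
    then have Npos: "N z > 0" by (simp add: N_def order_less_le)
    define t where "t = N z powr (1 / p)"
    have t: "t > 0" "t powr p = N z" using Npos p by (simp_all add: t_def powr_powr)
    define z' where "z' = (1 / t) *\<^sub>R z"
    have z: "z = t *\<^sub>R z'" using t by (simp add: z'_def)
    have h: "N z = N z * N z'" "d z = N z * d z'" "g z = N z * g z'"
      using hom[OF t(1), of z'] by (simp_all only: z[symmetric] t(2))
    then have "N z' = 1" using Npos by simp
    from unit[OF this] have "N z * d z' \<le> N z * (\<epsilon> * N z' + C * g z')"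
      using Npos by (intro mult_left_mono) auto
    also have "\<dots> = \<epsilon> * (N z * N z') + C * (N z * g z')" by (simp add: algebra_simps)
    finally show ?thesis by (simp only: h[symmetric])
  qed
  then have "norm (a - b) powr p \<le> \<epsilon> * (norm a powr p + norm b powr p)
       + C * ((norm a powr p + norm b powr p) / 2 - norm ((1 / 2) *\<^sub>R (a + b)) powr p)" for a b :: 'a
    by (metis N_def d_def g_def fst_conv snd_conv)
  with C that show thesis by blast
qed

section \<open>Minimizers of the energy\<close>

context sobolev_domain
begin

text \<open>A class in the quotient space is the affine space of the competitors in the minimisation.\<close>

lemma bdry_class_iff:
  assumes "u \<in> W1p \<Omega> p"
  shows "v \<in> bdry_class \<Omega> p u \<longleftrightarrow> v \<in> W1p \<Omega> p \<and> (\<lambda>x. v x - u x) \<in> W0p \<Omega> p"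
  using assms by (simp add: bdry_class_def bdry_rel_def)

lemma bdry_class_refl: "u \<in> W1p \<Omega> p \<Longrightarrow> u \<in> bdry_class \<Omega> p u"
  using test_function_W0p[OF zero_test_function] by (simp add: bdry_class_iff)

lemma bdry_class_diff:
  assumes u: "u \<in> W1p \<Omega> p" and v: "v \<in> bdry_class \<Omega> p u" and w: "w \<in> bdry_class \<Omega> p u"
  shows "(\<lambda>x. v x - w x) \<in> W0p \<Omega> p"
proof -
  have "(\<lambda>x. (v x - u x) + -1 * (w x - u x)) \<in> W0p \<Omega> p"
    using v w u by (intro W0p_lincomb) (auto simp: bdry_class_iff)
  then show ?thesis by simp
qed

lemma bdry_class_add:
  assumes u: "u \<in> W1p \<Omega> p" and v: "v \<in> bdry_class \<Omega> p u" and w: "w \<in> W0p \<Omega> p"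
  shows "(\<lambda>x. v x + c * w x) \<in> bdry_class \<Omega> p u"
proof -
  have "(\<lambda>x. (v x - u x) + c * w x) \<in> W0p \<Omega> p"
    using v w u by (intro W0p_lincomb) (auto simp: bdry_class_iff)
  moreover have "(\<lambda>x. (v x - u x) + c * w x) = (\<lambda>x. v x + c * w x - u x)" by (simp add: fun_eq_iff)
  ultimately show ?thesis
    using v u W1p_lincomb(1)[OF _ W0p_W1p[OF w]] by (simp add: bdry_class_iff)
qed

lemma flux_Lp_integrable:
  assumes a: "a \<in> Lp \<Omega> p" and b: "b \<in> Lp \<Omega> p" and s: "s \<in> borel_measurable M" "AE x in M. \<bar>s x\<bar> \<le> C"
  shows "integrable M (\<lambda>x. s x * (flux p (a x) \<bullet> b x))"
proof (rule Bochner_Integration.integrable_bound)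
  show "integrable M (\<lambda>x. C * (norm (a x) powr p + norm (b x) powr p))"
    using LpD[OF a] LpD[OF b] by simp
  have "(\<lambda>x. flux p (a x)) \<in> borel_measurable M"
    using borel_measurable_continuous_onI[OF continuous_flux[OF p]] LpD(1)[OF a]
        by (rule measurable_compose_rev)
  then show "(\<lambda>x. s x * (flux p (a x) \<bullet> b x)) \<in> borel_measurable M"
    using s(1) LpD(1)[OF b] by (intro borel_measurable_times borel_measurable_inner)
  show "AE x in M. norm (s x * (flux p (a x) \<bullet> b x)) \<le> norm (C * (norm (a x) powr p
      + norm (b x) powr p))"
    using s(2)
  proof eventually_elim
    case (elim x)
    have "\<bar>flux p (a x) \<bullet> b x\<bar> \<le> norm (a x) powr p + norm (b x) powr p"
      using flux_inner_le[of p "a x" "b x"] powr_mult_small_large[of "norm (a x)" "norm (b x)"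
          1 p] p by simp
    then have "\<bar>s x\<bar> * \<bar>flux p (a x) \<bullet> b x\<bar> \<le> C * (norm (a x) powr p + norm (b x) powr p)"
      using elim by (intro mult_mono) auto
    then show ?case using elim by (simp add: abs_mult)
  qed
qed

end

text \<open>A membership in \<^const>\<open>Linfty_pos\<close> enters all estimates only through two constants
  enclosing the conductivity, which are therefore made parameters.\<close>

locale conductivity = sobolev_domain +
  fixes \<sigma> :: "'a \<Rightarrow> real" and c C :: real
  assumes \<sigma>_measurable: "\<sigma> \<in> borel_measurable M" and c_pos: "0 < c"
    and \<sigma>_bounds: "AE x in M. c \<le> \<sigma> x \<and> \<sigma> x \<le> C"
begin

lemma \<sigma>_abs: "AE x in M. \<bar>\<sigma> x\<bar> \<le> C"
  using \<sigma>_bounds by eventually_elim (use c_pos in auto)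

lemma weighted_integrable:
  assumes "g \<in> Lp \<Omega> p"
  shows "integrable M (\<lambda>x. \<sigma> x * norm (g x) powr p)"
  using flux_Lp_integrable[OF assms assms \<sigma>_measurable \<sigma>_abs] by (simp add: flux_inner_self)

definition wmean :: "('a \<Rightarrow> 'a) \<Rightarrow> real" where
  "wmean g = (\<integral>x. \<sigma> x * norm (g x) powr p \<partial>M)"

lemma energy_wmean: "energy \<Omega> p \<sigma> u = wmean (weak_grad \<Omega> u)"
  by (simp add: energy_def wmean_def)

lemma wmean_lower:
  assumes "g \<in> Lp \<Omega> p"
  shows "c * pmean M p g \<le> wmean g"
proof -
  have "c * pmean M p g = (\<integral>x. c * norm (g x) powr p \<partial>M)"
    unfolding pmean_def by simp
  also have "\<dots> \<le> wmean g"
    unfolding wmean_def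
  proof (rule integral_mono_AE)
    show "AE x in M. c * norm (g x) powr p \<le> \<sigma> x * norm (g x) powr p"
      using \<sigma>_bounds by eventually_elim (auto intro: mult_right_mono)
  qed (use weighted_integrable[OF assms] LpD(2)[OF assms] in auto)
  finally show ?thesis .
qed

lemma wmean_nonneg: "g \<in> Lp \<Omega> p \<Longrightarrow> 0 \<le> wmean g"
  using wmean_lower[of g] c_pos pmean_nonneg[of M p g] by (smt (verit) mult_nonneg_nonneg)

lemma wmean_cong_AE:
  assumes "f \<in> Lp \<Omega> p" "g \<in> Lp \<Omega> p" "AE x in M. f x = g x"
  shows "wmean f = wmean g"
  unfolding wmean_def
  by (rule integral_cong_AE)
    (use weighted_integrable[OF assms(1)] weighted_integrable[OF assms(2)] assms(3)
      in \<open>auto elim: eventually_mono\<close>)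

lemma wmean_uniform_convexity:
  assumes "\<epsilon> > 0"
  obtains K where "K \<ge> 0" "\<And>f g h. f \<in> Lp \<Omega> p \<Longrightarrow> g \<in> Lp \<Omega> p \<Longrightarrow> h \<in> Lp \<Omega> p \<Longrightarrow>
    (AE x in M. h x = (1 / 2) *\<^sub>R (f x + g x)) \<Longrightarrow>
    wmean (\<lambda>x. f x - g x) \<le> \<epsilon> * (wmean f + wmean g) + K * ((wmean f + wmean g) / 2 - wmean h)"
proof -
  obtain K where K: "K \<ge> 0" "\<And>a b :: 'a. norm (a - b) powr p
     \<le> \<epsilon> * (norm a powr p + norm b powr p)
       + K * ((norm a powr p + norm b powr p) / 2 - norm ((1 / 2) *\<^sub>R (a + b)) powr p)"
    using uniform_convexity_powr[OF p assms] by blast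
  have "wmean (\<lambda>x. f x - g x) \<le> \<epsilon> * (wmean f + wmean g) + K * ((wmean f + wmean g) / 2 - wmean h)"
    if f: "f \<in> Lp \<Omega> p" and g: "g \<in> Lp \<Omega> p" and h: "h \<in> Lp \<Omega> p"
      and mid: "AE x in M. h x = (1 / 2) *\<^sub>R (f x + g x)" for f g h
  proof -
    note int = weighted_integrable[OF f] weighted_integrable[OF g] weighted_integrable[OF h]
    let ?R = "\<lambda>x. \<epsilon> * (\<sigma> x * norm (f x) powr p + \<sigma> x * norm (g x) powr p)
        + K * ((\<sigma> x * norm (f x) powr p + \<sigma> x * norm (g x) powr p) / 2 - \<sigma> x * norm (h x) powr p)"
    have "wmean (\<lambda>x. f x - g x) \<le> (\<integral>x. ?R x \<partial>M)"
      unfolding wmean_def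
    proof (rule integral_mono_AE)
      show "integrable M (\<lambda>x. \<sigma> x * norm (f x - g x) powr p)"
        by (rule weighted_integrable[OF Lp_diff[OF f g]])
      show "integrable M ?R" using int by simp
      show "AE x in M. \<sigma> x * norm (f x - g x) powr p \<le> ?R x"
        using mid \<sigma>_bounds
      proof eventually_elim
        case (elim x)
        then have "\<sigma> x \<ge> 0" using c_pos by simp
        then have "\<sigma> x * norm (f x - g x) powr p \<le> \<sigma> x * (\<epsilon> * (norm (f x) powr p + norm (g x) powr p)
           + K * ((norm (f x) powr p + norm (g x) powr p) / 2 - norm (h x) powr p))"
          unfolding elim(1) by (intro mult_left_mono K(2))
        also have "\<dots> = ?R x" by (simp add: algebra_simps)
        finally show ?case .
      qed
    qed
    also have "\<dots> = \<epsilon> * (wmean f + wmean g) + K * ((wmean f + wmean g) / 2 - wmean h)"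
      unfolding wmean_def using int by simp
    finally show ?thesis .
  qed
  with K(1) that show thesis by blast
qed

end

context conductivity
begin

text \<open>The direct method. By uniform convexity the gradients of a minimizing sequence form a Cauchy
  sequence in the mean of order \<open>p\<close>, since midpoints of competitors are competitors; the
  inequality of Poincare carries this over to the functions themselves.\<close>

lemma minimizer_exists:
  assumes u0: "u0 \<in> W1p \<Omega> p"
  shows "\<exists>u\<in>bdry_class \<Omega> p u0. \<forall>v\<in>bdry_class \<Omega> p u0. energy \<Omega> p \<sigma> u \<le> energy \<Omega> p \<sigma> v"
proof -
  let ?A = "bdry_class \<Omega> p u0"
  have AW: "v \<in> W1p \<Omega> p" if "v \<in> ?A" for v using that u0 by (simp add: bdry_class_iff)
  note AL = W1pD[OF AW]
  have E0: "0 \<le> energy \<Omega> p \<sigma> v" if "v \<in> ?A" for v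
    unfolding energy_wmean by (rule wmean_nonneg[OF AL(2)[OF that]])
  define m where "m = Inf (energy \<Omega> p \<sigma> ` ?A)"
  have ne: "energy \<Omega> p \<sigma> ` ?A \<noteq> {}" using bdry_class_refl[OF u0] by auto
  have bdd: "bdd_below (energy \<Omega> p \<sigma> ` ?A)" using E0 by (auto intro: bdd_belowI[of _ 0])
  have m_le: "m \<le> energy \<Omega> p \<sigma> v" if "v \<in> ?A" for v
    unfolding m_def using that bdd by (auto intro: cInf_lower)
  have m0: "0 \<le> m" unfolding m_def using ne E0 by (auto intro: cInf_greatest)
  have "\<exists>v\<in>?A. energy \<Omega> p \<sigma> v < m + 1 / real (Suc k)" for k
    using cInf_lessD[OF ne, of "m + 1 / real (Suc k)"] by (auto simp: m_def)
  then obtain u where u: "\<And>k. u k \<in> ?A" "\<And>k. energy \<Omega> p \<sigma> (u k) < m + 1 / real (Suc k)"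
    by metis
  define G where "G k = weak_grad \<Omega> (u k)" for k
  have G: "G k \<in> Lp \<Omega> p" for k unfolding G_def by (rule AL(2)[OF u(1)])
  have wG: "wmean (G k) < m + 1 / real (Suc k)" "m \<le> wmean (G k)" for k
    using u(2)[of k] m_le[OF u(1)] by (simp_all add: G_def energy_wmean)
  have wG1: "wmean (G k) \<le> m + 1" for k
    using wG(1)[of k] by (smt (verit) divide_le_eq_1 of_nat_0_less_iff of_nat_Suc of_nat_0_le_iff
        zero_less_Suc)
  have cauchyG: "\<exists>N. \<forall>i\<ge>N. \<forall>j\<ge>N. pmean M p (\<lambda>x. G i x - G j x) < e" if "e > 0" for e
  proof -
    \<comment> \<open>All energies are at most \<^term>\<open>m + 1\<close>, so this weight makes the first term of the
      convexity estimate at most \<^term>\<open>c * e / 2\<close>; the convexity defect tends to zero.\<close>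
    define \<epsilon> where "\<epsilon> = c * e / (4 * (m + 1))"
    have \<epsilon>: "\<epsilon> > 0" using that c_pos m0 by (simp add: \<epsilon>_def)
    obtain K where K: "K \<ge> 0" "\<And>f g h. f \<in> Lp \<Omega> p \<Longrightarrow> g \<in> Lp \<Omega> p \<Longrightarrow> h \<in> Lp \<Omega> p \<Longrightarrow>
        (AE x in M. h x = (1 / 2) *\<^sub>R (f x + g x)) \<Longrightarrow>
        wmean (\<lambda>x. f x - g x) \<le> \<epsilon> * (wmean f + wmean g) + K * ((wmean f + wmean g) / 2 - wmean h)"
      using wmean_uniform_convexity[OF \<epsilon>] by blast
    have "c * e / (4 * (K + 1)) > 0" using that c_pos K(1) by simp
    then obtain N where N: "1 / real (Suc N) < c * e / (4 * (K + 1))"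
      using nat_approx_posE by blast
    have "pmean M p (\<lambda>x. G i x - G j x) < e" if ij: "i \<ge> N" "j \<ge> N" for i j
    proof -
      let ?w = "\<lambda>x. u i x + (1 / 2) * (u j x - u i x)"
      have w: "?w \<in> ?A"
        by (rule bdry_class_add[OF u0 u(1) bdry_class_diff[OF u0 u(1) u(1)]])
      have "AE x in M. weak_grad \<Omega> ?w x = (1 / 2) *\<^sub>R (G i x + G j x)"
        using W1p_lincomb(2)[OF AW[OF u(1)] W1p_diff(1)[OF AW[OF u(1)] AW[OF u(1)]], of i "1 / 2" j i]
          W1p_diff(2)[OF AW[OF u(1)] AW[OF u(1)], of j i]
      proof eventually_elim
        case (elim x)
        have "G i x + (1 / 2) *\<^sub>R (G j x - G i x) = (1 / 2) *\<^sub>R (G i x + G j x)"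
          by (simp add: scaleR_right_distrib scaleR_right_diff_distrib) (metis scaleR_half_double
              scaleR_right_distrib add_diff_cancel_right')
        with elim show ?case by (simp add: G_def)
      qed
      from K(2)[OF G[of i] G[of j] AL(2)[OF w] this]
      have "wmean (\<lambda>x. G i x - G j x)
          \<le> \<epsilon> * (wmean (G i) + wmean (G j)) + K * ((wmean (G i)
              + wmean (G j)) / 2 - wmean (weak_grad \<Omega> ?w))" .
      also have "\<dots> \<le> \<epsilon> * (2 * (m + 1)) + K * (1 / real (Suc N))"
      proof (intro add_mono mult_left_mono)
        show "wmean (G i) + wmean (G j) \<le> 2 * (m + 1)" using wG1[of i] wG1[of j] by simp
        have "m \<le> wmean (weak_grad \<Omega> ?w)" using m_le[OF w] by (simp add: energy_wmean)
        moreover have "1 / real (Suc i) \<le> 1 / real (Suc N)" "1 / real (Suc j) \<le> 1 / real (Suc N)"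
          using ij by (simp_all add: frac_le)
        ultimately show "(wmean (G i) + wmean (G j)) / 2 - wmean (weak_grad \<Omega> ?w) \<le> 1 / real (Suc N)"
          using wG(1)[of i] wG(1)[of j] by argo
      qed (use \<epsilon> K in auto)
      also have "\<epsilon> * (2 * (m + 1)) = c * e / 2"
        using m0 by (simp add: \<epsilon>_def field_simps)
      also have "K * (1 / real (Suc N)) \<le> (K + 1) * (c * e / (4 * (K + 1)))"
        using K(1) N by (intro mult_mono) auto
      also have "(K + 1) * (c * e / (4 * (K + 1))) = c * e / 4"
      proof -
        have "y * (x / (4 * y)) = x / 4" if "y > 0" for x y :: real
          using that by (simp add: field_simps)
        moreover have "0 < K + 1" using K(1) by simp
        ultimately show ?thesis by blast
      qed
      also have "c * e / 2 + c * e / 4 < c * e"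
        using c_pos \<open>e > 0\<close> by simp
      finally have "c * pmean M p (\<lambda>x. G i x - G j x) < c * e"
        using wmean_lower[OF Lp_diff[OF G[of i] G[of j]]] by simp
      then show ?thesis using c_pos by simp
    qed
    then show ?thesis by blast
  qed
  obtain CP where CP: "CP \<ge> 0" "\<And>w. w \<in> W0p \<Omega> p \<Longrightarrow> pmean M p w \<le> CP * pmean M p (weak_grad \<Omega> w)"
    using poincare by blast
  have uij: "pmean M p (\<lambda>x. u i x - u j x) \<le> CP * pmean M p (\<lambda>x. G i x - G j x)" for i j
  proof -
    have d: "(\<lambda>x. u i x - u j x) \<in> W0p \<Omega> p" by (rule bdry_class_diff[OF u0 u(1) u(1)])
    have "pmean M p (weak_grad \<Omega> (\<lambda>x. u i x - u j x)) = pmean M p (\<lambda>x. G i x - G j x)"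
      using W1pD(2)[OF W0p_W1p[OF d]] Lp_diff[OF G G] W1p_diff(2)[OF AW[OF u(1)] AW[OF u(1)], of i j]
      by (intro pmean_cong_AE) (auto simp: G_def)
    with CP(2)[OF d] show ?thesis by simp
  qed
  have cauchyu: "\<exists>N. \<forall>i\<ge>N. \<forall>j\<ge>N. pmean M p (\<lambda>x. u i x - u j x) < e" if "e > 0" for e
  proof -
    have "e / (CP + 1) > 0" using that CP(1) by simp
    from cauchyG[OF this] obtain N where
      N: "\<And>i j. i \<ge> N \<Longrightarrow> j \<ge> N \<Longrightarrow> pmean M p (\<lambda>x. G i x - G j x) < e / (CP + 1)" by blast
    have "pmean M p (\<lambda>x. u i x - u j x) < e" if "i \<ge> N" "j \<ge> N" for i j
    proof -
      have "CP * pmean M p (\<lambda>x. G i x - G j x) \<le> CP * (e / (CP + 1))"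
        using N[OF that] CP(1) by (intro mult_left_mono) auto
      also have "\<dots> < (CP + 1) * (e / (CP + 1))"
        using \<open>e / (CP + 1) > 0\<close> by (intro mult_strict_right_mono) auto
      also have "\<dots> = e" using CP(1) by simp
      finally show ?thesis using uij[of i j] by simp
    qed
    then show ?thesis by blast
  qed
  note uL = AL(1)[OF u(1)]
  obtain U r' where U: "U \<in> borel_measurable M" "integrable M (\<lambda>x. norm (U x) powr p)"
    "(\<lambda>k. \<integral>x. norm (u k x - U x) powr p \<partial>M) \<longlonglongrightarrow> 0"
    "strict_mono (r' :: nat \<Rightarrow> nat)" "AE x in M. (\<lambda>k. u (r' k) x) \<longlonglongrightarrow> U x"
    by (rule Lp_complete[OF p LpD(1)[OF uL] LpD(2)[OF uL] cauchyu[unfolded pmean_def]])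
  obtain H r where H: "H \<in> borel_measurable M" "integrable M (\<lambda>x. norm (H x) powr p)"
    "(\<lambda>k. \<integral>x. norm (G k x - H x) powr p \<partial>M) \<longlonglongrightarrow> 0"
    and r: "strict_mono (r :: nat \<Rightarrow> nat)" "AE x in M. (\<lambda>k. G (r k) x) \<longlonglongrightarrow> H x"
    by (rule Lp_complete[OF p LpD(1)[OF G] LpD(2)[OF G] cauchyG[unfolded pmean_def]])
  have UL: "U \<in> Lp \<Omega> p" and HL: "H \<in> Lp \<Omega> p" using U H by (auto simp: Lp_def)
  have limu: "(\<lambda>k. pmean M p (\<lambda>x. u k x - U x)) \<longlonglongrightarrow> 0" and limG: "(\<lambda>k. pmean M p (\<lambda>x. G k x - H x)) \<longlonglongrightarrow> 0"
    using U(3) H(3) by (simp_all add: pmean_def)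
  have UH: "has_weak_grad \<Omega> U H"
    by (rule has_weak_grad_limit[OF uL G _ UL HL limu limG]) (simp add: G_def AL(3)[OF u(1)])
  have UW: "U \<in> W1p \<Omega> p" by (rule W1pI[OF UL HL UH])
  have gU: "AE x in M. weak_grad \<Omega> U x = H x" by (rule weak_grad_AE[OF open_dom UH])
  have UA: "U \<in> ?A"
  proof -
    have "(\<lambda>x. U x - u0 x) \<in> W0p \<Omega> p"
    proof (rule W0p_closed[where v="\<lambda>k x. u k x - u0 x"])
      show "(\<lambda>x. U x - u0 x) \<in> W1p \<Omega> p" by (rule W1p_diff(1)[OF UW u0])
      show "(\<lambda>x. u k x - u0 x) \<in> W0p \<Omega> p" for k
        using u(1) u0 by (simp add: bdry_class_iff)
      have "modular (\<lambda>x. U x - u0 x - (u k x - u0 x)) = pmean M p (\<lambda>x. u k x - U x)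
          + pmean M p (\<lambda>x. G k x - H x)" for k
      proof -
        have "pmean M p (weak_grad \<Omega> (\<lambda>x. U x - u k x)) = pmean M p (\<lambda>x. H x - G k x)"
          by (rule pmean_cong_AE[OF W1pD(2)[OF W1p_diff(1)[OF UW AW[OF u(1)]]] Lp_diff[OF HL G]])
            (use W1p_diff(2)[OF UW AW[OF u(1)], of k] gU in eventually_elim, simp add: G_def)
        then show ?thesis
          by (simp add: modular_def pmean_def norm_minus_commute abs_minus_commute)
      qed
      then show "(\<lambda>k. modular (\<lambda>x. U x - u0 x - (u k x - u0 x))) \<longlonglongrightarrow> 0"
        using tendsto_add[OF limu limG] by simp
    qed
    then show ?thesis using UW u0 by (simp add: bdry_class_iff)
  qed
  have "wmean H \<le> m"
  proof (rule field_le_epsilon)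
    fix e :: real assume "e > 0"
    then obtain N where N: "1 / real (Suc N) < e" using nat_approx_posE by blast
    have L: "AE x in M. (\<lambda>k. \<sigma> x * norm (G (r (k + N)) x) powr p) \<longlonglongrightarrow> \<sigma> x * norm (H x) powr p"
      using r(2)
    proof eventually_elim
      case (elim x)
      then have "(\<lambda>k. G (r (k + N)) x) \<longlonglongrightarrow> H x" by (rule LIMSEQ_ignore_initial_segment)
      then show ?case using p by (intro tendsto_mult tendsto_const tendsto_powr2 tendsto_norm) auto
    qed
    have le: "(\<integral>x. \<sigma> x * norm (G (r (k + N)) x) powr p \<partial>M) \<le> m + e" for k
    proof -
      have "r (k + N) \<ge> N" using seq_suble[OF r(1), of "k + N"] by simp
      then have "1 / real (Suc (r (k + N))) \<le> 1 / real (Suc N)" by (simp add: frac_le)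
      then show ?thesis using wG(1)[of "r (k + N)"] N by (simp add: wmean_def)
    qed
    have nn: "AE x in M. \<forall>k. 0 \<le> \<sigma> x * norm (G (r (k + N)) x) powr p"
      using \<sigma>_bounds by eventually_elim (use c_pos in auto)
    show "wmean H \<le> m + e"
      unfolding wmean_def
      by (rule Fatou_bound(2)[OF weighted_integrable[OF G] nn le borel_measurable_integrable[OF
          weighted_integrable[OF HL]] L])
  qed
  then have "energy \<Omega> p \<sigma> U \<le> m"
    using wmean_cong_AE[OF AL(2)[OF UA] HL gU] by (simp add: energy_wmean)
  then have "\<forall>v\<in>?A. energy \<Omega> p \<sigma> U \<le> energy \<Omega> p \<sigma> v"
    using m_le by (auto intro: order_trans)
  with UA show ?thesis by blast
qed

text \<open>Convexity bounds the difference quotient of the energy by the flux at the perturbed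
  gradient, so the first variation needs no differentiation under the integral.\<close>

lemma euler_lagrange_nonneg:
  assumes u0: "u0 \<in> W1p \<Omega> p" and u: "u \<in> bdry_class \<Omega> p u0"
    and min: "\<And>v. v \<in> bdry_class \<Omega> p u0 \<Longrightarrow> energy \<Omega> p \<sigma> u \<le> energy \<Omega> p \<sigma> v"
    and \<psi>: "\<psi> \<in> W0p \<Omega> p"
  shows "0 \<le> (\<integral>x. \<sigma> x * (flux p (weak_grad \<Omega> u x) \<bullet> weak_grad \<Omega> \<psi> x) \<partial>M)"
proof -
  let ?G = "weak_grad \<Omega> u" and ?P = "weak_grad \<Omega> \<psi>"
  have uW: "u \<in> W1p \<Omega> p" using u u0 by (simp add: bdry_class_iff)
  note \<psi>W = W0p_W1p[OF \<psi>]
  note L = W1pD[OF uW] W1pD[OF \<psi>W]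
  define s where "s k = 1 / real (Suc k)" for k
  have s: "0 < s k" "s k \<le> 1" for k by (auto simp: s_def)
  have slim: "s \<longlonglongrightarrow> 0" unfolding s_def by (rule LIMSEQ_Suc[OF lim_1_over_n])
  define a where "a k x = ?G x + s k *\<^sub>R ?P x" for k x
  have a: "a k \<in> Lp \<Omega> p" for k unfolding a_def[abs_def] by (rule Lp_lincomb[OF L(2) L(5)])
  have pos: "0 \<le> (\<integral>x. \<sigma> x * (flux p (a k x) \<bullet> ?P x) \<partial>M)" for k
  proof -
    let ?v = "\<lambda>x. u x + s k * \<psi> x"
    have v: "?v \<in> bdry_class \<Omega> p u0" by (rule bdry_class_add[OF u0 u \<psi>])
    have "weak_grad \<Omega> ?v \<in> Lp \<Omega> p" using W1pD(2)[OF W1p_lincomb(1)[OF uW \<psi>W]] .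
    then have "wmean (weak_grad \<Omega> ?v) = wmean (a k)"
      by (rule wmean_cong_AE[OF _ a]) (use W1p_lincomb(2)[OF uW \<psi>W, of "s k"] in \<open>simp add: a_def\<close>)
    then have "0 \<le> wmean (a k) - wmean ?G"
      using min[OF v] by (simp add: energy_wmean)
    also have "\<dots> = (\<integral>x. \<sigma> x * norm (a k x) powr p - \<sigma> x * norm (?G x) powr p \<partial>M)"
      unfolding wmean_def using weighted_integrable[OF a] weighted_integrable[OF L(2)] by simp
    also have "\<dots> \<le> (\<integral>x. (p * s k) * (\<sigma> x * (flux p (a k x) \<bullet> ?P x)) \<partial>M)"
    proof (rule integral_mono_AE)
      show "AE x in M. \<sigma> x * norm (a k x) powr p - \<sigma> x * norm (?G x) powr p
          \<le> (p * s k) * (\<sigma> x * (flux p (a k x) \<bullet> ?P x))"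
        using \<sigma>_bounds
      proof eventually_elim
        case (elim x)
        have "p * (flux p (a k x) \<bullet> ?G x) \<le> norm (?G x) powr p + (p - 1) * norm (a k x) powr p"
          by (rule flux_convexity[OF p])
        moreover have "flux p (a k x) \<bullet> ?G x = norm (a k x) powr p - s k * (flux p (a k x) \<bullet> ?P x)"
          using flux_inner_self[of p "a k x"] by (simp add: a_def inner_add_right)
        ultimately have "norm (a k x) powr p - norm (?G x) powr p \<le> p * (s k * (flux p (a k x) \<bullet> ?P x))"
          by (simp add: algebra_simps)
        then have "\<sigma> x * (norm (a k x) powr p - norm (?G x) powr p)
            \<le> \<sigma> x * (p * (s k * (flux p (a k x) \<bullet> ?P x)))"
          using elim c_pos by (intro mult_left_mono) auto
        then show ?case by (simp add: algebra_simps)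
      qed
    qed (use weighted_integrable[OF a] weighted_integrable[OF L(2)]
          flux_Lp_integrable[OF a L(5) \<sigma>_measurable \<sigma>_abs] in auto)
    also have "\<dots> = (p * s k) * (\<integral>x. \<sigma> x * (flux p (a k x) \<bullet> ?P x) \<partial>M)"
      by simp
    finally have "0 \<le> (p * s k) * (\<integral>x. \<sigma> x * (flux p (a k x) \<bullet> ?P x) \<partial>M)" .
    moreover have "0 < p * s k" using p s(1)[of k] by simp
    ultimately show ?thesis by (metis mult_pos_neg not_le)
  qed
  have "(\<lambda>k. \<integral>x. \<sigma> x * (flux p (a k x) \<bullet> ?P x) \<partial>M) \<longlonglongrightarrow> (\<integral>x. \<sigma> x * (flux p (?G x) \<bullet> ?P x) \<partial>M)"
  proof (rule integral_dominated_convergence[where w="\<lambda>x. C * (2 powr p * (norm (?G x) powr p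
      + norm (?P x) powr p) + norm (?P x) powr p)"])
    show "(\<lambda>x. \<sigma> x * (flux p (?G x) \<bullet> ?P x)) \<in> borel_measurable M"
      "(\<lambda>x. \<sigma> x * (flux p (a k x) \<bullet> ?P x)) \<in> borel_measurable M" for k
      using flux_Lp_integrable[OF L(2) L(5) \<sigma>_measurable \<sigma>_abs] flux_Lp_integrable[OF a L(5)
          \<sigma>_measurable \<sigma>_abs]
      by (auto intro: borel_measurable_integrable)
    show "integrable M (\<lambda>x. C * (2 powr p * (norm (?G x) powr p + norm (?P x) powr p)
        + norm (?P x) powr p))"
      using LpD(2)[OF L(2)] LpD(2)[OF L(5)] by simp
    show "AE x in M. (\<lambda>k. \<sigma> x * (flux p (a k x) \<bullet> ?P x)) \<longlonglongrightarrow> \<sigma> x * (flux p (?G x) \<bullet> ?P x)"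
    proof (rule AE_I2)
      fix x
      have "(\<lambda>k. a k x) \<longlonglongrightarrow> ?G x + 0 *\<^sub>R ?P x"
        unfolding a_def by (intro tendsto_intros slim)
      then have "(\<lambda>k. flux p (a k x)) \<longlonglongrightarrow> flux p (?G x)"
        using continuous_on_tendsto_compose[OF continuous_flux[OF p], of "\<lambda>k. a k x" "?G x"
            sequentially] by simp
      then show "(\<lambda>k. \<sigma> x * (flux p (a k x) \<bullet> ?P x)) \<longlonglongrightarrow> \<sigma> x * (flux p (?G x) \<bullet> ?P x)"
        by (intro tendsto_intros)
    qed
    show "AE x in M. norm (\<sigma> x * (flux p (a k x) \<bullet> ?P x))
        \<le> C * (2 powr p * (norm (?G x) powr p + norm (?P x) powr p) + norm (?P x) powr p)" for k
      using \<sigma>_abs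
    proof eventually_elim
      case (elim x)
      have "\<bar>flux p (a k x) \<bullet> ?P x\<bar> \<le> norm (a k x) powr p + norm (?P x) powr p"
        using flux_inner_le[of p "a k x" "?P x"] powr_mult_small_large[of "norm (a k x)"
            "norm (?P x)" 1 p] p by simp
      also have "norm (a k x) powr p \<le> 2 powr p * (norm (?G x) powr p + norm (s k *\<^sub>R ?P x) powr p)"
        unfolding a_def using p by (intro norm_add_powr_le) simp
      also have "norm (s k *\<^sub>R ?P x) powr p \<le> norm (?P x) powr p"
        using s[of k] p by (intro powr_mono2) (auto simp: mult_left_le_one_le)
      finally have "\<bar>flux p (a k x) \<bullet> ?P x\<bar> \<le> 2 powr p * (norm (?G x) powr p + norm (?P x) powr p)
          + norm (?P x) powr p"
        by simp
      then show ?case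
        unfolding real_norm_def abs_mult using elim by (intro mult_mono) auto
    qed
  qed
  then show ?thesis
    by (rule LIMSEQ_le_const) (use pos in blast)
qed

lemma euler_lagrange:
  assumes u0: "u0 \<in> W1p \<Omega> p" and u: "u \<in> bdry_class \<Omega> p u0"
    and min: "\<And>v. v \<in> bdry_class \<Omega> p u0 \<Longrightarrow> energy \<Omega> p \<sigma> u \<le> energy \<Omega> p \<sigma> v"
    and \<psi>: "\<psi> \<in> W0p \<Omega> p"
  shows "(\<integral>x. \<sigma> x * (flux p (weak_grad \<Omega> u x) \<bullet> weak_grad \<Omega> \<psi> x) \<partial>M) = 0"
proof -
  note uW = u[unfolded bdry_class_iff[OF u0], THEN conjunct1]
  note L = W1pD[OF uW] W1pD[OF W0p_W1p[OF \<psi>]]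
  have \<psi>': "(\<lambda>x. \<psi> x + -2 * \<psi> x) \<in> W0p \<Omega> p" by (rule W0p_lincomb[OF \<psi> \<psi>])
  have "AE x in M. weak_grad \<Omega> (\<lambda>x. \<psi> x + -2 * \<psi> x) x = - weak_grad \<Omega> \<psi> x"
    using W1p_lincomb(2)[OF W0p_W1p[OF \<psi>] W0p_W1p[OF \<psi>], of "-2"]
  proof eventually_elim
    case (elim x)
    have "a + -2 *\<^sub>R a = - a" for a :: 'a by (simp add: scaleR_2)
    with elim show ?case by metis
  qed
  then have "(\<integral>x. \<sigma> x * (flux p (weak_grad \<Omega> u x) \<bullet> weak_grad \<Omega> (\<lambda>x. \<psi> x + -2 * \<psi> x) x) \<partial>M)
      = (\<integral>x. - (\<sigma> x * (flux p (weak_grad \<Omega> u x) \<bullet> weak_grad \<Omega> \<psi> x)) \<partial>M)"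
    using flux_Lp_integrable[OF L(2) L(5) \<sigma>_measurable \<sigma>_abs]
      flux_Lp_integrable[OF L(2) W1pD(2)[OF W0p_W1p[OF \<psi>']] \<sigma>_measurable \<sigma>_abs]
    by (intro integral_cong_AE) (auto elim: eventually_mono)
  also have "\<dots> = - (\<integral>x. \<sigma> x * (flux p (weak_grad \<Omega> u x) \<bullet> weak_grad \<Omega> \<psi> x) \<partial>M)"
    by simp
  finally show ?thesis
    using euler_lagrange_nonneg[OF u0 u min \<psi>] euler_lagrange_nonneg[OF u0 u min \<psi>'] by simp
qed

text \<open>The integrand is the flux of the minimizer paired with the gradient of some representative of
  the class. By the Euler-Lagrange equation this representative may be replaced by the minimizer
  itself, and the pairing becomes the minimal energy.\<close>

lemma DN_map_minimal_energy:
  assumes u0: "u0 \<in> W1p \<Omega> p"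
  obtains u where "u \<in> bdry_class \<Omega> p u0" "\<And>v. v \<in> bdry_class \<Omega> p u0 \<Longrightarrow> energy \<Omega> p \<sigma> u \<le> energy \<Omega> p \<sigma> v"
    "DN_map \<Omega> p \<sigma> (bdry_class \<Omega> p u0) (bdry_class \<Omega> p u0) = energy \<Omega> p \<sigma> u"
proof -
  let ?f = "bdry_class \<Omega> p u0"
  define u where "u = minimizer \<Omega> p \<sigma> ?f"
  define v where "v = (SOME v. v \<in> ?f)"
  have "u \<in> ?f \<and> (\<forall>v\<in>?f. energy \<Omega> p \<sigma> u \<le> energy \<Omega> p \<sigma> v)"
    unfolding u_def minimizer_def by (rule someI_ex[OF minimizer_exists[OF u0, unfolded Bex_def]])
  then have u: "u \<in> ?f" "\<And>v. v \<in> ?f \<Longrightarrow> energy \<Omega> p \<sigma> u \<le> energy \<Omega> p \<sigma> v" by auto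
  have v: "v \<in> ?f" unfolding v_def by (rule someI[where P="\<lambda>v. v \<in> ?f", OF bdry_class_refl[OF u0]])
  have W: "u \<in> W1p \<Omega> p" "v \<in> W1p \<Omega> p" using u(1) v u0 by (auto simp: bdry_class_iff)
  note d = bdry_class_diff[OF u0 v u(1)]
  note L = W1pD(2)[OF W(1)] W1pD(2)[OF W(2)] W1pD(2)[OF W1p_diff(1)[OF W(2) W(1)]]
  have "?f \<in> bdry_space \<Omega> p"
    using u0 by (auto simp: bdry_space_def bdry_class_def quotient_def)
  then have "DN_map \<Omega> p \<sigma> ?f ?f = (\<integral>x. \<sigma> x * norm (weak_grad \<Omega> u x) powr (p - 2)
      * (weak_grad \<Omega> u x \<bullet> weak_grad \<Omega> v x) \<partial>M)"
    by (simp add: DN_map_def u_def v_def Let_def)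
  also have "\<dots> = (\<integral>x. \<sigma> x * (flux p (weak_grad \<Omega> u x) \<bullet> weak_grad \<Omega> v x) \<partial>M)"
    by (simp add: flux_def mult.assoc)
  also have "\<dots> = (\<integral>x. \<sigma> x * norm (weak_grad \<Omega> u x) powr p
      + \<sigma> x * (flux p (weak_grad \<Omega> u x) \<bullet> weak_grad \<Omega> (\<lambda>x. v x - u x) x) \<partial>M)"
  proof (rule integral_cong_AE)
    show "AE x in M. \<sigma> x * (flux p (weak_grad \<Omega> u x) \<bullet> weak_grad \<Omega> v x)
        = \<sigma> x * norm (weak_grad \<Omega> u x) powr p
      + \<sigma> x * (flux p (weak_grad \<Omega> u x) \<bullet> weak_grad \<Omega> (\<lambda>x. v x - u x) x)"
      using W1p_diff(2)[OF W(2) W(1)]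
    proof eventually_elim
      case (elim x)
      show ?case
        unfolding elim inner_diff_right flux_inner_self right_diff_distrib by simp
    qed
  qed (use flux_Lp_integrable[OF L(1) L(2) \<sigma>_measurable \<sigma>_abs] weighted_integrable[OF L(1)]
      flux_Lp_integrable[OF L(1) L(3) \<sigma>_measurable \<sigma>_abs] in auto)
  also have "\<dots> = energy \<Omega> p \<sigma> u"
    using euler_lagrange[OF u0 u d] weighted_integrable[OF L(1)]
      flux_Lp_integrable[OF L(1) L(3) \<sigma>_measurable \<sigma>_abs]
    by (simp add: energy_def)
  finally show thesis using that u by blast
qed

end

section \<open>Comparison of Dirichlet-Neumann maps\<close>

context sobolev_domain
begin

text \<open>The pairing with a fixed flux is continuous in the gradient of \<^term>\<open>\<psi>\<close>, hence it is
  enough to know it on test functions.\<close>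

lemma flux_orthogonal_W0p:
  assumes a: "a \<in> Lp \<Omega> p"
    and test: "\<And>\<phi>. \<phi> \<in> test_functions \<Omega> \<Longrightarrow> (\<integral>x. flux p (a x) \<bullet> weak_grad \<Omega> \<phi> x \<partial>M) = 0"
    and \<psi>: "\<psi> \<in> W0p \<Omega> p"
  shows "(\<integral>x. flux p (a x) \<bullet> weak_grad \<Omega> \<psi> x \<partial>M) = 0"
proof -
  have int: "integrable M (\<lambda>x. flux p (a x) \<bullet> b x)" if "b \<in> Lp \<Omega> p" for b
    using flux_Lp_integrable[OF a that, of "\<lambda>_. 1" 1] by simp
  have "\<bar>\<integral>x. flux p (a x) \<bullet> weak_grad \<Omega> \<psi> x \<partial>M\<bar> \<le> 0 + \<delta>" if \<delta>: "\<delta> > 0" for \<delta>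
  proof -
    define A where "A = pmean M p a + 1"
    have A: "A > 0" "pmean M p a \<le> A" using pmean_nonneg[of M p a] by (auto simp: A_def)
    define e where "e = \<delta> / (2 * A)"
    have e: "e > 0" "e * A = \<delta> / 2" using \<delta> A by (auto simp: e_def)
    have "\<delta> / 2 / e powr (1 - p) > 0" using \<delta> e by simp
    then obtain \<phi> where \<phi>: "\<phi> \<in> test_functions \<Omega>" "modular (\<lambda>x. \<psi> x - \<phi> x) < \<delta> / 2 / e powr (1 - p)"
      using \<psi> unfolding W0p_iff by meson
    note W = W0p_W1p[OF \<psi>] test_function_W1p[OF \<phi>(1)]
    let ?b = "weak_grad \<Omega> (\<lambda>x. \<psi> x - \<phi> x)"
    note L = W1pD(2)[OF W(1)] W1pD(2)[OF W(2)] W1pD(2)[OF W1p_diff(1)[OF W]]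
    have "(\<integral>x. flux p (a x) \<bullet> ?b x \<partial>M) = (\<integral>x. flux p (a x) \<bullet> weak_grad \<Omega> \<psi> x
        - flux p (a x) \<bullet> weak_grad \<Omega> \<phi> x \<partial>M)"
    proof (rule integral_cong_AE)
      show "AE x in M. flux p (a x) \<bullet> ?b x = flux p (a x) \<bullet> weak_grad \<Omega> \<psi> x
          - flux p (a x) \<bullet> weak_grad \<Omega> \<phi> x"
        using W1p_diff(2)[OF W] by eventually_elim (simp add: inner_diff_right)
    qed (use int[OF L(1)] int[OF L(2)] int[OF L(3)] in auto)
    also have "\<dots> = (\<integral>x. flux p (a x) \<bullet> weak_grad \<Omega> \<psi> x \<partial>M)"
      using int[OF L(1)] int[OF L(2)] test[OF \<phi>(1)] by simp
    finally have "\<bar>\<integral>x. flux p (a x) \<bullet> weak_grad \<Omega> \<psi> x \<partial>M\<bar> = \<bar>\<integral>x. flux p (a x) \<bullet> ?b x \<partial>M\<bar>" by simp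
    also have "\<dots> \<le> (\<integral>x. e * norm (a x) powr p + e powr (1 - p) * norm (?b x) powr p \<partial>M)"
    proof (rule integral_abs_bound_integral[OF int[OF L(3)]])
      show "integrable M (\<lambda>x. e * norm (a x) powr p + e powr (1 - p) * norm (?b x) powr p)"
        using LpD(2)[OF a] LpD(2)[OF L(3)] by simp
      show "\<bar>flux p (a x) \<bullet> ?b x\<bar> \<le> e * norm (a x) powr p + e powr (1 - p) * norm (?b x) powr p" for x
        using flux_inner_le[of p "a x" "?b x"] powr_mult_small_large[of "norm (a x)" "norm (?b x)"
            e p] e p by simp
    qed
    also have "\<dots> = e * pmean M p a + e powr (1 - p) * pmean M p ?b"
      unfolding pmean_def using LpD(2)[OF a] LpD(2)[OF L(3)] by simp
    also have "\<dots> \<le> e * A + e powr (1 - p) * (\<delta> / 2 / e powr (1 - p))"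
      using A e \<phi>(2) pmean_le_modular(2)[of "\<lambda>x. \<psi> x - \<phi> x"] by (intro add_mono mult_left_mono) auto
    also have "\<dots> = \<delta>" using e by simp
    finally show ?thesis by simp
  qed
  then have "\<bar>\<integral>x. flux p (a x) \<bullet> weak_grad \<Omega> \<psi> x \<partial>M\<bar> \<le> 0"
    by (rule field_le_epsilon)
  then show ?thesis by simp
qed

end

context conductivity
begin

lemma weight_power_bound:
  assumes "q \<ge> 0"
  shows "(\<lambda>x. \<sigma> x powr - q) \<in> borel_measurable M" "AE x in M. \<bar>\<sigma> x powr - q\<bar> \<le> c powr - q"
proof -
  show "(\<lambda>x. \<sigma> x powr - q) \<in> borel_measurable M" using \<sigma>_measurable by measurable
  show "AE x in M. \<bar>\<sigma> x powr - q\<bar> \<le> c powr - q"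
    using \<sigma>_bounds by eventually_elim (use assms c_pos in \<open>auto intro: powr_mono2'\<close>)
qed

text \<open>Young's inequality with weight \<^term>\<open>\<sigma> x\<close> bounds the energy density of a competitor from
  below by the pairing with the flux of \<^term>\<open>u0\<close>. The integral of this pairing depends only on
  the class of the competitor, because \<^term>\<open>u0\<close> is \<^term>\<open>p\<close>-harmonic.\<close>

lemma energy_lower_bound:
  assumes u0: "u0 \<in> W1p \<Omega> p"
    and harmonic: "\<And>\<psi>. \<psi> \<in> W0p \<Omega> p \<Longrightarrow> (\<integral>x. flux p (weak_grad \<Omega> u0 x) \<bullet> weak_grad \<Omega> \<psi> x \<partial>M) = 0"
    and v: "v \<in> bdry_class \<Omega> p u0"
  shows "p * pmean M p (weak_grad \<Omega> u0)
      - (p - 1) * (\<integral>x. \<sigma> x powr (- 1 / (p - 1)) * norm (weak_grad \<Omega> u0 x) powr p \<partial>M) \<le> energy \<Omega> p \<sigma> v"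
proof -
  let ?a = "weak_grad \<Omega> u0" and ?b = "weak_grad \<Omega> v" and ?d = "weak_grad \<Omega> (\<lambda>x. v x - u0 x)"
  have vW: "v \<in> W1p \<Omega> p" using v u0 by (simp add: bdry_class_iff)
  note L = W1pD(2)[OF u0] W1pD(2)[OF vW] W1pD(2)[OF W1p_diff(1)[OF vW u0]]
  have int: "integrable M (\<lambda>x. flux p (?a x) \<bullet> b x)" if "b \<in> Lp \<Omega> p" for b
    using flux_Lp_integrable[OF L(1) that, of "\<lambda>_. 1" 1] by simp
  have w: "integrable M (\<lambda>x. \<sigma> x powr (- 1 / (p - 1)) * norm (?a x) powr p)"
    using flux_Lp_integrable[OF L(1) L(1) weight_power_bound[of "1 / (p - 1)"]] p
    by (simp add: flux_inner_self)
  have "(\<integral>x. flux p (?a x) \<bullet> ?b x \<partial>M) = (\<integral>x. norm (?a x) powr p + flux p (?a x) \<bullet> ?d x \<partial>M)"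
  proof (rule integral_cong_AE)
    show "AE x in M. flux p (?a x) \<bullet> ?b x = norm (?a x) powr p + flux p (?a x) \<bullet> ?d x"
      using W1p_diff(2)[OF vW u0]
    proof eventually_elim
      case (elim x)
      show ?case unfolding elim inner_diff_right flux_inner_self by simp
    qed
  qed (use int[OF L(2)] int[OF L(3)] LpD(2)[OF L(1)] in auto)
  also have "\<dots> = pmean M p ?a"
    using int[OF L(3)] LpD(2)[OF L(1)] harmonic[of "\<lambda>x. v x - u0 x"] v u0
    by (simp add: pmean_def bdry_class_iff)
  finally have "p * pmean M p ?a = (\<integral>x. p * (flux p (?a x) \<bullet> ?b x) \<partial>M)" by simp
  also have "\<dots> \<le> (\<integral>x. \<sigma> x * norm (?b x) powr p + (p - 1) * (\<sigma> x powr (- 1 / (p - 1))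
      * norm (?a x) powr p) \<partial>M)"
  proof (rule integral_mono_AE)
    show "AE x in M. p * (flux p (?a x) \<bullet> ?b x)
        \<le> \<sigma> x * norm (?b x) powr p + (p - 1) * (\<sigma> x powr (- 1 / (p - 1)) * norm (?a x) powr p)"
      using \<sigma>_bounds
    proof eventually_elim
      case (elim x)
      then show ?case using flux_young[OF p, of "\<sigma> x" "?a x" "?b x"] c_pos by (simp add: mult.assoc)
    qed
  qed (use int[OF L(2)] weighted_integrable[OF L(2)] w in auto)
  also have "\<dots> = energy \<Omega> p \<sigma> v + (p - 1) * (\<integral>x. \<sigma> x powr (- 1 / (p - 1)) * norm (?a x) powr p \<partial>M)"
    using weighted_integrable[OF L(2)] w by (simp add: energy_def)
  finally show ?thesis by simp
qed

end

text \<open>On a compact interval of positive numbers, \<^term>\<open>1 - s powr (- 1 / (p - 1))\<close> is comparable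
  to \<^term>\<open>s - 1\<close>. Both estimates compare with \<^term>\<open>ln s\<close>, using
  \<^term>\<open>1 + y \<le> exp y\<close> for the exponential and the logarithm.\<close>

lemma one_minus_powr_bounds:
  fixes p s c C :: real
  assumes p: "p > 1" and s: "0 < c" "c \<le> s" "s \<le> C"
  shows "1 \<le> s \<Longrightarrow> 1 / (C * (1 + C / (p - 1))) * (s - 1) \<le> (p - 1) * (1 - s powr (- 1 / (p - 1)))"
    "s \<le> 1 \<Longrightarrow> (p - 1) * (s powr (- 1 / (p - 1)) - 1) \<le> c powr (- 1 / (p - 1)) / c * (1 - s)"
proof -
  define q where "q = 1 / (p - 1)"
  have q: "q > 0" "(p - 1) * q = 1" "- 1 / (p - 1) = - q" "C / (p - 1) = q * C"
    using p by (auto simp: q_def)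
  have s0: "s > 0" using s by simp
  show "1 / (C * (1 + C / (p - 1))) * (s - 1) \<le> (p - 1) * (1 - s powr (- 1 / (p - 1)))" if "1 \<le> s"
  proof -
    define y where "y = q * ln s"
    have y: "y \<ge> 0" "y \<le> q * C"
      using q that s ln_le_minus_one[OF s0] by (auto simp: y_def)
    have "(s - 1) / C \<le> (s - 1) / s"
      using s s0 that by (intro divide_left_mono) auto
    also have "\<dots> = 1 - 1 / s" using s0 by (simp add: field_simps)
    also have "\<dots> \<le> ln s"
      using ln_le_minus_one[of "1 / s"] s0 by (simp add: ln_div)
    finally have l: "q * ((s - 1) / C) \<le> y"
      unfolding y_def using q by (intro mult_left_mono) auto
    have "exp (- y) \<le> 1 / (1 + y)"
      using exp_ge_add_one_self[of y] y by (simp add: exp_minus field_simps)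
    then have "y / (1 + y) \<le> 1 - exp (- y)"
      using y by (simp add: field_simps)
    have "q * ((s - 1) / C) / (1 + q * C) \<le> y / (1 + y)"
      using l y q by (intro frac_le) auto
    also have "\<dots> \<le> 1 - s powr (- q)"
      using \<open>y / (1 + y) \<le> 1 - exp (- y)\<close> s0 by (simp add: powr_def y_def)
    finally have "(p - 1) * (q * ((s - 1) / C) / (1 + q * C)) \<le> (p - 1) * (1 - s powr (- q))"
      using p by (intro mult_left_mono) auto
    moreover have "(p - 1) * (q * ((s - 1) / C) / (1 + q * C)) = ((p - 1) * q) * (1 / (C * (1
        + q * C)) * (s - 1))"
      by simp
    ultimately show ?thesis by (simp only: q(2-4) mult_1_left)
  qed
  show "(p - 1) * (s powr (- 1 / (p - 1)) - 1) \<le> c powr (- 1 / (p - 1)) / c * (1 - s)" if "s \<le> 1"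
  proof -
    define y where "y = q * (- ln s)"
    have y: "y \<ge> 0" using q that s0 by (simp add: y_def mult_nonneg_nonpos)
    have sq: "s powr (- q) = exp y" using s0 by (simp add: powr_def y_def)
    have "1 - exp (- y) \<le> y" using exp_ge_add_one_self[of "- y"] by simp
    then have "(1 - exp (- y)) * exp y \<le> y * exp y" by (intro mult_right_mono) auto
    then have "exp y - 1 \<le> y * exp y" by (simp add: left_diff_distrib flip: exp_add)
    also have "\<dots> \<le> (q * ((1 - s) / c)) * c powr (- q)"
    proof (intro mult_mono)
      have "- ln s \<le> 1 / s - 1" using ln_le_minus_one[of "1 / s"] s0 by (simp add: ln_div)
      also have "\<dots> = (1 - s) / s" using s0 by (simp add: field_simps)
      also have "\<dots> \<le> (1 - s) / c" using s s0 that by (intro divide_left_mono) auto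
      finally show "y \<le> q * ((1 - s) / c)"
        unfolding y_def using q by (intro mult_left_mono) auto
      show "exp y \<le> c powr (- q)"
        unfolding sq[symmetric] using s q by (intro powr_mono2') auto
    qed (use q s that in auto)
    finally have "(p - 1) * (s powr (- q) - 1) \<le> (p - 1) * ((q * ((1 - s) / c)) * c powr (- q))"
      unfolding sq using p by (intro mult_left_mono) auto
    also have "\<dots> = ((p - 1) * q) * (c powr (- q) / c * (1 - s))" by simp
    finally show ?thesis by (simp only: q(2,3) mult_1_left)
  qed
qed

context conductivity
begin

text \<open>The difference of the Dirichlet-Neumann maps at a \<^term>\<open>p\<close>-harmonic \<^term>\<open>u0\<close> is the
  difference of two minimal energies. The function \<^term>\<open>u0\<close> is a competitor for the
  conductivity \<^term>\<open>\<sigma>\<close>, which gives the bound from above; the lower bound for the energy gives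
  the bound from below. If \<open>\<sigma> - 1\<close> has a sign, both bounds are comparable to the same
  integral, uniformly in \<^term>\<open>u0\<close>.\<close>

lemma DN_difference_comparable:
  assumes sign: "(AE x in M. \<sigma> x \<ge> 1) \<or> (AE x in M. \<sigma> x \<le> 1)"
  obtains \<kappa> K where "\<kappa> > 0" "\<And>u0. u0 \<in> W1p \<Omega> p \<Longrightarrow>
    (\<And>\<psi>. \<psi> \<in> W0p \<Omega> p \<Longrightarrow> (\<integral>x. flux p (weak_grad \<Omega> u0 x) \<bullet> weak_grad \<Omega> \<psi> x \<partial>M) = 0) \<Longrightarrow>
    \<kappa> * (\<integral>x. \<bar>\<sigma> x - 1\<bar> * norm (weak_grad \<Omega> u0 x) powr p \<partial>M)
      \<le> \<bar>DN_map \<Omega> p \<sigma> (bdry_class \<Omega> p u0) (bdry_class \<Omega> p u0)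
        - DN_map \<Omega> p (\<lambda>_. 1) (bdry_class \<Omega> p u0) (bdry_class \<Omega> p u0)\<bar> \<and>
    \<bar>DN_map \<Omega> p \<sigma> (bdry_class \<Omega> p u0) (bdry_class \<Omega> p u0)
        - DN_map \<Omega> p (\<lambda>_. 1) (bdry_class \<Omega> p u0) (bdry_class \<Omega> p u0)\<bar>
      \<le> K * (\<integral>x. \<bar>\<sigma> x - 1\<bar> * norm (weak_grad \<Omega> u0 x) powr p \<partial>M)"
proof -
  interpret one: conductivity \<Omega> p "\<lambda>_. 1" 1 1
    by unfold_locales auto
  let ?D = "\<lambda>u. DN_map \<Omega> p \<sigma> (bdry_class \<Omega> p u) (bdry_class \<Omega> p u)
        - DN_map \<Omega> p (\<lambda>_. 1) (bdry_class \<Omega> p u) (bdry_class \<Omega> p u)"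
  let ?J = "\<lambda>u. \<integral>x. \<bar>\<sigma> x - 1\<bar> * norm (weak_grad \<Omega> u x) powr p \<partial>M"
  let ?q = "- 1 / (p - 1)"
  define C' where "C' = max C 1"
  define \<kappa>1 where "\<kappa>1 = 1 / (C' * (1 + C' / (p - 1)))"
  define K1 where "K1 = c powr ?q / c"
  have C': "C' \<ge> 1" by (simp add: C'_def)
  have \<kappa>1: "\<kappa>1 > 0" using C' p by (auto simp: \<kappa>1_def intro!: mult_pos_pos add_pos_nonneg)
  have main: "min \<kappa>1 1 * ?J u \<le> \<bar>?D u\<bar> \<and> \<bar>?D u\<bar> \<le> max K1 1 * ?J u"
    if u: "u \<in> W1p \<Omega> p"
      and harmonic: "\<And>\<psi>. \<psi> \<in> W0p \<Omega> p \<Longrightarrow> (\<integral>x. flux p (weak_grad \<Omega> u x) \<bullet> weak_grad \<Omega> \<psi> x \<partial>M) = 0" for u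
  proof -
    let ?a = "weak_grad \<Omega> u"
    note La = W1pD(2)[OF u]
    have int: "integrable M (\<lambda>x. s x * norm (?a x) powr p)"
      if "s \<in> borel_measurable M" "AE x in M. \<bar>s x\<bar> \<le> B" for s B
      using flux_Lp_integrable[OF La La that] by (simp add: flux_inner_self)
    note i1 = weighted_integrable[OF La]
    have i2: "integrable M (\<lambda>x. \<sigma> x powr ?q * norm (?a x) powr p)"
      using int[OF weight_power_bound[of "1 / (p - 1)"]] p by simp
    note i3 = LpD(2)[OF La]
    have i4: "integrable M (\<lambda>x. \<bar>\<sigma> x - 1\<bar> * norm (?a x) powr p)"
    proof (rule int[where B="C + 1"])
      show "(\<lambda>x. \<bar>\<sigma> x - 1\<bar>) \<in> borel_measurable M" using \<sigma>_measurable by measurable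
      show "AE x in M. \<bar>\<bar>\<sigma> x - 1\<bar>\<bar> \<le> C + 1" using \<sigma>_bounds by eventually_elim (use c_pos in auto)
    qed
    have J0: "0 \<le> ?J u" by (rule integral_nonneg_AE) auto
    obtain v where v: "v \<in> bdry_class \<Omega> p u"
        "\<And>w. w \<in> bdry_class \<Omega> p u \<Longrightarrow> energy \<Omega> p \<sigma> v \<le> energy \<Omega> p \<sigma> w"
      "DN_map \<Omega> p \<sigma> (bdry_class \<Omega> p u) (bdry_class \<Omega> p u) = energy \<Omega> p \<sigma> v"
      using DN_map_minimal_energy[OF u] by blast
    obtain v1 where v1: "v1 \<in> bdry_class \<Omega> p u"
        "\<And>w. w \<in> bdry_class \<Omega> p u \<Longrightarrow> energy \<Omega> p (\<lambda>_. 1) v1 \<le> energy \<Omega> p (\<lambda>_. 1) w"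
      "DN_map \<Omega> p (\<lambda>_. 1) (bdry_class \<Omega> p u) (bdry_class \<Omega> p u) = energy \<Omega> p (\<lambda>_. 1) v1"
      using one.DN_map_minimal_energy[OF u] by blast
    have e1: "energy \<Omega> p (\<lambda>_. 1) u = pmean M p ?a" by (simp add: energy_def pmean_def)
    \<comment> \<open>For the conductivity one, the lower bound is attained by \<^term>\<open>u\<close> itself.\<close>
    have "energy \<Omega> p (\<lambda>_. 1) v1 \<ge> pmean M p ?a"
      using one.energy_lower_bound[OF u harmonic v1(1)] by (simp add: pmean_def algebra_simps)
    with v1(2)[OF bdry_class_refl[OF u]] e1 v1(3)
    have D1: "DN_map \<Omega> p (\<lambda>_. 1) (bdry_class \<Omega> p u) (bdry_class \<Omega> p u) = pmean M p ?a" by simp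
    have "?D u \<le> energy \<Omega> p \<sigma> u - pmean M p ?a"
      using v(2)[OF bdry_class_refl[OF u]] v(3) D1 by simp
    also have "\<dots> = (\<integral>x. (\<sigma> x - 1) * norm (?a x) powr p \<partial>M)"
      unfolding energy_def pmean_def using i1 i3 by (simp add: left_diff_distrib)
    finally have up: "?D u \<le> (\<integral>x. (\<sigma> x - 1) * norm (?a x) powr p \<partial>M)" .
    have "(p - 1) * (\<integral>x. (1 - \<sigma> x powr ?q) * norm (?a x) powr p \<partial>M)
        = (p - 1) * (pmean M p ?a - (\<integral>x. \<sigma> x powr ?q * norm (?a x) powr p \<partial>M))"
      unfolding pmean_def using i2 i3 by (simp add: left_diff_distrib)
    also have "\<dots> \<le> ?D u"
      using energy_lower_bound[OF u harmonic v(1)] v(3) D1 by (simp add: algebra_simps)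
    finally have low: "(p - 1) * (\<integral>x. (1 - \<sigma> x powr ?q) * norm (?a x) powr p \<partial>M) \<le> ?D u" .
    have i5: "integrable M (\<lambda>x. (\<sigma> x - 1) * norm (?a x) powr p)"
      "integrable M (\<lambda>x. (1 - \<sigma> x powr ?q) * norm (?a x) powr p)"
      using i1 i2 i3 by (simp_all add: left_diff_distrib)
    from sign show ?thesis
    proof
      assume ge: "AE x in M. \<sigma> x \<ge> 1"
      have "(\<integral>x. (\<sigma> x - 1) * norm (?a x) powr p \<partial>M) = ?J u"
        by (rule integral_cong_AE) (use i5 i4 ge in \<open>auto elim: eventually_mono\<close>)
      with up have D_le: "?D u \<le> ?J u" by simp
      have "\<kappa>1 * ?J u = (\<integral>x. \<kappa>1 * (\<bar>\<sigma> x - 1\<bar> * norm (?a x) powr p) \<partial>M)" by simp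
      also have "\<dots> \<le> (\<integral>x. (p - 1) * ((1 - \<sigma> x powr ?q) * norm (?a x) powr p) \<partial>M)"
      proof (rule integral_mono_AE)
        show "AE x in M. \<kappa>1 * (\<bar>\<sigma> x - 1\<bar> * norm (?a x) powr p)
            \<le> (p - 1) * ((1 - \<sigma> x powr ?q) * norm (?a x) powr p)"
          using ge \<sigma>_bounds
        proof eventually_elim
          case (elim x)
          then have "\<kappa>1 * \<bar>\<sigma> x - 1\<bar> \<le> (p - 1) * (1 - \<sigma> x powr ?q)"
            using one_minus_powr_bounds(1)[OF p c_pos, of "\<sigma> x" C'] by (auto simp: \<kappa>1_def C'_def)
          then have "\<kappa>1 * \<bar>\<sigma> x - 1\<bar> * norm (?a x) powr p
              \<le> (p - 1) * (1 - \<sigma> x powr ?q) * norm (?a x) powr p"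
            by (rule mult_right_mono) simp
          then show ?case by (simp only: mult.assoc)
        qed
      qed (use i4 i5 in auto)
      also have "\<dots> \<le> ?D u" using low by simp
      finally have D_ge: "\<kappa>1 * ?J u \<le> ?D u" .
      have "min \<kappa>1 1 * ?J u \<le> \<kappa>1 * ?J u" "?J u \<le> max K1 1 * ?J u"
        using J0 mult_right_mono[of 1 "max K1 1" "?J u"] by (auto intro: mult_right_mono)
      with D_ge D_le \<kappa>1 J0 show ?thesis
        by (smt (verit) mult_nonneg_nonneg)
    next
      assume le: "AE x in M. \<sigma> x \<le> 1"
      have "(\<integral>x. (\<sigma> x - 1) * norm (?a x) powr p \<partial>M) = (\<integral>x. - (\<bar>\<sigma> x - 1\<bar> * norm (?a x) powr p) \<partial>M)"
      proof (rule integral_cong_AE)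
        show "AE x in M. (\<sigma> x - 1) * norm (?a x) powr p = - (\<bar>\<sigma> x - 1\<bar> * norm (?a x) powr p)"
          using le by eventually_elim (simp add: algebra_simps)
      qed (use i5 i4 in auto)
      with up have D_le: "?J u \<le> - ?D u" by simp
      have "- ?D u \<le> - ((p - 1) * (\<integral>x. (1 - \<sigma> x powr ?q) * norm (?a x) powr p \<partial>M))" using low by simp
      also have "\<dots> = (\<integral>x. - ((p - 1) * ((1 - \<sigma> x powr ?q) * norm (?a x) powr p)) \<partial>M)" by simp
      also have "\<dots> \<le> (\<integral>x. K1 * (\<bar>\<sigma> x - 1\<bar> * norm (?a x) powr p) \<partial>M)"
      proof (rule integral_mono_AE)
        show "AE x in M. - ((p - 1) * ((1 - \<sigma> x powr ?q) * norm (?a x) powr p))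
            \<le> K1 * (\<bar>\<sigma> x - 1\<bar> * norm (?a x) powr p)"
          using le \<sigma>_bounds
        proof eventually_elim
          case (elim x)
          then have "(p - 1) * (\<sigma> x powr ?q - 1) \<le> K1 * \<bar>\<sigma> x - 1\<bar>"
            using one_minus_powr_bounds(2)[OF p c_pos, of "\<sigma> x" C] by (auto simp: K1_def)
          then have "(p - 1) * (\<sigma> x powr ?q - 1) * norm (?a x) powr p
              \<le> K1 * \<bar>\<sigma> x - 1\<bar> * norm (?a x) powr p"
            by (rule mult_right_mono) simp
          then show ?case by (simp add: algebra_simps)
        qed
      qed (use i4 i5 in auto)
      also have "\<dots> = K1 * ?J u" by simp
      finally have D_ge: "- ?D u \<le> K1 * ?J u" .
      have "min \<kappa>1 1 * ?J u \<le> 1 * ?J u" "K1 * ?J u \<le> max K1 1 * ?J u"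
        using J0 by (intro mult_right_mono; simp)+
      with D_ge D_le J0 show ?thesis by linarith
    qed
  qed
  show thesis
    by (rule that[of "min \<kappa>1 1" "max K1 1"]) (use \<kappa>1 main in auto)
qed

end

section \<open>Wolff solutions\<close>

lemma C_diff_deriv:
  fixes f :: "real \<Rightarrow> real"
  assumes "C_diff (Suc k) f"
  shows "C_diff k (deriv f)" "(f has_real_derivative deriv f x) (at x)"
proof -
  have D: "(f has_real_derivative deriv f x) (at x)" for x
    using assms by (simp add: DERIV_deriv_iff_real_differentiable)
  then show "(f has_real_derivative deriv f x) (at x)" .
  have "frechet_derivative f (at x) 1 = deriv f x" for x
    using frechet_derivative_at'[OF D[of x, unfolded has_field_derivative_def]] by simp
  then have "deriv f = (\<lambda>x. frechet_derivative f (at x) 1)" by auto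
  with assms show "C_diff k (deriv f)" by simp
qed

lemma smooth_derivs:
  fixes w :: "real \<Rightarrow> real"
  assumes "smooth w"
  shows "(w has_real_derivative deriv w s) (at s)"
    "(deriv w has_real_derivative deriv (deriv w) s) (at s)"
    "continuous_on UNIV (deriv w)" "continuous_on UNIV (deriv (deriv w))"
proof -
  have C: "C_diff (Suc (Suc 0)) w" using assms unfolding smooth_def by blast
  note C' = C_diff_deriv(1)[OF C]
  show "(w has_real_derivative deriv w s) (at s)" by (rule C_diff_deriv(2)[OF C])
  show "(deriv w has_real_derivative deriv (deriv w) s) (at s)" by (rule C_diff_deriv(2)[OF C'])
  show "continuous_on UNIV (deriv w)" by (rule C1_D(2)[OF C'])
  show "continuous_on UNIV (deriv (deriv w))" using C_diff_deriv(1)[OF C'] by simp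
qed

text \<open>Both \<^term>\<open>\<lambda>s. R s * exp (L * s)\<close> and \<^term>\<open>\<lambda>s. R s * exp (- L * s)\<close> are monotone.
  Applied to the squared radius, this shows that a solution of the ordinary differential equation
  with non-zero initial data never meets the origin of the phase plane, where the potential
  degenerates.\<close>

lemma exp_rate_positive:
  fixes R R' :: "real \<Rightarrow> real"
  assumes D: "\<And>s. (R has_real_derivative R' s) (at s)" and rate: "\<And>s. \<bar>R' s\<bar> \<le> L * R s"
      and R0: "R 0 > 0"
  shows "R s > 0"
proof (cases "s \<ge> 0")
  case True
  have "R 0 * exp (L * 0) \<le> R s * exp (L * s)"
  proof (rule DERIV_nonneg_imp_nondecreasing[OF True])
    fix x
    have "((\<lambda>s. R s * exp (L * s)) has_real_derivative (R' x + L * R x) * exp (L * x)) (at x)"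
      by (auto intro!: derivative_eq_intros D simp: algebra_simps)
    moreover have "0 \<le> (R' x + L * R x) * exp (L * x)"
      using rate[of x] by (intro mult_nonneg_nonneg) auto
    ultimately show "\<exists>y. ((\<lambda>s. R s * exp (L * s)) has_real_derivative y) (at x) \<and> y \<ge> 0" by blast
  qed
  then have "0 < R s * exp (L * s)" using R0 by simp
  then show ?thesis by (simp add: zero_less_mult_iff)
next
  case False
  have "R s * exp (- L * s) \<ge> R 0 * exp (- L * 0)"
  proof (rule DERIV_nonpos_imp_nonincreasing[of s 0])
    fix x
    have "((\<lambda>s. R s * exp (- L * s)) has_real_derivative (R' x - L * R x) * exp (- L * x)) (at x)"
      by (auto intro!: derivative_eq_intros D simp: algebra_simps)
    moreover have "(R' x - L * R x) * exp (- L * x) \<le> 0"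
      using rate[of x] by (intro mult_nonpos_nonneg) auto
    ultimately show "\<exists>y. ((\<lambda>s. R s * exp (- L * s)) has_real_derivative y) (at x) \<and> y \<le> 0" by blast
  qed (use False in simp)
  then have "0 < R s * exp (- L * s)" using R0 by simp
  then show ?thesis by (simp add: zero_less_mult_iff)
qed

locale wolff_ode =
  fixes p a b :: real and w :: "real \<Rightarrow> real"
  assumes p: "1 < p" and initial: "(a, b) \<noteq> (0, 0)" and profile: "wolff_profile p a b w"
begin

text \<open>The square of the radius in the phase plane.\<close>

definition R :: "real \<Rightarrow> real" where "R s = (w s)\<^sup>2 + (deriv w s)\<^sup>2"

abbreviation "V s \<equiv> wolff_V p (w s) (deriv w s)"

lemma deriv2: "deriv (deriv w) s = - V s * w s"
proof -
  have "deriv (deriv w) s + V s * w s = 0"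
    using profile unfolding wolff_profile_def by blast
  then show ?thesis by simp
qed

lemma smooth_w: "smooth w"
  using profile by (simp add: wolff_profile_def)

lemmas w_derivs = smooth_derivs[OF smooth_w]

lemma R_derivative: "(R has_real_derivative 2 * w s * deriv w s * (1 - V s)) (at s)"
proof -
  have "((\<lambda>s. (w s)\<^sup>2) has_real_derivative 2 * w s * deriv w s) (at s)"
    using DERIV_power[OF w_derivs(1), of 2 s] by (simp add: mult_ac)
  moreover have "((\<lambda>s. (deriv w s)\<^sup>2) has_real_derivative 2 * deriv w s * (- V s * w s)) (at s)"
    using DERIV_power[OF w_derivs(2), of 2 s] by (simp add: deriv2 mult_ac)
  ultimately have "(R has_real_derivative 2 * w s * deriv w s + 2 * deriv w s * (- V s * w s)) (at s)"
    unfolding R_def[abs_def] by (rule DERIV_add)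
  then show ?thesis by (simp add: algebra_simps)
qed

lemma R_pos: "R s > 0"
proof (rule exp_rate_positive[OF R_derivative])
  define \<mu> where "\<mu> = min (p - 1) 1"
  have \<mu>: "\<mu> > 0" using p by (simp add: \<mu>_def)
  define B where "B = (\<bar>2 * p - 3\<bar> + (p - 1)) / \<mu>"
  have VB: "\<bar>V s\<bar> \<le> B" for s
  proof (cases "R s = 0")
    case True
    then have "w s = 0" "deriv w s = 0" by (auto simp: R_def sum_power2_eq_zero_iff)
    then show ?thesis using p \<mu> by (simp add: wolff_V_def B_def)
  next
    case False
    then have R: "R s > 0" by (simp add: R_def order_less_le)
    let ?den = "(p - 1) * (deriv w s)\<^sup>2 + (w s)\<^sup>2"
    have den: "\<mu> * R s \<le> ?den"
    proof -
      have "\<mu> * (w s)\<^sup>2 \<le> 1 * (w s)\<^sup>2" "\<mu> * (deriv w s)\<^sup>2 \<le> (p - 1) * (deriv w s)\<^sup>2"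
        by (intro mult_right_mono; simp add: \<mu>_def)+
      then show ?thesis by (simp add: R_def distrib_left)
    qed
    have pos: "0 < \<mu> * R s" using \<mu> R by simp
    have dpos: "0 < ?den" using den pos by linarith
    have "\<bar>(2 * p - 3) * (deriv w s)\<^sup>2 + (p - 1) * (w s)\<^sup>2\<bar> \<le> \<bar>2 * p - 3\<bar> * (deriv w s)\<^sup>2
        + (p - 1) * (w s)\<^sup>2"
      using p by (intro order_trans[OF abs_triangle_ineq]) (simp add: abs_mult)
    also have "\<dots> \<le> \<bar>2 * p - 3\<bar> * R s + (p - 1) * R s"
      using p by (intro add_mono mult_left_mono) (auto simp: R_def)
    finally have "\<bar>V s\<bar> \<le> ((\<bar>2 * p - 3\<bar> + (p - 1)) * R s) / ?den"
      using den pos by (simp add: wolff_V_def abs_divide distrib_right divide_right_mono)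
    also have "\<dots> \<le> ((\<bar>2 * p - 3\<bar> + (p - 1)) * R s) / (\<mu> * R s)"
      by (rule divide_left_mono[OF den _ mult_pos_pos[OF dpos pos]]) (use p R in simp)
    also have "\<dots> = B" using R by (simp add: B_def)
    finally show ?thesis .
  qed
  show "\<bar>2 * w s * deriv w s * (1 - V s)\<bar> \<le> (1 + B) * R s" for s
  proof -
    have "\<bar>2 * w s * deriv w s\<bar> \<le> R s"
      using sum_squares_bound[of "\<bar>w s\<bar>" "\<bar>deriv w s\<bar>"] by (simp add: R_def abs_mult)
    moreover have "\<bar>1 - V s\<bar> \<le> 1 + B" using VB[of s] by linarith
    ultimately have "\<bar>2 * w s * deriv w s\<bar> * \<bar>1 - V s\<bar> \<le> R s * (1 + B)"
      by (intro mult_mono) (auto simp: R_def)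
    then show ?thesis by (simp add: abs_mult mult.commute)
  qed
  have "w 0 = a" "deriv w 0 = b" using profile by (auto simp: wolff_profile_def)
  then show "R 0 > 0" using initial by (auto simp: R_def sum_power2_gt_zero_iff)
qed

text \<open>The denominator of the potential \<^term>\<open>V s\<close>.\<close>

definition den :: "real \<Rightarrow> real" where "den s = (p - 1) * (deriv w s)\<^sup>2 + (w s)\<^sup>2"

lemma den_pos: "den s > 0"
proof (cases "w s = 0")
  case True
  then have "(deriv w s)\<^sup>2 > 0" using R_pos[of s] by (simp add: R_def)
  with True p show ?thesis by (simp add: den_def)
next
  case False
  then show ?thesis using p by (simp add: den_def add_nonneg_pos)
qed

lemma V_den: "V s * den s = (2 * p - 3) * (deriv w s)\<^sup>2 + (p - 1) * (w s)\<^sup>2"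
  using den_pos[of s] by (simp add: wolff_V_def den_def)

text \<open>In polar coordinates of the phase plane the equation separates: the logarithm of the squared
  radius is, up to a constant, a multiple of the squared sine of the angle. This first integral
  confines the radius between two positive constants.\<close>

lemma R_bounds: obtains lo hi where "0 < lo" "\<And>s. lo \<le> R s \<and> R s \<le> hi"
proof -
  define \<kappa> where "\<kappa> = (2 - p) / (p - 1)"
  define Q where "Q s = ln (R s) + \<kappa> * (deriv w s)\<^sup>2 / R s" for s
  have "(Q has_real_derivative 0) (at s)" for s
  proof -
    let ?x = "w s" and ?y = "deriv w s" and ?R' = "2 * w s * deriv w s * (1 - V s)"
    have D: "(Q has_real_derivative ?R' / R s + ((\<kappa> * (2 * ?y * (- V s * ?x))) * R s - \<kappa> * ?y\<^sup>2
        * ?R') / (R s * R s)) (at s)"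
    proof -
      have "((\<lambda>s. ln (R s)) has_real_derivative ?R' / R s) (at s)"
        using DERIV_chain2[OF DERIV_ln[OF R_pos] R_derivative, of s] by (simp add: field_simps)
      moreover have "((\<lambda>s. (deriv w s)\<^sup>2) has_real_derivative 2 * ?y * (- V s * ?x)) (at s)"
        using DERIV_power[OF w_derivs(2), of 2 s] by (simp add: deriv2 mult_ac)
      ultimately show ?thesis
        unfolding Q_def[abs_def] using R_pos[of s]
        by (intro DERIV_add DERIV_divide DERIV_cmult R_derivative) auto
    qed
    have 1: "(1 - V s) * den s = (2 - p) * R s"
      unfolding left_diff_distrib V_den by (simp add: den_def R_def algebra_simps)
    have 2: "(V s * ?x\<^sup>2 + ?y\<^sup>2) * den s = (p - 1) * (R s * R s)"
      unfolding distrib_right mult.commute[of "V s"] mult.assoc V_den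
      by (simp add: den_def R_def algebra_simps power2_eq_square)
    have "((1 - V s) * R s) * den s = (\<kappa> * (V s * ?x\<^sup>2 + ?y\<^sup>2)) * den s"
    proof -
      have "((1 - V s) * R s) * den s = (2 - p) * (R s * R s)"
        using 1 by (simp add: mult_ac)
      also have "\<dots> = \<kappa> * ((p - 1) * (R s * R s))" using p by (simp add: \<kappa>_def)
      also have "\<dots> = (\<kappa> * (V s * ?x\<^sup>2 + ?y\<^sup>2)) * den s" unfolding 2[symmetric] by simp
      finally show ?thesis .
    qed
    then have key: "(1 - V s) * R s = \<kappa> * (V s * ?x\<^sup>2 + ?y\<^sup>2)"
      using den_pos[of s] by simp
    have "?R' / R s + ((\<kappa> * (2 * ?y * (- V s * ?x))) * R s - \<kappa> * ?y\<^sup>2 * ?R') / (R s * R s)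
        = 2 * ?x * ?y * ((1 - V s) * R s - \<kappa> * (V s * R s + ?y\<^sup>2 * (1 - V s))) / (R s * R s)"
      using R_pos[of s] by (simp add: field_simps)
    also have "V s * R s + ?y\<^sup>2 * (1 - V s) = V s * ?x\<^sup>2 + ?y\<^sup>2"
      by (simp add: R_def algebra_simps)
    also have "(1 - V s) * R s - \<kappa> * (V s * ?x\<^sup>2 + ?y\<^sup>2) = 0" using key by simp
    finally show ?thesis using D by simp
  qed
  then have Q: "Q s = Q 0" for s using DERIV_isconst_all by blast
  have "\<bar>ln (R s) - Q 0\<bar> \<le> \<bar>\<kappa>\<bar>" for s
  proof -
    have "\<bar>ln (R s) - Q 0\<bar> = \<bar>\<kappa>\<bar> * ((deriv w s)\<^sup>2 / R s)"
      using R_pos[of s] unfolding Q[of s, symmetric] by (simp add: Q_def abs_mult)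
    also have "\<dots> \<le> \<bar>\<kappa>\<bar> * 1"
      using R_pos[of s] by (intro mult_left_mono) (auto simp: R_def)
    finally show ?thesis by simp
  qed
  then have b: "Q 0 - \<bar>\<kappa>\<bar> \<le> ln (R s)" "ln (R s) \<le> Q 0 + \<bar>\<kappa>\<bar>" for s
    by (smt (verit))+
  show thesis
  proof (rule that)
    show "0 < exp (Q 0 - \<bar>\<kappa>\<bar>)" by simp
    show "exp (Q 0 - \<bar>\<kappa>\<bar>) \<le> R s \<and> R s \<le> exp (Q 0 + \<bar>\<kappa>\<bar>)" for s
      using b[of s] R_pos[of s] by (metis exp_le_cancel_iff exp_ln)
  qed
qed

text \<open>Up to an exponential factor, the components of the flux of a Wolff solution along its two
  directions.\<close>

definition g1 :: "real \<Rightarrow> real" where "g1 s = R s powr ((p - 2) / 2) * w s"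
definition g2 :: "real \<Rightarrow> real" where "g2 s = R s powr ((p - 2) / 2) * deriv w s"

lemma g1_derivative:
  obtains g where "\<And>s. (g1 has_real_derivative g s) (at s)" "continuous_on UNIV g"
proof
  let ?R' = "\<lambda>s. 2 * w s * deriv w s * (1 - V s)"
  let ?g = "\<lambda>s. (p - 2) / 2 * R s powr ((p - 2) / 2 - 1) * (2 * w s * deriv w s
      + 2 * deriv w s * deriv (deriv w) s) * w s
      + R s powr ((p - 2) / 2) * deriv w s"
  have R': "(R has_real_derivative 2 * w s * deriv w s + 2 * deriv w s * deriv (deriv w) s) (at s)"
      for s
  proof -
    have "2 * w s * deriv w s + 2 * deriv w s * deriv (deriv w) s = 2 * w s * deriv w s * (1 - V s)"
      by (simp add: deriv2 algebra_simps)
    with R_derivative[of s] show ?thesis by simp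
  qed
  show "(g1 has_real_derivative ?g s) (at s)" for s
    unfolding g1_def[abs_def]
    using DERIV_mult[OF DERIV_fun_powr[OF R' R_pos, of "(p - 2) / 2"] w_derivs(1), of s]
    by (simp add: mult.commute)
  have cw: "continuous_on UNIV w" using smooth_w unfolding smooth_def by (metis C_diff.simps(1))
  have cR: "continuous_on UNIV R" unfolding R_def[abs_def] by (intro continuous_intros cw w_derivs)
  have "R s \<noteq> 0" for s using R_pos[of s] by simp
  then show "continuous_on UNIV ?g"
    by (intro continuous_intros cR cw w_derivs) auto
qed

text \<open>This is the ordinary differential equation in divergence form. Along the direction of growth
  the flux is multiplied by an exponential with rate \<^term>\<open>p - 1\<close>, so the derivatives along
  the two directions cancel and the flux is divergence free.\<close>

lemma g2_derivative: "(g2 has_real_derivative - (p - 1) * g1 s) (at s)"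
proof -
  let ?x = "w s" and ?y = "deriv w s" and ?R' = "2 * w s * deriv w s * (1 - V s)"
  have D: "(g2 has_real_derivative (p - 2) / 2 * R s powr ((p - 2) / 2 - 1) * ?R' * ?y
      + R s powr ((p - 2) / 2) * (- V s * ?x)) (at s)"
    unfolding g2_def[abs_def]
    using DERIV_mult[OF DERIV_fun_powr[OF R_derivative R_pos, of "(p - 2) / 2"] w_derivs(2), of s]
    by (simp add: deriv2 mult.commute)
  have 1: "(1 - V s) * den s = (2 - p) * R s"
    unfolding left_diff_distrib V_den by (simp add: den_def R_def algebra_simps)
  have "((p - 2) * ?y\<^sup>2 * (1 - V s) - V s * R s) * den s
      = (p - 2) * ?y\<^sup>2 * ((1 - V s) * den s) - (V s * den s) * R s" by (simp add: algebra_simps)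
  also have "\<dots> = R s * ((p - 2) * ?y\<^sup>2 * (2 - p) - ((2 * p - 3) * ?y\<^sup>2 + (p - 1) * ?x\<^sup>2))"
    unfolding 1 V_den by (simp add: algebra_simps)
  also have "\<dots> = (- (p - 1) * R s) * den s"
    by (simp add: den_def algebra_simps power2_eq_square)
  finally have key: "(p - 2) * ?y\<^sup>2 * (1 - V s) - V s * R s = - (p - 1) * R s"
    using den_pos[of s] by simp
  have pw: "R s powr ((p - 2) / 2) = R s * R s powr ((p - 2) / 2 - 1)"
    using R_pos[of s] by (simp add: powr_diff)
  have "(p - 2) / 2 * R s powr ((p - 2) / 2 - 1) * ?R' * ?y + R s powr ((p - 2) / 2) * (- V s * ?x)
      = R s powr ((p - 2) / 2 - 1) * ?x * ((p - 2) * ?y\<^sup>2 * (1 - V s) - V s * R s)"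
  proof -
    have "(p - 2) / 2 * E * (2 * x * y * (1 - v)) * y + r * E * (- v * x)
        = E * x * ((p - 2) * y\<^sup>2 * (1 - v) - v * r)" for E x y v r :: real
      by (simp add: field_simps power2_eq_square)
    then show ?thesis unfolding pw .
  qed
  also have "\<dots> = - (p - 1) * g1 s"
    unfolding key g1_def pw by (simp add: mult_ac)
  finally show ?thesis using D by simp
qed

end

lemma plane_function:
  fixes g g' :: "real \<Rightarrow> real" and \<rho> \<rho>' :: "'a::euclidean_space"
  assumes g: "\<And>s. (g has_real_derivative g' s) (at s)" "continuous_on UNIV g'"
  shows "C_diff (Suc 0) (\<lambda>x. exp (k * (x \<bullet> \<rho> - t)) * g (\<tau> * (x \<bullet> \<rho>')))"
    "frechet_derivative (\<lambda>x. exp (k * (x \<bullet> \<rho> - t)) * g (\<tau> * (x \<bullet> \<rho>'))) (at x) v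
      = exp (k * (x \<bullet> \<rho> - t)) * (k * (v \<bullet> \<rho>) * g (\<tau> * (x \<bullet> \<rho>')) + \<tau> * (v \<bullet> \<rho>') * g' (\<tau> * (x \<bullet> \<rho>')))"
proof -
  have "C_diff (Suc 0) exp"
    by (rule C1_realI[of exp exp]) (auto intro!: DERIV_exp continuous_intros)
  from C_diff_comp_inner[OF this, of k \<rho> "- k * t"]
  have 1: "C_diff (Suc 0) (\<lambda>x. exp (k * (x \<bullet> \<rho> - t)))" by (simp add: right_diff_distrib)
  have "C_diff (Suc 0) g" using g by (rule C1_realI)
  from C_diff_comp_inner[OF this, of \<tau> \<rho>' 0]
  have 2: "C_diff (Suc 0) (\<lambda>x. g (\<tau> * (x \<bullet> \<rho>')))" by simp
  show "C_diff (Suc 0) (\<lambda>x. exp (k * (x \<bullet> \<rho> - t)) * g (\<tau> * (x \<bullet> \<rho>')))"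
    by (rule C_diff_mult[OF 1 2])
  have d1: "((\<lambda>x. k * (x \<bullet> \<rho> - t)) has_derivative (\<lambda>v. k * (v \<bullet> \<rho>))) (at x)" for x
    by (auto intro!: derivative_eq_intros)
  have d2: "((\<lambda>x. \<tau> * (x \<bullet> \<rho>')) has_derivative (\<lambda>v. \<tau> * (v \<bullet> \<rho>'))) (at x)" for x
    by (auto intro!: derivative_eq_intros)
  have f1: "frechet_derivative (\<lambda>x. exp (k * (x \<bullet> \<rho> - t))) (at x) v
      = exp (k * (x \<bullet> \<rho> - t)) * (k * (v \<bullet> \<rho>))"
    by (subst frechet_derivative_comp_real(2)[where h=exp, OF DERIV_exp])
      (use d1 in \<open>auto simp: differentiable_def frechet_derivative_at'[OF d1]\<close>)
  have f2: "frechet_derivative (\<lambda>x. g (\<tau> * (x \<bullet> \<rho>'))) (at x) v = g' (\<tau> * (x \<bullet> \<rho>')) * (\<tau> * (v \<bullet> \<rho>'))"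
    by (subst frechet_derivative_comp_real(2)[where h=g, OF g(1)])
      (use d2 in \<open>auto simp: differentiable_def frechet_derivative_at'[OF d2]\<close>)
  show "frechet_derivative (\<lambda>x. exp (k * (x \<bullet> \<rho> - t)) * g (\<tau> * (x \<bullet> \<rho>'))) (at x) v
      = exp (k * (x \<bullet> \<rho> - t)) * (k * (v \<bullet> \<rho>) * g (\<tau> * (x \<bullet> \<rho>')) + \<tau> * (v \<bullet> \<rho>') * g' (\<tau> * (x \<bullet> \<rho>')))"
    unfolding frechet_derivative_mult_real[OF C1_D(1)[OF 1] C1_D(1)[OF 2]] f1 f2
    by (simp add: distrib_left mult_ac)
qed

context wolff_ode
begin

context
  fixes \<rho> \<rho>' :: "'a::euclidean_space" and t \<tau> :: real
  assumes ortho: "norm \<rho> = 1" "norm \<rho>' = 1" "\<rho> \<bullet> \<rho>' = 0" and \<tau>: "\<tau> > 0"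
begin

abbreviation "u \<equiv> wolff_solution w \<rho> \<rho>' t \<tau>"

lemma u_eq: "u = (\<lambda>x. exp (\<tau> * (x \<bullet> \<rho> - t)) * w (\<tau> * (x \<bullet> \<rho>')))"
  by (simp add: wolff_solution_def fun_eq_iff)

lemma wolff_C1: "C_diff (Suc 0) u"
  unfolding u_eq by (rule plane_function(1)[OF w_derivs(1) w_derivs(3)])

lemma wolff_grad:
  "classical_grad u x = (\<tau> * exp (\<tau> * (x \<bullet> \<rho> - t))) *\<^sub>R
     (w (\<tau> * (x \<bullet> \<rho>')) *\<^sub>R \<rho> + deriv w (\<tau> * (x \<bullet> \<rho>')) *\<^sub>R \<rho>')"
proof (rule euclidean_eqI)
  fix i :: 'a assume "i \<in> Basis"
  show "classical_grad u x \<bullet> i = ((\<tau> * exp (\<tau> * (x \<bullet> \<rho> - t))) *\<^sub>R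
     (w (\<tau> * (x \<bullet> \<rho>')) *\<^sub>R \<rho> + deriv w (\<tau> * (x \<bullet> \<rho>')) *\<^sub>R \<rho>')) \<bullet> i"
    unfolding classical_grad_inner[OF C1_D(1)[OF wolff_C1]]
    unfolding u_eq plane_function(2)[OF w_derivs(1) w_derivs(3)]
    by (simp add: inner_add_left inner_commute[of i] algebra_simps)
qed

lemma norm_wolff_grad: "norm (classical_grad u x) = \<tau> * exp (\<tau> * (x \<bullet> \<rho> - t)) * sqrt (R (\<tau> * (x \<bullet> \<rho>')))"
proof -
  have "norm (y *\<^sub>R \<rho> + z *\<^sub>R \<rho>') = sqrt (y\<^sup>2 + z\<^sup>2)" for y z
    using ortho by (simp add: norm_eq_sqrt_inner inner_add_left inner_add_right inner_commute[of \<rho>'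
        \<rho>] power2_eq_square)

  then show ?thesis
    unfolding wolff_grad using \<tau> by (simp add: R_def abs_mult)
qed

lemma norm_wolff_grad_powr:
  "norm (classical_grad u x) powr q = \<tau> powr q * exp (q * \<tau> * (x \<bullet> \<rho> - t)) * R (\<tau>
      * (x \<bullet> \<rho>')) powr (q / 2)"
proof -
  have "exp (\<tau> * (x \<bullet> \<rho> - t)) powr q = exp (q * \<tau> * (x \<bullet> \<rho> - t))"
    by (simp add: powr_def mult_ac)
  moreover have "sqrt y powr q = y powr (q / 2)" if "y > 0" for y
    using that by (simp add: powr_half_sqrt[symmetric] powr_powr)
  ultimately show ?thesis
    unfolding norm_wolff_grad using \<tau> R_pos[of "\<tau> * (x \<bullet> \<rho>')"] by (simp add: powr_mult)
qed

lemma wolff_flux: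
  "flux p (classical_grad u x) = \<tau> powr (p - 1) *\<^sub>R
     ((exp (((p - 1) * \<tau>) * (x \<bullet> \<rho> - t)) * g1 (\<tau> * (x \<bullet> \<rho>'))) *\<^sub>R \<rho>
      + (exp (((p - 1) * \<tau>) * (x \<bullet> \<rho> - t)) * g2 (\<tau> * (x \<bullet> \<rho>'))) *\<^sub>R \<rho>')"
proof -
  have 1: "\<tau> powr (p - 2) * \<tau> = \<tau> powr (p - 1)"
    using \<tau> powr_mult_base[of \<tau> "p - 2"] by (simp add: mult.commute)
  have 2: "exp ((p - 2) * \<tau> * (x \<bullet> \<rho> - t)) * exp (\<tau> * (x \<bullet> \<rho> - t)) = exp (((p - 1) * \<tau>) * (x \<bullet> \<rho> - t))"
    by (simp add: algebra_simps flip: exp_add)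
  have "flux p (classical_grad u x)
      = ((\<tau> powr (p - 2) * \<tau>) * (exp ((p - 2) * \<tau> * (x \<bullet> \<rho> - t)) * exp (\<tau> * (x \<bullet> \<rho> - t)))
          * R (\<tau> * (x \<bullet> \<rho>')) powr ((p - 2) / 2)) *\<^sub>R
        (w (\<tau> * (x \<bullet> \<rho>')) *\<^sub>R \<rho> + deriv w (\<tau> * (x \<bullet> \<rho>')) *\<^sub>R \<rho>')"
    unfolding flux_def norm_wolff_grad_powr by (simp add: wolff_grad mult_ac)
  then show ?thesis
    unfolding 1 2 g1_def g2_def by (simp add: scaleR_add_right mult_ac)
qed

text \<open>Integration by parts moves the two directional derivatives from the test function to the
  components of the flux, where they cancel.\<close>

lemma wolff_p_harmonic:
  assumes \<Omega>: "open \<Omega>" and \<phi>: "\<phi> \<in> test_functions \<Omega>"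
  shows "(\<integral>x. flux p (classical_grad u x) \<bullet> classical_grad \<phi> x \<partial>lebesgue_on \<Omega>) = 0"
proof -
  obtain g1' where g1': "\<And>s. (g1 has_real_derivative g1' s) (at s)" "continuous_on UNIV g1'"
    using g1_derivative by blast
  have g2': "\<And>s. (g2 has_real_derivative (\<lambda>s. - (p - 1) * g1 s) s) (at s)"
      "continuous_on UNIV (\<lambda>s. - (p - 1) * g1 s)"
    using g2_derivative DERIV_continuous_on[of UNIV g1] g1'(1)
    by (auto intro!: continuous_intros continuous_at_imp_continuous_on DERIV_isCont[OF g1'(1)])
  let ?k = "(p - 1) * \<tau>"
  let ?\<alpha> = "\<lambda>x. exp (?k * (x \<bullet> \<rho> - t)) * g1 (\<tau> * (x \<bullet> \<rho>'))"
      and ?\<beta> = "\<lambda>x. exp (?k * (x \<bullet> \<rho> - t)) * g2 (\<tau> * (x \<bullet> \<rho>'))"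
  let ?M = "lebesgue_on \<Omega>"
  note A = plane_function[OF g1', of ?k \<rho> t \<tau> \<rho>'] and B = plane_function[OF g2', of ?k \<rho> t \<tau> \<rho>']
  have d\<alpha>: "frechet_derivative ?\<alpha> (at x) \<rho> = exp (?k * (x \<bullet> \<rho> - t)) * (?k * g1 (\<tau> * (x \<bullet> \<rho>')))" for x
    unfolding A(2) using ortho by (simp add: dot_square_norm)
  have d\<beta>: "frechet_derivative ?\<beta> (at x) \<rho>' = - (exp (?k * (x \<bullet> \<rho> - t)) * (?k * g1 (\<tau> * (x \<bullet> \<rho>'))))"
      for x
    unfolding B(2) using ortho
    by (simp add: dot_square_norm inner_commute[of \<rho>' \<rho>]) (simp add: algebra_simps)
  note C = C1_D(1)[OF test_function_C1[OF \<phi>]]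
  have i: "integrable ?M (\<lambda>x. ?\<alpha> x * frechet_derivative \<phi> (at x) \<rho>)"
      "integrable ?M (\<lambda>x. ?\<beta> x * frechet_derivative \<phi> (at x) \<rho>')"
    by (intro integrable_mult_test[OF continuous_imp_L1_loc[OF C1_D(2)] \<Omega> \<phi>] A(1) B(1))+
  have "(\<integral>x. flux p (classical_grad u x) \<bullet> classical_grad \<phi> x \<partial>?M)
      = (\<integral>x. \<tau> powr (p - 1) * (?\<alpha> x * frechet_derivative \<phi> (at x) \<rho>
          + ?\<beta> x * frechet_derivative \<phi> (at x) \<rho>') \<partial>?M)"
  proof -
    have cg: "v \<bullet> classical_grad \<phi> x = frechet_derivative \<phi> (at x) v" for v x
      using classical_grad_inner[OF C] by (simp add: inner_commute)
    show ?thesis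
      unfolding wolff_flux unfolding inner_scaleR_left inner_add_left unfolding cg by (rule refl)
  qed
  also have "\<dots> = \<tau> powr (p - 1) * ((\<integral>x. ?\<alpha> x * frechet_derivative \<phi> (at x) \<rho> \<partial>?M)
      + (\<integral>x. ?\<beta> x * frechet_derivative \<phi> (at x) \<rho>' \<partial>?M))"
    using i by simp
  also have "(\<integral>x. ?\<alpha> x * frechet_derivative \<phi> (at x) \<rho> \<partial>?M)
      = - (\<integral>x. frechet_derivative ?\<alpha> (at x) \<rho> * \<phi> x \<partial>?M)"
    by (rule integral_by_parts_test_function[OF \<Omega> A(1) \<phi>])
  also have "(\<integral>x. ?\<beta> x * frechet_derivative \<phi> (at x) \<rho>' \<partial>?M)
      = - (\<integral>x. frechet_derivative ?\<beta> (at x) \<rho>' * \<phi> x \<partial>?M)"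
    by (rule integral_by_parts_test_function[OF \<Omega> B(1) \<phi>])
  also have "- (\<integral>x. frechet_derivative ?\<alpha> (at x) \<rho> * \<phi> x \<partial>?M)
      + - (\<integral>x. frechet_derivative ?\<beta> (at x) \<rho>' * \<phi> x \<partial>?M) = 0"
    unfolding d\<alpha> d\<beta> by simp
  finally show ?thesis by simp
qed

end

end

section \<open>The enclosure method\<close>

lemma Linfty_pos_imp_conductivity:
  assumes "sobolev_domain \<Omega> p" "\<sigma> \<in> Linfty_pos \<Omega>"
  obtains c C where "conductivity \<Omega> p \<sigma> c C"
proof -
  interpret sobolev_domain \<Omega> p by fact
  have m: "\<sigma> \<in> borel_measurable M" and sup: "esssup M (\<lambda>x. ereal \<bar>\<sigma> x\<bar>) < \<infinity>"
    and inf: "- esssup M (\<lambda>x. ereal (- \<sigma> x)) > 0"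
    using assms(2) by (auto simp: Linfty_pos_def essinf_def)
  obtain C where C: "AE x in M. \<sigma> x \<le> C"
  proof -
    obtain n :: nat where n: "esssup M (\<lambda>x. ereal \<bar>\<sigma> x\<bar>) < ereal (real n)"
      using less_PInf_Ex_of_nat[of "esssup M (\<lambda>x. ereal \<bar>\<sigma> x\<bar>)"] sup by auto
    have "AE x in M. \<sigma> x \<le> real n"
      using esssup_AE[of "\<lambda>x. ereal \<bar>\<sigma> x\<bar>" M]
    proof eventually_elim
      case (elim x)
      from le_less_trans[OF this n] show ?case by simp
    qed
    then show thesis by (rule that)
  qed
  obtain c where c: "c > 0" "AE x in M. c \<le> \<sigma> x"
  proof -
    have "esssup M (\<lambda>x. ereal (- \<sigma> x)) < 0" using inf by (simp add: ereal_less_uminus_reorder)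
    then obtain d where d: "esssup M (\<lambda>x. ereal (- \<sigma> x)) < ereal d" "ereal d < 0"
      using ereal_dense2[of "esssup M (\<lambda>x. ereal (- \<sigma> x))" 0] by auto
    have "AE x in M. - d \<le> \<sigma> x"
      using esssup_AE[of "\<lambda>x. ereal (- \<sigma> x)" M]
    proof eventually_elim
      case (elim x)
      from le_less_trans[OF this d(1)] show ?case by simp
    qed
    then show thesis using d(2) by (intro that[of "- d"]) auto
  qed
  have "conductivity \<Omega> p \<sigma> c C"
    by unfold_locales (use m c C in auto)
  then show thesis by (rule that)
qed

text \<open>Where \<^term>\<open>l x \<le> t\<close> the weight stays at most one. If \<^term>\<open>h\<close> has mass beyond the level
  \<^term>\<open>t\<close>, it already has mass beyond some strictly larger level, where the weight grows
  exponentially.\<close>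

lemma exp_weight_filterlim_iff:
  fixes h :: "'a::euclidean_space \<Rightarrow> real"
  assumes h: "integrable M h" "\<And>x. 0 \<le> h x" and k: "k > 0" and lm: "l \<in> borel_measurable M"
    and bounded: "\<And>x. x \<in> space M \<Longrightarrow> \<bar>l x\<bar> \<le> B"
  shows "filterlim (\<lambda>\<tau>. \<integral>x. h x * exp (k * \<tau> * (l x - t)) \<partial>M) at_top at_top
    \<longleftrightarrow> \<not> (AE x in M. l x > t \<longrightarrow> h x = 0)"
proof -
  have int: "integrable M (\<lambda>x. h x * exp (k * \<tau> * (l x - t)))" if "\<tau> > 0" for \<tau>
  proof (rule Bochner_Integration.integrable_bound)
    show "integrable M (\<lambda>x. exp (k * \<tau> * (\<bar>B\<bar> + \<bar>t\<bar>)) * h x)" using h by simp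
    show "(\<lambda>x. h x * exp (k * \<tau> * (l x - t))) \<in> borel_measurable M"
      using h(1) lm by measurable
    show "AE x in M. norm (h x * exp (k * \<tau> * (l x - t))) \<le> norm (exp (k * \<tau> * (\<bar>B\<bar> + \<bar>t\<bar>)) * h x)"
    proof (rule AE_I2)
      fix x assume "x \<in> space M"
      then have "l x - t \<le> \<bar>B\<bar> + \<bar>t\<bar>" using bounded[of x] by linarith
      then have "k * \<tau> * (l x - t) \<le> k * \<tau> * (\<bar>B\<bar> + \<bar>t\<bar>)" using k that by (intro mult_left_mono) auto
      then have "exp (k * \<tau> * (l x - t)) * h x \<le> exp (k * \<tau> * (\<bar>B\<bar> + \<bar>t\<bar>)) * h x"
        using h(2)[of x] by (intro mult_right_mono) auto
      then show "norm (h x * exp (k * \<tau> * (l x - t))) \<le> norm (exp (k * \<tau> * (\<bar>B\<bar> + \<bar>t\<bar>)) * h x)"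
        using h(2)[of x] by (simp add: abs_mult mult.commute)
    qed
  qed
  show ?thesis
  proof
    assume lim: "filterlim (\<lambda>\<tau>. \<integral>x. h x * exp (k * \<tau> * (l x - t)) \<partial>M) at_top at_top"
    show "\<not> (AE x in M. l x > t \<longrightarrow> h x = 0)"
    proof
      assume ae: "AE x in M. l x > t \<longrightarrow> h x = 0"
      have le: "(\<integral>x. h x * exp (k * \<tau> * (l x - t)) \<partial>M) \<le> (\<integral>x. h x \<partial>M)" if "\<tau> > 0" for \<tau>
      proof (rule integral_mono_AE[OF int[OF that] h(1)])
        show "AE x in M. h x * exp (k * \<tau> * (l x - t)) \<le> h x"
          using ae
        proof eventually_elim
          case (elim x)
          show ?case
          proof (cases "l x > t")
            case True
            then show ?thesis using elim by simp
          next
            case False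
            then have "k * \<tau> * (l x - t) \<le> 0" using k that by (intro mult_nonneg_nonpos) auto
            then show ?thesis using h(2)[of x] by (intro mult_left_le) auto
          qed
        qed
      qed
      have "\<forall>\<^sub>F \<tau> in at_top. (\<integral>x. h x \<partial>M) < (\<integral>x. h x * exp (k * \<tau> * (l x - t)) \<partial>M)"
        using lim by (simp add: filterlim_at_top_dense)
      then have "\<forall>\<^sub>F \<tau> in at_top. (\<tau>::real) \<le> 0"
      proof eventually_elim
        case (elim \<tau>)
        show "\<tau> \<le> 0"
          using le[of \<tau>] elim by (cases "\<tau> > 0") auto
      qed
      then obtain T where "\<And>\<tau>::real. \<tau> \<ge> T \<Longrightarrow> \<tau> \<le> 0" by (auto simp: eventually_at_top_linorder)
      from this[of "max T 1"] show False by simp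
    qed
  next
    assume nae: "\<not> (AE x in M. l x > t \<longrightarrow> h x = 0)"
    obtain n :: nat where n: "\<not> (AE x in M. l x > t + 1 / real (Suc n) \<longrightarrow> h x = 0)"
    proof (rule ccontr)
      assume "\<not> thesis"
      with that have "\<forall>n. AE x in M. l x > t + 1 / real (Suc n) \<longrightarrow> h x = 0"
        by blast
      then have "AE x in M. \<forall>n. l x > t + 1 / real (Suc n) \<longrightarrow> h x = 0"
        unfolding AE_all_countable .
      then have "AE x in M. l x > t \<longrightarrow> h x = 0"
      proof eventually_elim
        case (elim x)
        show ?case
        proof
          assume "l x > t"
          then obtain n where "1 / real (Suc n) < l x - t" using nat_approx_posE[of "l x - t"] by auto
          with elim show "h x = 0" by (auto simp: less_diff_eq add.commute)
        qed
      qed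
      with nae show False ..
    qed
    define \<delta> where "\<delta> = 1 / real (Suc n)"
    have \<delta>: "\<delta> > 0" by (simp add: \<delta>_def)
    define S where "S = {x \<in> space M. l x > t + \<delta>}"
    have S: "S \<in> sets M" unfolding S_def using lm by measurable
    define m where "m = (\<integral>x. indicator S x * h x \<partial>M)"
    have iS: "integrable M (\<lambda>x. indicator S x * h x)"
      using integrable_mult_indicator[OF S h(1)] by simp
    have "m > 0"
    proof -
      have "m \<noteq> 0"
      proof
        assume "m = 0"
        then have "AE x in M. indicator S x * h x = 0"
          using integral_nonneg_eq_0_iff_AE[OF iS] h(2) by (simp add: m_def)
        moreover have "AE x in M. x \<in> space M" by (rule AE_space)
        ultimately have "AE x in M. l x > t + \<delta> \<longrightarrow> h x = 0"
          by eventually_elim (auto simp: S_def indicator_def split: if_splits)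
        with n show False by (simp add: \<delta>_def)
      qed
      moreover have "m \<ge> 0" unfolding m_def by (rule integral_nonneg_AE) (use h(2) in auto)
      ultimately show ?thesis by simp
    qed
    have ge: "m * exp (k * \<delta> * \<tau>) \<le> (\<integral>x. h x * exp (k * \<tau> * (l x - t)) \<partial>M)" if "\<tau> > 0" for \<tau>
    proof -
      have "m * exp (k * \<delta> * \<tau>) = (\<integral>x. exp (k * \<delta> * \<tau>) * (indicator S x * h x) \<partial>M)"
        unfolding m_def by simp
      also have "\<dots> \<le> (\<integral>x. h x * exp (k * \<tau> * (l x - t)) \<partial>M)"
      proof (rule integral_mono)
        show "integrable M (\<lambda>x. exp (k * \<delta> * \<tau>) * (indicator S x * h x))"
          using iS by simp
        show "integrable M (\<lambda>x. h x * exp (k * \<tau> * (l x - t)))" by (rule int[OF that])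
        fix x assume "x \<in> space M"
        show "exp (k * \<delta> * \<tau>) * (indicator S x * h x) \<le> h x * exp (k * \<tau> * (l x - t))"
        proof (cases "x \<in> S")
          case True
          then have "k * \<tau> * \<delta> \<le> k * \<tau> * (l x - t)"
            using k that by (intro mult_left_mono) (auto simp: S_def)
          then have "exp (k * \<delta> * \<tau>) \<le> exp (k * \<tau> * (l x - t))" by (simp add: mult_ac)
          then have "exp (k * \<delta> * \<tau>) * h x \<le> exp (k * \<tau> * (l x - t)) * h x"
            using h(2) by (rule mult_right_mono)
          then show ?thesis using True by (simp add: mult.commute)
        next
          case False
          then show ?thesis using h(2)[of x] by simp
        qed
      qed
      finally show ?thesis .
    qed
    have "filterlim (\<lambda>\<tau>. m * exp (k * \<delta> * \<tau>)) at_top at_top"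
    proof (rule filterlim_tendsto_pos_mult_at_top[OF tendsto_const \<open>m > 0\<close>])
      show "filterlim (\<lambda>\<tau>. exp (k * \<delta> * \<tau>)) at_top at_top"
        using k \<delta> by (intro filterlim_compose[OF exp_at_top] filterlim_tendsto_pos_mult_at_top[OF
            tendsto_const _ filterlim_ident]) auto
    qed
    then show "filterlim (\<lambda>\<tau>. \<integral>x. h x * exp (k * \<tau> * (l x - t)) \<partial>M) at_top at_top"
      by (rule filterlim_at_top_mono) (use ge in \<open>auto intro: eventually_mono[OF
          eventually_gt_at_top[of 0]]\<close>)
  qed
qed

lemma filterlim_at_top_comparable:
  fixes f g :: "real \<Rightarrow> real"
  assumes "\<kappa> > 0" "\<And>\<tau>. \<tau> > 0 \<Longrightarrow> \<kappa> * f \<tau> \<le> g \<tau>" "\<And>\<tau>. \<tau> > 0 \<Longrightarrow> g \<tau> \<le> K * f \<tau>" "\<And>\<tau>. \<tau> > 0 \<Longrightarrow> 0 \<le> f \<tau>"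
  shows "filterlim g at_top at_top \<longleftrightarrow> filterlim f at_top at_top"
proof
  assume "filterlim f at_top at_top"
  then have "filterlim (\<lambda>\<tau>. \<kappa> * f \<tau>) at_top at_top"
    by (rule filterlim_tendsto_pos_mult_at_top[OF tendsto_const assms(1)])
  then show "filterlim g at_top at_top"
    by (rule filterlim_at_top_mono) (use assms(2) in \<open>auto intro: eventually_mono[OF
        eventually_gt_at_top[of 0]]\<close>)
next
  assume g: "filterlim g at_top at_top"
  define L where "L = 1 / max K 1"
  have L: "L > 0" by (simp add: L_def)
  have le: "L * g \<tau> \<le> f \<tau>" if "\<tau> > 0" for \<tau>
  proof -
    have "g \<tau> \<le> max K 1 * f \<tau>"
      using assms(3)[OF that] mult_right_mono[OF max.cobounded1[of K 1] assms(4)[OF that]] by linarith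
    then show ?thesis by (simp add: L_def divide_le_eq mult.commute less_max_iff_disj)
  qed
  from g have "filterlim (\<lambda>\<tau>. L * g \<tau>) at_top at_top"
    by (rule filterlim_tendsto_pos_mult_at_top[OF tendsto_const L])
  then show "filterlim f at_top at_top"
    by (rule filterlim_at_top_mono) (use le in \<open>auto intro: eventually_mono[OF
        eventually_gt_at_top[of 0]]\<close>)
qed

text \<open>The factor \<^term>\<open>\<tau> powr (- p)\<close> in the indicator function compensates the frequency in the
  gradient of the Wolff solution, and the oscillating factor of the gradient is bounded above and
  below. What remains of the indicator function is comparable to the integral of
  \<^term>\<open>\<bar>\<sigma> x - 1\<bar>\<close> with the weight \<^term>\<open>exp (p * \<tau> * (x \<bullet> \<rho> - t))\<close>.\<close>

lemma indicator_fn_filterlim_iff: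
  fixes \<Omega> :: "'a::euclidean_space set"
  assumes dom: "sobolev_domain \<Omega> p" and \<sigma>: "\<sigma> \<in> Linfty_pos \<Omega>"
    and sign: "(AE x in lebesgue_on \<Omega>. \<sigma> x \<ge> 1) \<or> (AE x in lebesgue_on \<Omega>. \<sigma> x \<le> 1)"
    and ode: "wolff_ode p a b w"
    and ortho: "norm \<rho> = 1" "norm (perp \<rho>) = 1" "\<rho> \<bullet> perp \<rho> = 0"
  shows "filterlim (\<lambda>\<tau>. \<bar>indicator_fn \<Omega> p \<sigma> w perp \<rho> t \<tau>\<bar>) at_top at_top
    \<longleftrightarrow> \<not> (AE x in lebesgue_on \<Omega>. x \<bullet> \<rho> > t \<longrightarrow> \<sigma> x = 1)"
proof -
  obtain c C where "conductivity \<Omega> p \<sigma> c C"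
    using Linfty_pos_imp_conductivity[OF dom \<sigma>] .
  then interpret conductivity \<Omega> p \<sigma> c C .
  interpret ode: wolff_ode p a b w by fact
  obtain lo hi where R: "0 < lo" "\<And>s. lo \<le> ode.R s \<and> ode.R s \<le> hi"
    using ode.R_bounds by blast
  let ?u = "\<lambda>\<tau>. wolff_solution w \<rho> (perp \<rho>) t \<tau>"
  let ?f = "\<lambda>\<tau>. bdry_class \<Omega> p (?u \<tau>)"
  obtain \<kappa> K where \<kappa>: "\<kappa> > 0" and comp: "\<And>u0. u0 \<in> W1p \<Omega> p \<Longrightarrow>
    (\<And>\<psi>. \<psi> \<in> W0p \<Omega> p \<Longrightarrow> (\<integral>x. flux p (weak_grad \<Omega> u0 x) \<bullet> weak_grad \<Omega> \<psi> x \<partial>M) = 0) \<Longrightarrow>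
    \<kappa> * (\<integral>x. \<bar>\<sigma> x - 1\<bar> * norm (weak_grad \<Omega> u0 x) powr p \<partial>M)
      \<le> \<bar>DN_map \<Omega> p \<sigma> (bdry_class \<Omega> p u0) (bdry_class \<Omega> p u0)
        - DN_map \<Omega> p (\<lambda>_. 1) (bdry_class \<Omega> p u0) (bdry_class \<Omega> p u0)\<bar> \<and>
    \<bar>DN_map \<Omega> p \<sigma> (bdry_class \<Omega> p u0) (bdry_class \<Omega> p u0)
        - DN_map \<Omega> p (\<lambda>_. 1) (bdry_class \<Omega> p u0) (bdry_class \<Omega> p u0)\<bar>
      \<le> K * (\<integral>x. \<bar>\<sigma> x - 1\<bar> * norm (weak_grad \<Omega> u0 x) powr p \<partial>M)"
    using DN_difference_comparable[OF sign] by blast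
  let ?J = "\<lambda>\<tau>. \<integral>x. \<bar>\<sigma> x - 1\<bar> * exp (p * \<tau> * (x \<bullet> \<rho> - t)) \<partial>M"
  let ?W = "\<lambda>\<tau>. \<integral>x. \<bar>\<sigma> x - 1\<bar> * (exp (p * \<tau> * (x \<bullet> \<rho> - t)) * ode.R (\<tau> * (x \<bullet> perp \<rho>)) powr (p / 2)) \<partial>M"
  have dev_m: "(\<lambda>x. \<bar>\<sigma> x - 1\<bar>) \<in> borel_measurable M"
    using \<sigma>_measurable by measurable
  have dev_b: "AE x in M. \<bar>\<bar>\<sigma> x - 1\<bar>\<bar> \<le> C + 1"
    using \<sigma>_bounds by eventually_elim (use c_pos in auto)
  have dev_int: "integrable M (\<lambda>x. \<bar>\<sigma> x - 1\<bar> * g x)"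
    if "integrable M g" for g
  proof (rule Bochner_Integration.integrable_bound)
    show "integrable M (\<lambda>x. (C + 1) * g x)" using that by simp
    show "(\<lambda>x. \<bar>\<sigma> x - 1\<bar> * g x) \<in> borel_measurable M"
      using dev_m borel_measurable_integrable[OF that] by (rule borel_measurable_times)
    show "AE x in M. norm (\<bar>\<sigma> x - 1\<bar> * g x) \<le> norm ((C + 1) * g x)"
      using dev_b by eventually_elim (auto simp: abs_mult intro!: mult_right_mono)
  qed
  have cont: "continuous_on UNIV (\<lambda>x. exp (p * \<tau> * (x \<bullet> \<rho> - t)))" for \<tau>
    by (intro continuous_intros)
  have cont_int: "integrable M g" if "continuous_on UNIV g" for g :: "'a \<Rightarrow> real"
    by (rule Lp_integrable[OF continuous_Lp[OF that]])
  have contR: "continuous_on UNIV (\<lambda>x. exp (p * \<tau> * (x \<bullet> \<rho> - t)) * ode.R (\<tau>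
      * (x \<bullet> perp \<rho>)) powr (p / 2))" for \<tau>
  proof -
    have "continuous_on UNIV ode.R"
      by (intro continuous_at_imp_continuous_on ballI DERIV_isCont[OF ode.R_derivative])
    then have "continuous_on UNIV (\<lambda>x. ode.R (\<tau> * (x \<bullet> perp \<rho>)))"
      by (rule continuous_on_compose2) (auto intro!: continuous_intros)
    moreover have "ode.R s \<noteq> 0" for s using ode.R_pos[of s] by simp
    ultimately show ?thesis by (intro continuous_intros) auto
  qed
  have I: "\<kappa> * ?W \<tau> \<le> \<bar>indicator_fn \<Omega> p \<sigma> w perp \<rho> t \<tau>\<bar> \<and> \<bar>indicator_fn \<Omega> p \<sigma> w perp \<rho> t \<tau>\<bar> \<le> K * ?W \<tau>"
    if \<tau>: "\<tau> > 0" for \<tau>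
  proof -
    note C1 = ode.wolff_C1[OF ortho \<tau>, of t]
    note W = C1_W1p[OF C1]
    have harm: "(\<integral>x. flux p (weak_grad \<Omega> (?u \<tau>) x) \<bullet> weak_grad \<Omega> \<psi> x \<partial>M) = 0" if "\<psi> \<in> W0p \<Omega> p" for \<psi>
    proof (rule flux_orthogonal_W0p[OF W1pD(2)[OF W(1)] _ that])
      fix \<phi> assume \<phi>: "\<phi> \<in> test_functions \<Omega>"
      note P = C1_W1p[OF test_function_C1[OF \<phi>]]
      have "(\<integral>x. flux p (weak_grad \<Omega> (?u \<tau>) x) \<bullet> weak_grad \<Omega> \<phi> x \<partial>M)
          = (\<integral>x. flux p (classical_grad (?u \<tau>) x) \<bullet> classical_grad \<phi> x \<partial>M)"
      proof (rule integral_cong_AE)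
        show "AE x in M. flux p (weak_grad \<Omega> (?u \<tau>) x) \<bullet> weak_grad \<Omega> \<phi> x
            = flux p (classical_grad (?u \<tau>) x) \<bullet> classical_grad \<phi> x"
          using W(2) P(2) by eventually_elim simp
        show "(\<lambda>x. flux p (weak_grad \<Omega> (?u \<tau>) x) \<bullet> weak_grad \<Omega> \<phi> x) \<in> borel_measurable M"
          using flux_Lp_integrable[OF W1pD(2)[OF W(1)] W1pD(2)[OF P(1)], of "\<lambda>_. 1" 1] by auto
        show "(\<lambda>x. flux p (classical_grad (?u \<tau>) x) \<bullet> classical_grad \<phi> x) \<in> borel_measurable M"
          using flux_Lp_integrable[OF continuous_Lp[OF continuous_classical_grad[OF C1]]
              continuous_Lp[OF continuous_classical_grad[OF test_function_C1[OF \<phi>]]], of "\<lambda>_. 1"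
                  1] by auto
      qed
      also have "\<dots> = 0" by (rule ode.wolff_p_harmonic[OF ortho \<tau> open_dom \<phi>])
      finally show "(\<integral>x. flux p (weak_grad \<Omega> (?u \<tau>) x) \<bullet> weak_grad \<Omega> \<phi> x \<partial>M) = 0" .
    qed
    have "(\<integral>x. \<bar>\<sigma> x - 1\<bar> * norm (weak_grad \<Omega> (?u \<tau>) x) powr p \<partial>M)
        = (\<integral>x. \<bar>\<sigma> x - 1\<bar> * norm (classical_grad (?u \<tau>) x) powr p \<partial>M)"
    proof (rule integral_cong_AE)
      show "AE x in M. \<bar>\<sigma> x - 1\<bar> * norm (weak_grad \<Omega> (?u \<tau>) x) powr p
          = \<bar>\<sigma> x - 1\<bar> * norm (classical_grad (?u \<tau>) x) powr p"
        using W(2) by eventually_elim simp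
    qed (intro borel_measurable_times dev_m borel_measurable_norm_powr LpD(1) W1pD(2)[OF W(1)]
        continuous_Lp continuous_classical_grad C1)+
    also have "\<dots> = \<tau> powr p * ?W \<tau>"
      unfolding ode.norm_wolff_grad_powr[OF ortho \<tau>]
          by (simp add: mult_ac flip: integral_mult_right_zero)
    finally have J: "(\<integral>x. \<bar>\<sigma> x - 1\<bar> * norm (weak_grad \<Omega> (?u \<tau>) x) powr p \<partial>M) = \<tau> powr p * ?W \<tau>" .
    let ?D = "DN_map \<Omega> p \<sigma> (?f \<tau>) (?f \<tau>) - DN_map \<Omega> p (\<lambda>_. 1) (?f \<tau>) (?f \<tau>)"
    have ind: "\<bar>indicator_fn \<Omega> p \<sigma> w perp \<rho> t \<tau>\<bar> = \<tau> powr (- p) * \<bar>?D\<bar>"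
      by (simp add: indicator_fn_def Let_def abs_mult)
    have one: "\<tau> powr (- p) * \<tau> powr p = 1" using \<tau> by (simp flip: powr_add)
    have D: "\<kappa> * (\<tau> powr p * ?W \<tau>) \<le> \<bar>?D\<bar>" "\<bar>?D\<bar> \<le> K * (\<tau> powr p * ?W \<tau>)"
      using comp[OF W(1) harm] unfolding J by auto
    have eq: "\<tau> powr (- p) * (z * (\<tau> powr p * y)) = z * y" for z y
      using one by (metis mult.assoc mult.commute mult.left_neutral)
    show ?thesis
      using mult_left_mono[OF D(1), of "\<tau> powr (- p)"] mult_left_mono[OF D(2), of "\<tau> powr (- p)"]
      unfolding ind eq by simp
  qed
  have JW: "lo powr (p / 2) * ?J \<tau> \<le> ?W \<tau>" "?W \<tau> \<le> hi powr (p / 2) * ?J \<tau>" for \<tau>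
  proof -
    have b: "lo powr (p / 2) \<le> ode.R s powr (p / 2)" "ode.R s powr (p / 2) \<le> hi powr (p / 2)" for s
      using R(2)[of s] R(1) p by (auto intro!: powr_mono2)
    have "lo powr (p / 2) * ?J \<tau> = (\<integral>x. \<bar>\<sigma> x - 1\<bar> * (exp (p * \<tau> * (x \<bullet> \<rho> - t)) * lo powr (p / 2)) \<partial>M)"
      by (simp add: mult_ac flip: integral_mult_right_zero)
    also have "\<dots> \<le> ?W \<tau>"
      by (rule integral_mono) (intro dev_int cont_int contR continuous_intros mult_left_mono b; simp)+
    finally show "lo powr (p / 2) * ?J \<tau> \<le> ?W \<tau>" .
    have "?W \<tau> \<le> (\<integral>x. \<bar>\<sigma> x - 1\<bar> * (exp (p * \<tau> * (x \<bullet> \<rho> - t)) * hi powr (p / 2)) \<partial>M)"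
      by (rule integral_mono) (intro dev_int cont_int contR continuous_intros mult_left_mono b; simp)+
    also have "\<dots> = hi powr (p / 2) * ?J \<tau>"
      by (simp add: mult_ac flip: integral_mult_right_zero)
    finally show "?W \<tau> \<le> hi powr (p / 2) * ?J \<tau>" .
  qed
  have J0: "0 \<le> ?J \<tau>" "0 \<le> ?W \<tau>" for \<tau> by (rule integral_nonneg_AE, simp)+
  have "filterlim (\<lambda>\<tau>. \<bar>indicator_fn \<Omega> p \<sigma> w perp \<rho> t \<tau>\<bar>) at_top at_top \<longleftrightarrow> filterlim ?W at_top at_top"
    by (rule filterlim_at_top_comparable[OF \<kappa>]) (use I J0 in auto)
  also have "\<dots> \<longleftrightarrow> filterlim ?J at_top at_top"
    by (rule filterlim_at_top_comparable[of "lo powr (p / 2)"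
        _ _ "hi powr (p / 2)"]) (use JW J0 R(1) in auto)
  also have "\<dots> \<longleftrightarrow> \<not> (AE x in M. x \<bullet> \<rho> > t \<longrightarrow> \<bar>\<sigma> x - 1\<bar> = 0)"
  proof -
    obtain B where "\<And>x. x \<in> \<Omega> \<Longrightarrow> norm x \<le> B" using bounded_dom unfolding bounded_iff by blast
    then have B: "\<bar>x \<bullet> \<rho>\<bar> \<le> B" if "x \<in> space M" for x
      using that Cauchy_Schwarz_ineq2[of x \<rho>] ortho(1) by force
    have "integrable M (\<lambda>x. \<bar>\<sigma> x - 1\<bar>)" using dev_int[OF integrable_const_dom[of 1]] by simp
    moreover have "(\<lambda>x. x \<bullet> \<rho>) \<in> borel_measurable M"
      by (rule LpD(1)[OF continuous_Lp]) (intro continuous_intros)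
    ultimately show ?thesis
      using exp_weight_filterlim_iff[of M "\<lambda>x. \<bar>\<sigma> x - 1\<bar>" p "\<lambda>x. x \<bullet> \<rho>" B t] B p by simp
  qed
  finally show ?thesis by simp
qed

text \<open>The union of all open sets on which the function vanishes almost everywhere is already a
  countable union, by Lindelof's theorem; so the function vanishes almost everywhere on it.\<close>

lemma ess_supp_null_iff:
  fixes \<Omega> :: "'a::euclidean_space set"
  assumes \<Omega>: "open \<Omega>" and H: "closed H"
  shows "ess_supp \<Omega> f - H \<in> null_sets lebesgue \<longleftrightarrow> (AE x in lebesgue_on \<Omega>. x \<notin> H \<longrightarrow> f x = 0)"
proof -
  define \<G> where "\<G> = {G. open G \<and> G \<subseteq> \<Omega> \<and> (AE x in lebesgue_on G. f x = 0)}"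
  have D: "ess_supp \<Omega> f = \<Omega> - \<Union>\<G>" by (simp add: ess_supp_def \<G>_def)
  have AE_open: "(AE x in lebesgue_on G. P x) \<longleftrightarrow> (AE x in lebesgue. x \<in> G \<longrightarrow> P x)" if "open G"
      for G :: "'a set" and P
    using that by (intro AE_restrict_space_iff) simp
  show ?thesis
  proof
    assume null: "ess_supp \<Omega> f - H \<in> null_sets lebesgue"
    obtain \<G>' where \<G>': "\<G>' \<subseteq> \<G>" "countable \<G>'" "\<Union>\<G>' = \<Union>\<G>"
      using Lindelof[of \<G>] by (auto simp: \<G>_def)
    have "AE x in lebesgue. \<forall>G\<in>\<G>'. x \<in> G \<longrightarrow> f x = 0"
      unfolding AE_ball_countable[OF \<G>'(2)]
    proof
      fix G assume "G \<in> \<G>'"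
      then have "open G" "AE x in lebesgue_on G. f x = 0" using \<G>'(1) by (auto simp: \<G>_def)
      then show "AE x in lebesgue. x \<in> G \<longrightarrow> f x = 0" by (simp add: AE_open)
    qed
    moreover have "AE x in lebesgue. x \<notin> ess_supp \<Omega> f - H" using null by (rule AE_not_in)
    ultimately have "AE x in lebesgue. x \<in> \<Omega> \<longrightarrow> x \<notin> H \<longrightarrow> f x = 0"
      by eventually_elim (use D \<G>'(3) in blast)
    then show "AE x in lebesgue_on \<Omega>. x \<notin> H \<longrightarrow> f x = 0" by (simp add: AE_open[OF \<Omega>])
  next
    assume ae: "AE x in lebesgue_on \<Omega>. x \<notin> H \<longrightarrow> f x = 0"
    have "open (\<Omega> - H)" using \<Omega> H by (rule open_Diff)
    moreover have "AE x in lebesgue_on (\<Omega> - H). f x = 0"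
      using ae by (simp add: AE_open[OF \<Omega>] AE_open[OF \<open>open (\<Omega> - H)\<close>]) (auto elim: eventually_mono)
    ultimately have "\<Omega> - H \<in> \<G>" by (auto simp: \<G>_def)
    then have e: "ess_supp \<Omega> f - H = {}" unfolding D by blast
    show "ess_supp \<Omega> f - H \<in> null_sets lebesgue" unfolding e by simp
  qed
qed

text \<open>For a unit vector \<^term>\<open>\<rho>\<close> the set under the closure is the open half-space below the
  essential supremum of \<^term>\<open>\<lambda>y. y \<bullet> \<rho>\<close> over the support, to be read as empty or everything if
  the supremum is infinite; its closure is the intersection of the admissible closed half-spaces
  with normal \<^term>\<open>\<rho>\<close>. A non-zero vector contributes the same half-spaces as its normalisation.
  The zero vector contributes the empty set exactly if the function vanishes almost everywhere, and
  then the sets under the closure are empty as well.\<close>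

lemma ess_conv_ess_supp:
  fixes \<Omega> :: "'a::euclidean_space set"
  assumes \<Omega>: "open \<Omega>"
  shows "ess_conv (ess_supp \<Omega> f) = (\<Inter>\<rho>\<in>{\<rho>. norm \<rho> = 1}. closure
    {x. \<not> (AE y in lebesgue_on \<Omega>. y \<bullet> \<rho> > x \<bullet> \<rho> \<longrightarrow> f y = 0)})"
proof -
  define S where "S \<rho> t \<longleftrightarrow> (AE y in lebesgue_on \<Omega>. y \<bullet> \<rho> > t \<longrightarrow> f y = 0)" for \<rho> :: 'a and t
  have half: "ess_supp \<Omega> f - {x. x \<bullet> \<rho> \<le> t} \<in> null_sets lebesgue \<longleftrightarrow> S \<rho> t" for \<rho> t
    using ess_supp_null_iff[OF \<Omega> closed_Collect_le[of "\<lambda>x. x \<bullet> \<rho>" "\<lambda>_. t"], of f]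
    by (simp add: S_def not_le continuous_on_inner)
  have conv: "y \<in> ess_conv (ess_supp \<Omega> f) \<longleftrightarrow> (\<forall>\<rho> t. S \<rho> t \<longrightarrow> y \<bullet> \<rho> \<le> t)" for y
  proof
    assume y: "y \<in> ess_conv (ess_supp \<Omega> f)"
    show "\<forall>\<rho> t. S \<rho> t \<longrightarrow> y \<bullet> \<rho> \<le> t"
    proof (intro allI impI)
      fix \<rho> t assume "S \<rho> t"
      then have "y \<in> {x. x \<bullet> \<rho> \<le> t}"
        using y half unfolding ess_conv_def by blast
      then show "y \<bullet> \<rho> \<le> t" by simp
    qed
  next
    assume "\<forall>\<rho> t. S \<rho> t \<longrightarrow> y \<bullet> \<rho> \<le> t"
    then show "y \<in> ess_conv (ess_supp \<Omega> f)"
      using half unfolding ess_conv_def by blast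
  qed
  have mono: "S \<rho> t" if "S \<rho> s" "s \<le> t" for \<rho> s t
    using that(1) unfolding S_def by (rule eventually_mono) (use that(2) in auto)
  have scale: "S ((1 / norm \<rho>) *\<^sub>R \<rho>) (t / norm \<rho>) \<longleftrightarrow> S \<rho> t" if "\<rho> \<noteq> 0" for \<rho> t
    using that by (simp add: S_def divide_less_cancel)
  have sub: "closure {x. \<not> S \<rho> (x \<bullet> \<rho>)} \<subseteq> {x. x \<bullet> \<rho> \<le> t}" if "S \<rho> t" for \<rho> t
  proof (rule closure_minimal)
    show "{x. \<not> S \<rho> (x \<bullet> \<rho>)} \<subseteq> {x. x \<bullet> \<rho> \<le> t}"
      using mono[OF that] linear by blast
    show "closed {x. x \<bullet> \<rho> \<le> t}" by (intro closed_Collect_le continuous_intros)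
  qed
  have "y \<in> ess_conv (ess_supp \<Omega> f) \<longleftrightarrow> (\<forall>\<rho>. norm \<rho> = 1 \<longrightarrow> y \<in> closure {x. \<not> S \<rho> (x \<bullet> \<rho>)})" for y
  proof
    assume y: "y \<in> ess_conv (ess_supp \<Omega> f)"
    show "\<forall>\<rho>. norm \<rho> = 1 \<longrightarrow> y \<in> closure {x. \<not> S \<rho> (x \<bullet> \<rho>)}"
    proof (intro allI impI)
      fix \<rho> :: 'a assume \<rho>: "norm \<rho> = 1"
      define z where "z n = y - (1 / real (Suc n)) *\<^sub>R \<rho>" for n
      have "z n \<in> {x. \<not> S \<rho> (x \<bullet> \<rho>)}" for n
      proof -
        have "z n \<bullet> \<rho> < y \<bullet> \<rho>" using \<rho> by (simp add: z_def inner_diff_left dot_square_norm)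
        then show ?thesis using y unfolding conv by force
      qed
      moreover have "z \<longlonglongrightarrow> y - 0 *\<^sub>R \<rho>"
        unfolding z_def by (intro tendsto_intros LIMSEQ_Suc[OF lim_1_over_n])
      ultimately show "y \<in> closure {x. \<not> S \<rho> (x \<bullet> \<rho>)}"
        unfolding closure_sequential by auto
    qed
  next
    assume y: "\<forall>\<rho>. norm \<rho> = 1 \<longrightarrow> y \<in> closure {x. \<not> S \<rho> (x \<bullet> \<rho>)}"
    show "y \<in> ess_conv (ess_supp \<Omega> f)"
      unfolding conv
    proof (intro allI impI)
      fix \<rho> t assume S: "S \<rho> t"
      show "y \<bullet> \<rho> \<le> t"
      proof (cases "\<rho> = 0")
        case True
        show ?thesis
        proof (rule ccontr)
          assume "\<not> y \<bullet> \<rho> \<le> t"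
          then have "AE x in lebesgue_on \<Omega>. f x = 0" using S True by (simp add: S_def)
          then have all: "S e s" for e s unfolding S_def by (rule eventually_mono) simp
          obtain e :: 'a where "e \<in> Basis" using nonempty_Basis by blast
          then have "y \<in> closure {x. \<not> S e (x \<bullet> e)}" using y by simp
          then show False using all by simp
        qed
      next
        case False
        define e where "e = (1 / norm \<rho>) *\<^sub>R \<rho>"
        have "norm e = 1" using False by (simp add: e_def)
        then have "y \<in> closure {x. \<not> S e (x \<bullet> e)}" using y by blast
        moreover have "S e (t / norm \<rho>)" using S scale[OF False] by (simp add: e_def)
        ultimately have "y \<bullet> e \<le> t / norm \<rho>" using sub by blast
        then show ?thesis using False by (simp add: e_def divide_le_cancel)
      qed
    qed
  qed
  then show ?thesis unfolding S_def[symmetric] by auto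
qed

theorem theorem4p1:
  fixes \<Omega> :: "(real ^ 'n) set"
    and p a\<^sub>0 b\<^sub>0 :: real
    and \<sigma> :: "real ^ 'n \<Rightarrow> real"
    and w :: "real \<Rightarrow> real"
    and perp :: "real ^ 'n \<Rightarrow> real ^ 'n"
  assumes "CARD('n) \<ge> 2"
    and "1 < p"
    and "open \<Omega>" and "bounded \<Omega>"
    and "\<sigma> \<in> Linfty_pos \<Omega>"
    and "(AE x in lebesgue_on \<Omega>. \<sigma> x \<ge> 1) \<or> (AE x in lebesgue_on \<Omega>. \<sigma> x \<le> 1)"
    and "(a\<^sub>0, b\<^sub>0) \<noteq> (0, 0)"
    and "wolff_profile p a\<^sub>0 b\<^sub>0 w"
    and "\<And>\<rho>. norm \<rho> = 1 \<Longrightarrow> norm (perp \<rho>) = 1 \<and> \<rho> \<bullet> perp \<rho> = 0"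
  shows "ess_conv (ess_supp \<Omega> (\<lambda>x. \<sigma> x - 1)) =
    (\<Inter>\<rho>\<in>{\<rho>. norm \<rho> = 1}. closure
      {x. filterlim (\<lambda>\<tau>. \<bar>indicator_fn \<Omega> p \<sigma> w perp \<rho> (x \<bullet> \<rho>) \<tau>\<bar>) at_top at_top})"
proof -
  have dom: "sobolev_domain \<Omega> p" using assms(2-4) by unfold_locales
  have ode: "wolff_ode p a\<^sub>0 b\<^sub>0 w" using assms(2,7,8) by unfold_locales
  have "filterlim (\<lambda>\<tau>. \<bar>indicator_fn \<Omega> p \<sigma> w perp \<rho> t \<tau>\<bar>) at_top at_top
      \<longleftrightarrow> \<not> (AE y in lebesgue_on \<Omega>. y \<bullet> \<rho> > t \<longrightarrow> \<sigma> y - 1 = 0)" if "norm \<rho> = 1" for \<rho> t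
    using indicator_fn_filterlim_iff[where perp=perp, OF dom assms(5,6) ode that] assms(9)[OF that] by simp
  then show ?thesis
    unfolding ess_conv_ess_supp[OF assms(3)] by (intro INF_cong) auto
qed

end
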